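(* Let $G$ be a torsion-free abelian group. (1) If $R$ is a Noetherian $G$-graded ring, then $\operatorname{rank}_{\mathbb{Z}} \mathbb{Z}\operatorname{Supp}(R)<\infty$. (2) If $\operatorname{rank}_{\mathbb{Z}} G<\infty$, then there is a Noetherian $G$-graded ring $R$ with $\operatorname{Supp}(R)=G$. In particular, $\mathbb{Z}\operatorname{Supp}(R)=G$.
   Context: All rings are commutative with identity. For an abelian group $(G,+)$, a $G$-graded ring is a ring $R=\bigoplus_{g\in G}R_g$ (direct sum of additive subgroups) with $R_gR_h\subset R_{g+h}$ for all $g,h\in G$. $\operatorname{Supp}(R)=\{g\in G: R_g\neq 0\}$ and $\mathbb{Z}\operatorname{Supp}(R)$ is the subgroup of $G$ generated by $\operatorname{Supp}(R)$. The rank of an abelian group $H$ is $\operatorname{rank}_{\mathbb{Z}}H=\dim_{\mathbb{Q}}(\mathbb{Q}\otimes_{\mathbb{Z}}H)$. "Noetherian" means Noetherian as an ungraded ring. *)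

theory Defs
  imports
    "HOL-Algebra.Ring_Divisibility"
    "HOL-Algebra.Free_Abelian_Groups"
    "HOL-Library.Extended_Nat"
    "Jordan_Normal_Form.VS_Connect"
begin

text \<open>
  The grading group is a multiplicatively written structure of \<open>HOL-Algebra\<close>, so \<open>g + h\<close>
  becomes \<open>g \<otimes>\<^bsub>G\<^esub> h\<close>.
\<close>

definition torsion_free :: "('g, 'm) monoid_scheme \<Rightarrow> bool" where
  "torsion_free G \<longleftrightarrow>
     (\<forall>x\<in>carrier G. \<forall>n::nat. 0 < n \<longrightarrow> x [^]\<^bsub>G\<^esub> n = \<one>\<^bsub>G\<^esub> \<longrightarrow> x = \<one>\<^bsub>G\<^esub>)"


subsection \<open>The rank of an abelian group\<close>

text \<open>
  The tensor product over the integers: the free abelian group on pairs modulo the subgroup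
  generated by the biadditivity relations.
\<close>

definition tensor_relations ::
    "('a, 'm) monoid_scheme \<Rightarrow> ('b, 'n) monoid_scheme \<Rightarrow> ('a \<times> 'b \<Rightarrow>\<^sub>0 int) set" where
  "tensor_relations A B =
     {frag_of (x \<otimes>\<^bsub>A\<^esub> x', y) - (frag_of (x, y) + frag_of (x', y)) | x x' y.
        x \<in> carrier A \<and> x' \<in> carrier A \<and> y \<in> carrier B} \<union>
     {frag_of (x, y \<otimes>\<^bsub>B\<^esub> y') - (frag_of (x, y) + frag_of (x, y')) | x y y'.
        x \<in> carrier A \<and> y \<in> carrier B \<and> y' \<in> carrier B}"

definition tensor_kernel ::
    "('a, 'm) monoid_scheme \<Rightarrow> ('b, 'n) monoid_scheme \<Rightarrow> ('a \<times> 'b \<Rightarrow>\<^sub>0 int) set" where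
  "tensor_kernel A B =
     generate (free_Abelian_group (carrier A \<times> carrier B)) (tensor_relations A B)"

definition tensor_group ::
    "('a, 'm) monoid_scheme \<Rightarrow> ('b, 'n) monoid_scheme \<Rightarrow> ('a \<times> 'b \<Rightarrow>\<^sub>0 int) set monoid" where
  "tensor_group A B =
     free_Abelian_group (carrier A \<times> carrier B) Mod tensor_kernel A B"

abbreviation rat_field :: "rat ring" where
  "rat_field \<equiv> class_ring"

text \<open>
  The rational vector space \<open>\<rat> \<otimes> H\<close>. Scalar multiplication is induced by
  \<open>p \<otimes> h \<mapsto> q p \<otimes> h\<close>; the image of a coset under this map is contained in a single coset,
  and the union below is that coset. The ring multiplication and unit of the record are not
  part of a module and are left unspecified.
\<close>

definition rat_tensor :: "('h, 'm) monoid_scheme \<Rightarrow> (rat, (rat \<times> 'h \<Rightarrow>\<^sub>0 int) set) module" where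
  "rat_tensor H =
     (let T = tensor_group (add_monoid rat_field) H;
          K = tensor_kernel (add_monoid rat_field) H
      in \<lparr>carrier = carrier T, monoid.mult = undefined, monoid.one = undefined,
          ring.zero = \<one>\<^bsub>T\<^esub>, ring.add = (\<otimes>\<^bsub>T\<^esub>),
          smult = (\<lambda>q C. \<Union>x\<in>C.
            K #>\<^bsub>free_Abelian_group (UNIV \<times> carrier H)\<^esub>
              frag_extend (\<lambda>(p, h). frag_of (q * p, h)) x)\<rparr>)"

definition group_rank :: "('h, 'm) monoid_scheme \<Rightarrow> enat" where
  "group_rank H =
     (if vectorspace.fin_dim rat_field (rat_tensor H)
      then enat (vectorspace.dim rat_field (rat_tensor H)) else \<infinity>)"


subsection \<open>Graded rings\<close>

text \<open>
  \<open>A g\<close> is the component of degree \<open>g\<close>; only its values on \<open>carrier G\<close> matter. The last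
  assumption says that \<open>R\<close> is the internal direct sum of the components.
\<close>

locale graded_ring = R?: cring R + G: comm_group G
  for R :: "('r, 'n) ring_scheme" (structure) and G :: "('g, 'm) monoid_scheme"
    and A :: "'g \<Rightarrow> 'r set" +
  assumes component_subgroup: "g \<in> carrier G \<Longrightarrow> additive_subgroup (A g) R"
    and component_mult:
      "\<lbrakk>g \<in> carrier G; h \<in> carrier G; x \<in> A g; y \<in> A h\<rbrakk> \<Longrightarrow> x \<otimes> y \<in> A (g \<otimes>\<^bsub>G\<^esub> h)"
    and direct_sum:
      "r \<in> carrier R \<Longrightarrow>
         \<exists>!x. x \<in> (\<Pi>\<^sub>E g\<in>carrier G. A g) \<and> finite {g \<in> carrier G. x g \<noteq> \<zero>} \<and>
              r = (\<Oplus>g\<in>{g \<in> carrier G. x g \<noteq> \<zero>}. x g)"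

definition graded_supp ::
    "('r, 'n) ring_scheme \<Rightarrow> ('g, 'm) monoid_scheme \<Rightarrow> ('g \<Rightarrow> 'r set) \<Rightarrow> 'g set" where
  "graded_supp R G A = {g \<in> carrier G. A g \<noteq> {\<zero>\<^bsub>R\<^esub>}}"

end

theory Submission
  imports Defs "HOL-Computational_Algebra.Fraction_Field"
begin

text \<open>
  Part (1). Among the homogeneous ideals \<open>I\<close> for which the degrees occurring in \<open>R/I\<close> have infinite
  rank take a maximal one. A homogeneous \<open>a \<notin> I\<close> is then a non-zero-divisor modulo \<open>I\<close>, since the
  degrees of \<open>R/I\<close> are covered by those of \<open>R/(I + aR)\<close> and a translate of those of \<open>R/(I : a)\<close>.
  Choose homogeneous \<open>a\<^sub>0, a\<^sub>1, \<dots> \<notin> I\<close> of independent degrees. Setting \<open>a\<^sub>i = 1\<close> for \<open>i < m\<close> does not kill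
  \<open>a\<^sub>m - 1\<close>, so the ideals \<open>I + (a\<^sub>i - 1 : i < m)\<close> increase strictly.

  Part (2). Embed \<open>G\<close> into \<open>\<rat>\<^sup>r\<close> and give the variables of \<open>P = \<rat>[Y\<^sub>0, Y\<^sub>1, \<dots>]\<close> degrees that exhaust \<open>G\<close>.
  The ring \<open>R\<close> is the localization of \<open>P\<close> at its nonzero homogeneous elements. By Cohen's theorem
  it suffices that a prime \<open>\<pp>\<close> of \<open>P\<close> without nonzero homogeneous elements is finitely generated. Let \<open>\<pp>\<^sub>n\<close>
  be its contraction to the polynomials in the first \<open>n\<close> variables. If no \<open>\<pp>\<^sub>n\<close> generates \<open>\<pp>\<close>, then the extensions
  \<open>\<pp>\<^sub>nP\<close> contain arbitrarily long chains of primes. But \<open>r + 1\<close> elements climbing such a chain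
  satisfy a polynomial relation with homogeneous coefficients of one degree, because their
  monomials outnumber the degrees that occur, and a Coquand-Lombardi type argument puts a nonzero
  homogeneous coefficient into \<open>\<pp>\<close>.
\<close>

subsection \<open>Finitely generated ideals of a subring\<close>

text \<open>For part (2) the group algebra of \<open>G\<close> over a field does not serve: it is
  Noetherian only when \<open>G\<close> is finitely generated, and \<open>G\<close> may be the
  additive group of the rationals. Inverting the nonzero homogeneous elements removes every prime
  that contains one of them. The other primes are controlled by growth: \<open>r + 1\<close>
  polynomials have \<open>(d + 1) ^ (r + 1)\<close> monomials with exponents at most
  \<open>d\<close>, while the degrees of these monomials are points of a lattice in rational
  \<open>r\<close>-space, only about \<open>d ^ r\<close> in number. Rational coefficients keep the
  ring countable, so that it has a copy in the type \<open>'g \<Rightarrow> rat\<close> of the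
  statement.

  In part (1) setting the \<open>a\<^sub>i\<close> equal to \<open>1\<close> identifies parts whose
  degrees differ by multiples of the degrees of the \<open>a\<^sub>i\<close>. Comparing such parts
  would call for negative powers of the \<open>a\<^sub>i\<close>, which need not be invertible. A
  common factor, the \<open>N\<close>-th power of each \<open>a\<^sub>i\<close>, clears these
  denominators; the price is a sum cut off at \<open>N\<close>, so that the identities hold only for
  large \<open>N\<close>.\<close>

definition subring_set :: "'a::comm_ring_1 set \<Rightarrow> bool" where
  "subring_set C \<longleftrightarrow> 1 \<in> C \<and> (\<forall>x\<in>C. \<forall>y\<in>C. x - y \<in> C \<and> x * y \<in> C)"

definition ideal_in :: "'a::comm_ring_1 set \<Rightarrow> 'a set \<Rightarrow> bool" where
  "ideal_in C I \<longleftrightarrow> I \<subseteq> C \<and> 0 \<in> I \<and> (\<forall>x\<in>I. \<forall>y\<in>I. x + y \<in> I) \<and> (\<forall>c\<in>C. \<forall>x\<in>I. c * x \<in> I)"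

inductive_set ideal_gen :: "'a::comm_ring_1 set \<Rightarrow> 'a set \<Rightarrow> 'a set" for C S where
  zero: "0 \<in> ideal_gen C S"
| step: "c \<in> C \<Longrightarrow> s \<in> S \<Longrightarrow> x \<in> ideal_gen C S \<Longrightarrow> c * s + x \<in> ideal_gen C S"

definition fin_gen :: "'a::comm_ring_1 set \<Rightarrow> 'a set \<Rightarrow> bool" where
  "fin_gen C I \<longleftrightarrow> (\<exists>S. finite S \<and> S \<subseteq> I \<and> I \<subseteq> ideal_gen C S)"

definition noetherian_set :: "'a::comm_ring_1 set \<Rightarrow> bool" where
  "noetherian_set C \<longleftrightarrow> (\<forall>I. ideal_in C I \<longrightarrow> fin_gen C I)"

lemma subring_setD:
  assumes "subring_set C"
  shows "1 \<in> C" "0 \<in> C" "x \<in> C \<Longrightarrow> y \<in> C \<Longrightarrow> x - y \<in> C" "x \<in> C \<Longrightarrow> y \<in> C \<Longrightarrow> x * y \<in> C"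
    "x \<in> C \<Longrightarrow> - x \<in> C" "x \<in> C \<Longrightarrow> y \<in> C \<Longrightarrow> x + y \<in> C"
proof -
  show 1: "1 \<in> C" and d: "\<And>x y. x \<in> C \<Longrightarrow> y \<in> C \<Longrightarrow> x - y \<in> C" and "x \<in> C \<Longrightarrow> y \<in> C \<Longrightarrow> x * y \<in> C" for x y
    using assms by (auto simp: subring_set_def)
  show 0: "0 \<in> C" using d[OF 1 1] by simp
  show n: "x \<in> C \<Longrightarrow> - x \<in> C" for x using d[OF 0] by force
  show "x \<in> C \<Longrightarrow> y \<in> C \<Longrightarrow> x + y \<in> C" for x y using d[of x "- y"] n by simp
qed

lemma subring_set_power: "subring_set C \<Longrightarrow> x \<in> C \<Longrightarrow> x ^ n \<in> C"
  by (induction n) (simp_all add: subring_setD(1,4))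

lemma subring_set_sum: "subring_set C \<Longrightarrow> (\<And>i. i \<in> F \<Longrightarrow> f i \<in> C) \<Longrightarrow> sum f F \<in> C"
  by (induction F rule: infinite_finite_induct) (simp_all add: subring_setD(2,6))

lemma ideal_inD:
  assumes "ideal_in C I"
  shows "x \<in> I \<Longrightarrow> x \<in> C" "0 \<in> I" "x \<in> I \<Longrightarrow> y \<in> I \<Longrightarrow> x + y \<in> I" "c \<in> C \<Longrightarrow> x \<in> I \<Longrightarrow> c * x \<in> I"
  using assms by (auto simp: ideal_in_def)

lemma ideal_in_diff:
  assumes "subring_set C" "ideal_in C I" "x \<in> I" "y \<in> I"
  shows "x - y \<in> I"
proof -
  have "x + (- 1) * y \<in> I"
    by (intro ideal_inD(3,4)[OF assms(2)] assms(3,4) subring_setD(1,5)[OF assms(1)])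
  then show ?thesis by simp
qed

lemma ideal_gen_add:
  assumes "x \<in> ideal_gen C S" "y \<in> ideal_gen C S"
  shows "x + y \<in> ideal_gen C S"
  using assms by induction (auto simp: add.assoc intro: ideal_gen.intros)

lemma ideal_gen_mult:
  assumes "subring_set C" "x \<in> ideal_gen C S" "c \<in> C"
  shows "c * x \<in> ideal_gen C S"
  using assms(2) by induction
    (auto simp: distrib_left mult.assoc[symmetric] intro!: ideal_gen.intros subring_setD(4)[OF assms(1,3)])

lemma ideal_gen_self:
  assumes "subring_set C" "s \<in> S"
  shows "s \<in> ideal_gen C S"
  using ideal_gen.step[OF subring_setD(1)[OF assms(1)] assms(2) ideal_gen.zero] by simp

lemma ideal_gen_subset:
  assumes "ideal_in C I" "S \<subseteq> I"
  shows "ideal_gen C S \<subseteq> I"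
proof
  fix x assume "x \<in> ideal_gen C S"
  then show "x \<in> I" by induction (use assms in \<open>auto simp: ideal_in_def\<close>)
qed

lemma ideal_in_gen:
  assumes "subring_set C" "S \<subseteq> C"
  shows "ideal_in C (ideal_gen C S)"
proof -
  have "x \<in> C" if "x \<in> ideal_gen C S" for x
    using that
  proof induction
    case (step c s x)
    then show ?case using assms(2) by (intro subring_setD(6,4)[OF assms(1)]) auto
  qed (rule subring_setD(2)[OF assms(1)])
  then show ?thesis
    unfolding ideal_in_def
    by (intro conjI subsetI ballI ideal_gen.zero ideal_gen_add ideal_gen_mult[OF assms(1)])
qed

lemma ideal_gen_mono:
  assumes "S \<subseteq> T" "C \<subseteq> D"
  shows "ideal_gen C S \<subseteq> ideal_gen D T"
proof
  fix x assume "x \<in> ideal_gen C S"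
  then show "x \<in> ideal_gen D T" by induction (use assms in \<open>auto intro: ideal_gen.intros\<close>)
qed

lemma ideal_gen_trans:
  assumes "subring_set C" "S \<subseteq> ideal_gen C T"
  shows "ideal_gen C S \<subseteq> ideal_gen C T"
proof
  fix x assume "x \<in> ideal_gen C S"
  then show "x \<in> ideal_gen C T"
  proof induction
    case (step c s x)
    then show ?case using assms(2) by (intro ideal_gen_add ideal_gen_mult[OF assms(1)]) auto
  qed (rule ideal_gen.zero)
qed

lemma finite_subset_image_lessThan:
  fixes a :: "nat \<Rightarrow> 'a"
  assumes "finite S" "S \<subseteq> range a"
  obtains m where "S \<subseteq> a ` {..<m}"
proof -
  obtain F where F: "finite F" "S = a ` F" using assms finite_subset_image[of S a UNIV] by auto
  obtain m where "\<forall>i\<in>F. i < m" using F(1) finite_nat_set_iff_bounded by blast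
  then show ?thesis using that F by auto
qed

lemma ideal_gen_finite_support:
  assumes "x \<in> ideal_gen C S"
  obtains T where "finite T" "T \<subseteq> S" "x \<in> ideal_gen C T"
proof -
  from assms have "\<exists>T. finite T \<and> T \<subseteq> S \<and> x \<in> ideal_gen C T"
  proof induction
    case zero
    then show ?case using ideal_gen.zero by blast
  next
    case (step c s x)
    then obtain T where T: "finite T" "T \<subseteq> S" "x \<in> ideal_gen C T" by blast
    have "x \<in> ideal_gen C (insert s T)" using ideal_gen_mono[of T "insert s T" C C] T(3) by blast
    then have "c * s + x \<in> ideal_gen C (insert s T)" using step by (auto intro: ideal_gen.step)
    then show ?case using T step by (intro exI[of _ "insert s T"]) auto
  qed
  then show ?thesis using that by blast
qed

lemma finite_subset_gen_finite_support:
  assumes "finite X" "X \<subseteq> ideal_gen C S"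
  obtains T where "finite T" "T \<subseteq> S" "X \<subseteq> ideal_gen C T"
proof -
  from assms have "\<exists>T. finite T \<and> T \<subseteq> S \<and> X \<subseteq> ideal_gen C T"
  proof induction
    case (insert x X)
    then obtain T where T: "finite T" "T \<subseteq> S" "X \<subseteq> ideal_gen C T" by blast
    obtain T' where T': "finite T'" "T' \<subseteq> S" "x \<in> ideal_gen C T'"
      using insert.prems ideal_gen_finite_support[of x C S] by blast
    have "ideal_gen C T \<subseteq> ideal_gen C (T \<union> T')" "ideal_gen C T' \<subseteq> ideal_gen C (T \<union> T')"
      by (rule ideal_gen_mono; simp)+
    then show ?case using T T' by (intro exI[of _ "T \<union> T'"]) auto
  qed auto
  then show ?thesis using that by blast
qed

section \<open>Noetherian subrings: sequences of elements and Hilbert's basis theorem\<close>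

lemma noetherian_set_sequence:
  assumes "subring_set C" "noetherian_set C" "\<And>k::nat. a k \<in> C"
  obtains m where "a m \<in> ideal_gen C (a ` {..<m})"
proof -
  have "ideal_in C (ideal_gen C (range a))"
    by (rule ideal_in_gen[OF assms(1)]) (use assms(3) in blast)
  then obtain X where X: "finite X" "X \<subseteq> ideal_gen C (range a)" "ideal_gen C (range a) \<subseteq> ideal_gen C X"
    using assms(2) unfolding noetherian_set_def fin_gen_def by blast
  obtain T where T: "finite T" "T \<subseteq> range a" "X \<subseteq> ideal_gen C T"
    using finite_subset_gen_finite_support[OF X(1,2)] .
  obtain m where m: "T \<subseteq> a ` {..<m}" using finite_subset_image_lessThan[OF T(1,2)] .
  have "a m \<in> ideal_gen C (range a)" by (rule ideal_gen_self[OF assms(1)]) simp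
  then have "a m \<in> ideal_gen C T" using X(3) ideal_gen_trans[OF assms(1) T(3)] by blast
  then have "a m \<in> ideal_gen C (a ` {..<m})" using ideal_gen_mono[OF m] by blast
  then show ?thesis by (rule that)
qed

text \<open>Dependent choice in which the condition on a new term sees only the set of earlier
  terms. It serves twice: for generators of least degree in the basis theorem, and for degrees
  independent of the earlier ones in part (1).\<close>

lemma greedy_sequence:
  assumes "\<And>F. finite F \<Longrightarrow> F \<subseteq> X \<Longrightarrow> \<exists>x\<in>X. Q F x"
  obtains f :: "nat \<Rightarrow> 'a" where "\<And>k. f k \<in> X" "\<And>k. Q (f ` {..<k}) (f k)"
proof -
  have "\<exists>f::nat \<Rightarrow> 'a. \<forall>k. f k \<in> X \<and> (f ` {..<k} \<subseteq> X \<longrightarrow> Q (f ` {..<k}) (f k))"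
  proof (rule dependent_wellorder_choice)
    fix r :: 'a and f g :: "nat \<Rightarrow> 'a" and k
    assume "\<And>y. y < k \<Longrightarrow> f y = g y"
    then have "f ` {..<k} = g ` {..<k}" by (auto simp: image_iff)
    then show "(r \<in> X \<and> (f ` {..<k} \<subseteq> X \<longrightarrow> Q (f ` {..<k}) r)) =
        (r \<in> X \<and> (g ` {..<k} \<subseteq> X \<longrightarrow> Q (g ` {..<k}) r))" by simp
  next
    fix k and f :: "nat \<Rightarrow> 'a"
    assume "\<And>y. y < k \<Longrightarrow> f y \<in> X \<and> (f ` {..<y} \<subseteq> X \<longrightarrow> Q (f ` {..<y}) (f y))"
    then have "f ` {..<k} \<subseteq> X" by auto
    then show "\<exists>r. r \<in> X \<and> (f ` {..<k} \<subseteq> X \<longrightarrow> Q (f ` {..<k}) r)"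
      using assms[of "f ` {..<k}"] by auto
  qed
  then obtain f :: "nat \<Rightarrow> 'a" where f: "\<And>k. f k \<in> X" "\<And>k. f ` {..<k} \<subseteq> X \<Longrightarrow> Q (f ` {..<k}) (f k)"
    by blast
  from f(1) have "f ` {..<k} \<subseteq> X" for k by blast
  with f show ?thesis by (intro that[of f]) simp_all
qed

text \<open>Values at \<open>t\<close> of polynomials over \<open>B\<close> with \<open>d\<close>
  coefficients, that is, of degree below \<open>d\<close>. Since \<open>t\<close> may be algebraic
  over \<open>B\<close>, a value does not determine its coefficients; the degree used below is the
  least possible \<open>d\<close>.\<close>

definition poly_values :: "'a::comm_ring_1 set \<Rightarrow> 'a \<Rightarrow> nat \<Rightarrow> 'a set" where
  "poly_values B t d = {\<Sum>i<d. b i * t ^ i | b. \<forall>i. b i \<in> B}"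

lemma poly_values_add:
  assumes "subring_set B" "x \<in> poly_values B t d" "y \<in> poly_values B t d"
  shows "x + y \<in> poly_values B t d"
proof -
  obtain b c where b: "x = (\<Sum>i<d. b i * t ^ i)" "\<forall>i. b i \<in> B" and c: "y = (\<Sum>i<d. c i * t ^ i)" "\<forall>i. c i \<in> B"
    using assms unfolding poly_values_def by blast
  have "x + y = (\<Sum>i<d. (b i + c i) * t ^ i)" by (simp add: b c sum.distrib algebra_simps)
  moreover have "\<forall>i. b i + c i \<in> B" using b c subring_setD(6)[OF assms(1)] by blast
  ultimately show ?thesis unfolding poly_values_def by (intro CollectI exI conjI)
qed

lemma poly_values_smult:
  assumes "subring_set B" "x \<in> poly_values B t d" "c \<in> B"
  shows "c * x \<in> poly_values B t d"
proof -
  obtain b where b: "x = (\<Sum>i<d. b i * t ^ i)" "\<forall>i. b i \<in> B"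
    using assms unfolding poly_values_def by blast
  have "c * x = (\<Sum>i<d. (c * b i) * t ^ i)" by (simp add: b sum_distrib_left algebra_simps)
  moreover have "\<forall>i. c * b i \<in> B" using b assms(3) subring_setD(4)[OF assms(1)] by blast
  ultimately show ?thesis unfolding poly_values_def by (intro CollectI exI conjI)
qed

lemma poly_values_zero: "subring_set B \<Longrightarrow> 0 \<in> poly_values B t d"
  unfolding poly_values_def by (auto intro!: exI[of _ "\<lambda>_. 0"] intro: subring_setD(2))

lemma poly_values_mult_power:
  assumes "subring_set B" "x \<in> poly_values B t d"
  shows "t ^ e * x \<in> poly_values B t (e + d)"
proof -
  obtain b where b: "x = (\<Sum>i<d. b i * t ^ i)" "\<forall>i. b i \<in> B"
    using assms unfolding poly_values_def by blast
  define c where "c i = (if i < e then 0 else b (i - e))" for i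
  have "(\<Sum>i<e + d. c i * t ^ i) = (\<Sum>i<e. c i * t ^ i) + (\<Sum>i=e..<e + d. c i * t ^ i)"
    unfolding atLeast0LessThan[symmetric] by (rule sum.atLeastLessThan_concat[symmetric]) simp_all
  also have "(\<Sum>i=e..<e + d. c i * t ^ i) = (\<Sum>i<d. c (i + e) * t ^ (i + e))"
    using sum.shift_bounds_nat_ivl[of "\<lambda>i. c i * t ^ i" 0 e d] by (simp add: atLeast0LessThan add.commute)
  finally have "t ^ e * x = (\<Sum>i<e + d. c i * t ^ i)"
    by (simp add: b c_def sum_distrib_left power_add mult.commute mult.left_commute)
  moreover have "\<forall>i. c i \<in> B" using b subring_setD(2)[OF assms(1)] by (simp add: c_def)
  ultimately show ?thesis unfolding poly_values_def by (intro CollectI exI conjI)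
qed

lemma poly_values_split:
  assumes "f \<in> poly_values B t (Suc d)"
  obtains b where "b \<in> B" "f - b * t ^ d \<in> poly_values B t d"
proof -
  obtain b where b: "f = (\<Sum>i<Suc d. b i * t ^ i)" "\<forall>i. b i \<in> B"
    using assms unfolding poly_values_def by blast
  then have "f - b d * t ^ d = (\<Sum>i<d. b i * t ^ i)" by simp
  then have "f - b d * t ^ d \<in> poly_values B t d" using b(2) unfolding poly_values_def by blast
  with b(2) show ?thesis by (intro that[of "b d"]) auto
qed

text \<open>Hilbert's basis theorem. Choosing generators greedily of least degree, the leading coefficients
  cannot generate a strictly increasing sequence of ideals.\<close>

lemma noetherian_set_adjoin:
  assumes B: "subring_set B" "noetherian_set B" and C: "subring_set C" "B \<subseteq> C" "t \<in> C"
    and adj: "C \<subseteq> (\<Union>d. poly_values B t d)"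
  shows "noetherian_set C"
  unfolding noetherian_set_def
proof (intro allI impI, rule ccontr)
  fix I assume I: "ideal_in C I" and nfg: "\<not> fin_gen C I"
  define deg where "deg f = (LEAST d. f \<in> poly_values B t d)" for f
  have deg: "f \<in> poly_values B t (deg f)" if "f \<in> I" for f
  proof -
    have "f \<in> C" using that I ideal_inD(1) by blast
    then have "\<exists>d. f \<in> poly_values B t d" using adj by blast
    then show ?thesis unfolding deg_def by (rule LeastI_ex)
  qed
  have deg_le: "deg f \<le> d" if "f \<in> poly_values B t d" for f d
    unfolding deg_def using that by (rule Least_le)
  have ex: "\<exists>x\<in>I. x \<notin> ideal_gen C F \<and> (\<forall>y\<in>I. y \<notin> ideal_gen C F \<longrightarrow> deg x \<le> deg y)"
    if "finite F" "F \<subseteq> I" for F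
  proof -
    have "\<not> I \<subseteq> ideal_gen C F" using nfg that unfolding fin_gen_def by simp
    then obtain z where "z \<in> I \<and> z \<notin> ideal_gen C F" by auto
    from ex_has_least_nat[of "\<lambda>z. z \<in> I \<and> z \<notin> ideal_gen C F", OF this, of deg]
    show ?thesis by auto
  qed
  obtain f :: "nat \<Rightarrow> 'a" where fI: "\<And>k. f k \<in> I" and f: "\<And>k. f k \<notin> ideal_gen C (f ` {..<k}) \<and>
      (\<forall>y\<in>I. y \<notin> ideal_gen C (f ` {..<k}) \<longrightarrow> deg (f k) \<le> deg y)"
    using greedy_sequence[of I "\<lambda>F x. x \<notin> ideal_gen C F \<and> (\<forall>y\<in>I. y \<notin> ideal_gen C F \<longrightarrow> deg x \<le> deg y)", OF ex]
    by auto
  have deg_mono: "deg (f k) \<le> deg (f l)" if "k \<le> l" for k l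
  proof -
    have "ideal_gen C (f ` {..<k}) \<subseteq> ideal_gen C (f ` {..<l})"
      using that by (intro ideal_gen_mono image_mono) auto
    then show ?thesis using f[of l] f[of k] fI[of l] by blast
  qed
  \<comment> \<open>\<open>deg\<close> counts coefficients, so the leading exponent is
    \<open>deg (f k) - 1\<close>. The subtraction is genuine: \<open>0\<close> lies in every
    generated ideal, hence \<open>f k\<close> is nonzero.\<close>
  have deg_Suc: "deg (f k) = Suc (deg (f k) - 1)" for k
  proof -
    have "f k \<noteq> 0" using f[of k] ideal_gen.zero by metis
    moreover have "poly_values B t 0 \<subseteq> {0}" by (auto simp: poly_values_def)
    ultimately have "deg (f k) \<noteq> 0" using deg[OF fI[of k]] by (cases "deg (f k) = 0") auto
    then show ?thesis by simp
  qed
  have "\<exists>b. b \<in> B \<and> f k - b * t ^ (deg (f k) - 1) \<in> poly_values B t (deg (f k) - 1)" for k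
  proof -
    have "f k \<in> poly_values B t (Suc (deg (f k) - 1))" using deg[OF fI[of k]] deg_Suc[of k] by simp
    from poly_values_split[OF this] show ?thesis by auto
  qed
  then obtain b where bB: "\<And>k. b k \<in> B"
    and b: "\<And>k. f k - b k * t ^ (deg (f k) - 1) \<in> poly_values B t (deg (f k) - 1)" by metis
  obtain m where m: "b m \<in> ideal_gen B (b ` {..<m})"
    using noetherian_set_sequence[OF B, of b] bB by blast
  define D where "D = deg (f m) - 1"
  have neg: "- x \<in> poly_values B t d" if "x \<in> poly_values B t d" for x d
    using poly_values_smult[OF B(1) that subring_setD(5)[OF B(1) subring_setD(1)[OF B(1)]]] by simp
  \<comment> \<open>A combination of the earlier leading coefficients lifts to a combination of the
    earlier generators with the same leading term, once each generator is multiplied by the power of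
    \<open>t\<close> that makes up the difference of degrees.\<close>
  have "\<exists>y\<in>ideal_gen C (f ` {..<m}). x * t ^ D - y \<in> poly_values B t D" if "x \<in> ideal_gen B (b ` {..<m})" for x
    using that
  proof induction
    case zero
    then show ?case using ideal_gen.zero[of C] poly_values_zero[OF B(1)] by force
  next
    case (step c s x)
    then obtain y where y: "y \<in> ideal_gen C (f ` {..<m})" "x * t ^ D - y \<in> poly_values B t D" by blast
    obtain k where k: "k < m" "s = b k" using step by blast
    define e where "e = deg (f m) - deg (f k)"
    have D: "D = e + (deg (f k) - 1)"
      using deg_mono[of k m] k(1) deg_Suc[of k] deg_Suc[of m] unfolding D_def e_def by linarith
    have "c * t ^ e \<in> C" using step C subring_setD(4)[OF C(1)] subring_set_power[OF C(1,3)] by blast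
    then have 1: "(c * t ^ e) * f k + y \<in> ideal_gen C (f ` {..<m})"
      using k y by (intro ideal_gen.step) auto
    have "c * (t ^ e * - (f k - b k * t ^ (deg (f k) - 1))) + (x * t ^ D - y) \<in> poly_values B t D"
      unfolding D
      by (intro poly_values_add[OF B(1)] poly_values_smult[OF B(1)] poly_values_mult_power[OF B(1)] neg b
          step y(2)[unfolded D])
    also have "c * (t ^ e * - (f k - b k * t ^ (deg (f k) - 1))) + (x * t ^ D - y)
        = (c * s + x) * t ^ D - ((c * t ^ e) * f k + y)"
      by (simp add: k D power_add algebra_simps)
    finally show ?case using 1 by blast
  qed
  from this[OF m] obtain y where y: "y \<in> ideal_gen C (f ` {..<m})" "b m * t ^ D - y \<in> poly_values B t D" by blast
  \<comment> \<open>Subtracting \<open>y\<close> removes the leading term of \<open>f m\<close> and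
    gives an element of smaller degree outside the earlier ideal, against the choice of
    \<open>f m\<close>.\<close>
  have "(f m - b m * t ^ D) + (b m * t ^ D - y) \<in> poly_values B t D"
    by (intro poly_values_add[OF B(1)] y(2) b[of m, folded D_def])
  then have "deg (f m - y) \<le> D" by (intro deg_le) simp
  moreover have "y \<in> I" using y(1) ideal_gen_subset[OF I, of "f ` {..<m}"] fI by blast
  then have "f m - y \<in> I" using ideal_in_diff[OF C(1) I fI] by blast
  moreover have "f m - y \<notin> ideal_gen C (f ` {..<m})"
  proof
    assume "f m - y \<in> ideal_gen C (f ` {..<m})"
    then have "(f m - y) + y \<in> ideal_gen C (f ` {..<m})" using y(1) by (rule ideal_gen_add)
    then show False using f[of m] by simp
  qed
  ultimately have "deg (f m) \<le> D" using f[of m] le_trans by blast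
  then show False using deg_Suc[of m] unfolding D_def by simp
qed

text \<open>Cohen's theorem. An ideal that is maximal among those not finitely generated is prime.\<close>

lemma noetherian_set_prime_ideals:
  assumes C: "subring_set C"
    and prime: "\<And>P. ideal_in C P \<Longrightarrow> 1 \<notin> P \<Longrightarrow>
      (\<And>a b. a \<in> C \<Longrightarrow> b \<in> C \<Longrightarrow> a * b \<in> P \<Longrightarrow> a \<in> P \<or> b \<in> P) \<Longrightarrow> fin_gen C P"
  shows "noetherian_set C"
proof (rule ccontr)
  assume "\<not> noetherian_set C"
  define U where "U = {I. ideal_in C I \<and> \<not> fin_gen C I}"
  have "U \<noteq> {}" using \<open>\<not> noetherian_set C\<close> by (auto simp: U_def noetherian_set_def)
  moreover have "\<Union>K \<in> U" if K: "K \<noteq> {}" "subset.chain U K" for K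
  proof -
    have KU: "\<And>I. I \<in> K \<Longrightarrow> ideal_in C I" "\<And>I. I \<in> K \<Longrightarrow> \<not> fin_gen C I"
      and lin: "\<And>I J. I \<in> K \<Longrightarrow> J \<in> K \<Longrightarrow> I \<subseteq> J \<or> J \<subseteq> I"
      using K(2) unfolding subset_chain_def U_def by blast+
    have "ideal_in C (\<Union>K)"
      unfolding ideal_in_def
    proof (intro conjI ballI)
      show "\<Union>K \<subseteq> C" using ideal_inD(1)[OF KU(1)] by blast
      show "0 \<in> \<Union>K" using ideal_inD(2)[OF KU(1)] K(1) by blast
      show "x + y \<in> \<Union>K" if xy: "x \<in> \<Union>K" "y \<in> \<Union>K" for x y
      proof -
        obtain I J where "x \<in> I" "I \<in> K" "y \<in> J" "J \<in> K" using xy by blast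
        then have "x + y \<in> I \<or> x + y \<in> J"
          using lin[of I J] ideal_inD(3)[OF KU(1)[of I], of x y] ideal_inD(3)[OF KU(1)[of J], of x y] by blast
        then show ?thesis using \<open>I \<in> K\<close> \<open>J \<in> K\<close> by blast
      qed
      show "c * x \<in> \<Union>K" if cx: "c \<in> C" "x \<in> \<Union>K" for c x
      proof -
        obtain I where "x \<in> I" "I \<in> K" using cx by blast
        then show ?thesis using ideal_inD(4)[OF KU(1)[of I] cx(1)] by blast
      qed
    qed
    moreover have "\<not> fin_gen C (\<Union>K)"
    proof
      assume "fin_gen C (\<Union>K)"
      then obtain S where S: "finite S" "S \<subseteq> \<Union>K" "\<Union>K \<subseteq> ideal_gen C S" unfolding fin_gen_def by blast
      obtain I where "I \<in> K" "S \<subseteq> I"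
        using finite_subset_Union_chain[OF S(1,2) K] by blast
      then show False using KU(2) S unfolding fin_gen_def by blast
    qed
    ultimately show ?thesis by (simp add: U_def)
  qed
  ultimately obtain M where "M \<in> U" and max: "\<And>X. X \<in> U \<Longrightarrow> M \<subseteq> X \<Longrightarrow> X = M"
    using subset_Zorn_nonempty[of U] by auto
  then have M: "ideal_in C M" and nfg: "\<not> fin_gen C M" by (auto simp: U_def)
  have "1 \<notin> M"
  proof
    assume "1 \<in> M"
    have "M \<subseteq> ideal_gen C {1}"
    proof
      fix x assume "x \<in> M"
      then have "x \<in> C" using M ideal_inD(1) by blast
      then show "x \<in> ideal_gen C {1}" using ideal_gen.step[of x C 1 "{1}" 0, OF _ _ ideal_gen.zero] by simp
    qed
    then show False using nfg \<open>1 \<in> M\<close> unfolding fin_gen_def by blast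
  qed
  moreover have "a \<in> M \<or> b \<in> M" if ab: "a \<in> C" "b \<in> C" "a * b \<in> M" for a b
  proof (rule ccontr)
    assume "\<not> (a \<in> M \<or> b \<in> M)"
    then have aM: "a \<notin> M" and bM: "b \<notin> M" by auto
    let ?Ia = "ideal_gen C (insert a M)"
    have MC: "M \<subseteq> C" using M by (simp add: ideal_in_def)
    have "ideal_in C ?Ia" using ab MC by (intro ideal_in_gen[OF C]) auto
    moreover have "M \<subseteq> ?Ia" "a \<in> ?Ia" using ideal_gen_self[OF C] by (meson insertCI subsetI)+
    ultimately have "fin_gen C ?Ia" using max[of ?Ia] aM unfolding U_def by blast
    then obtain X where X: "finite X" "X \<subseteq> ?Ia" "?Ia \<subseteq> ideal_gen C X" unfolding fin_gen_def by blast
    obtain T where T: "finite T" "T \<subseteq> insert a M" "X \<subseteq> ideal_gen C T"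
      using finite_subset_gen_finite_support[OF X(1,2)] .
    \<comment> \<open>Generators of the ideal \<open>M + (a)\<close> may be taken to be
      \<open>a\<close> together with finitely many elements of \<open>M\<close>.\<close>
    define S where "S = T - {a}"
    have S: "finite S" "S \<subseteq> M" using T by (auto simp: S_def)
    have M1: "M \<subseteq> ideal_gen C (insert a S)"
    proof -
      have "M \<subseteq> ideal_gen C T" using \<open>M \<subseteq> ?Ia\<close> X(3) ideal_gen_trans[OF C T(3)] by blast
      moreover have "ideal_gen C T \<subseteq> ideal_gen C (insert a S)" by (rule ideal_gen_mono) (auto simp: S_def)
      ultimately show ?thesis by blast
    qed
    \<comment> \<open>The colon ideal contains \<open>b\<close>, so it is strictly larger than
      \<open>M\<close> and finitely generated too.\<close>
    let ?Q = "{x \<in> C. a * x \<in> M}"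
    have "ideal_in C ?Q"
      unfolding ideal_in_def
      using subring_setD[OF C] ideal_inD[OF M] ab(1)
      by (auto simp: distrib_left mult.left_commute[of a])
    moreover have "M \<subseteq> ?Q" using ideal_inD[OF M] ab(1) by auto
    moreover have "b \<in> ?Q" using ab by auto
    ultimately have "fin_gen C ?Q" using max[of ?Q] bM unfolding U_def by blast
    then obtain Z where Z: "finite Z" "Z \<subseteq> ?Q" "?Q \<subseteq> ideal_gen C Z" unfolding fin_gen_def by blast
    \<comment> \<open>\<open>S\<close> together with \<open>a\<close> times the generators of the
      colon ideal generates \<open>M\<close>: if \<open>x = r * a + y\<close> with \<open>y\<close>
      generated by \<open>S\<close>, then \<open>x - y\<close> lies in \<open>M\<close>, which puts
      \<open>r\<close> into the colon ideal.\<close>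
    let ?G = "S \<union> (*) a ` Z"
    have dec: "\<exists>r\<in>C. \<exists>y\<in>ideal_gen C S. x = r * a + y" if "x \<in> ideal_gen C (insert a S)" for x
      using that
    proof induction
      case zero
      show ?case using subring_setD(2)[OF C] ideal_gen.zero by (intro bexI[of _ 0]) auto
    next
      case (step c s x)
      then obtain r y where ry: "r \<in> C" "y \<in> ideal_gen C S" "x = r * a + y" by blast
      show ?case
      proof (cases "s = a")
        case True
        then have "c * s + x = (c + r) * a + y" using ry by (simp add: algebra_simps)
        then show ?thesis using ry step subring_setD(6)[OF C] by blast
      next
        case False
        then have "c * s + y \<in> ideal_gen C S" using step ry by (intro ideal_gen.step) auto
        moreover have "c * s + x = r * a + (c * s + y)" using ry by (simp add: algebra_simps)
        ultimately show ?thesis using ry by blast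
      qed
    qed
    have az: "a * x \<in> ideal_gen C ?G" if "x \<in> ideal_gen C Z" for x
      using that
    proof induction
      case (step c s x)
      have "c * (a * s) + a * x \<in> ideal_gen C ?G" using step by (intro ideal_gen.step) auto
      then show ?case by (simp add: algebra_simps)
    qed (simp add: ideal_gen.zero)
    have "M \<subseteq> ideal_gen C ?G"
    proof
      fix x assume x: "x \<in> M"
      obtain r y where ry: "r \<in> C" "y \<in> ideal_gen C S" "x = r * a + y" using dec[of x] x M1 by blast
      have "y \<in> M" using ry(2) ideal_gen_subset[OF M S(2)] by blast
      then have "x - y \<in> M" using ideal_in_diff[OF C M x] by blast
      then have "r \<in> ?Q" using ry by (simp add: mult.commute)
      then have "a * r \<in> ideal_gen C ?G" using Z(3) az by blast
      moreover have "y \<in> ideal_gen C ?G" using ry(2) ideal_gen_mono[of S ?G C C] by blast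
      ultimately show "x \<in> ideal_gen C ?G" using ideal_gen_add ry(3) by (metis mult.commute)
    qed
    moreover have "finite ?G" "?G \<subseteq> M" using S Z by auto
    ultimately show False using nfg unfolding fin_gen_def by blast
  qed
  ultimately show False using prime[OF M] nfg by blast
qed

subsection \<open>Graded polynomials\<close>

abbreviation "keys \<equiv> Poly_Mapping.keys"
abbreviation "lookup \<equiv> Poly_Mapping.lookup"
abbreviation "single \<equiv> Poly_Mapping.single"

text \<open>Polynomials are finitely supported functions on a monoid of monomials, which is graded by an
  additive map \<open>w\<close>.\<close>

definition homog :: "('k \<Rightarrow> 'v) \<Rightarrow> 'v \<Rightarrow> ('k \<Rightarrow>\<^sub>0 'a::zero) \<Rightarrow> bool" where
  "homog w x f \<longleftrightarrow> (\<forall>m\<in>keys f. w m = x)"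

definition component :: "('k \<Rightarrow> 'v) \<Rightarrow> 'v \<Rightarrow> ('k \<Rightarrow>\<^sub>0 'a::zero) \<Rightarrow> ('k \<Rightarrow>\<^sub>0 'a)" where
  "component w x f = Poly_Mapping.mapp (\<lambda>m c. c when w m = x) f"

lemma lookup_component:
  "lookup (component w x f) m = (lookup f m when w m = x)"
  by (simp add: component_def lookup_mapp when_def in_keys_iff)

lemma keys_component: "keys (component w x f) = {m \<in> keys f. w m = x}"
  by (auto simp: in_keys_iff lookup_component when_def split: if_splits)

lemma homog_lookup: "homog w x f \<Longrightarrow> w m \<noteq> x \<Longrightarrow> lookup f m = 0"
  unfolding homog_def not_in_keys_iff_lookup_eq_zero[symmetric] by blast

lemma homog_component: "homog w x (component w x f)"
  by (auto simp: homog_def keys_component)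

lemma component_add: "component w x (f + g) = component w x f + component w x (g :: 'k \<Rightarrow>\<^sub>0 'a::monoid_add)"
  by (rule poly_mapping_eqI) (simp add: lookup_component lookup_add when_def)

lemma component_diff: "component w x (f - g) = component w x f - component w x (g :: 'k \<Rightarrow>\<^sub>0 'a::ab_group_add)"
  by (rule poly_mapping_eqI) (simp add: lookup_component lookup_minus when_def)

lemma component_zero [simp]: "component w x 0 = 0"
  by (rule poly_mapping_eqI) (simp add: lookup_component)

lemma component_sum:
  "component w x (\<Sum>i\<in>F. f i) = (\<Sum>i\<in>F. component w x (f i :: 'k \<Rightarrow>\<^sub>0 'a::ab_group_add))"
  by (induction F rule: infinite_finite_induct) (auto simp: component_add)

lemma component_eq_zero: "x \<notin> w ` keys f \<Longrightarrow> component w x f = 0"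
  by (rule poly_mapping_eqI) (auto simp: lookup_component when_def in_keys_iff)

lemma component_homog: "homog w y f \<Longrightarrow> component w x f = (f when x = y)"
  by (rule poly_mapping_eqI) (auto simp: lookup_component homog_lookup when_def)

lemma sum_components:
  assumes "finite X" "w ` keys f \<subseteq> X"
  shows "(\<Sum>x\<in>X. component w x f) = (f :: 'k \<Rightarrow>\<^sub>0 'a::ab_group_add)"
proof (rule poly_mapping_eqI)
  fix m
  have "(\<Sum>x\<in>X. lookup f m when w m = x) = lookup f m"
  proof (cases "w m \<in> X")
    case True
    then show ?thesis using assms(1) by (simp add: when_def sum.delta)
  next
    case False
    then have "lookup f m = 0" using assms(2) unfolding in_keys_iff[symmetric] not_in_keys_iff_lookup_eq_zero[symmetric] by blast
    then show ?thesis by simp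
  qed
  then show "lookup (\<Sum>x\<in>X. component w x f) m = lookup f m"
    by (simp add: lookup_sum lookup_component)
qed

lemma homog_zero [simp]: "homog w x 0"
  by (simp add: homog_def)

lemma homog_add: "homog w x f \<Longrightarrow> homog w x g \<Longrightarrow> homog w x (f + g)"
  using keys_add[of f g] unfolding homog_def by blast

lemma homog_uminus: "homog w x f \<Longrightarrow> homog w x (- f :: 'k \<Rightarrow>\<^sub>0 'a::ab_group_add)"
  by (auto simp: homog_def in_keys_iff)

lemma homog_sum: "(\<And>i. i \<in> F \<Longrightarrow> homog w x (f i)) \<Longrightarrow> homog w x (\<Sum>i\<in>F. f i)"
  by (induction F rule: infinite_finite_induct) (auto simp: homog_add)

lemma homog_single: "homog w (w m) (single m c)"
  by (auto simp: homog_def)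

text \<open>The ordered monoid of monomials makes the polynomials over a domain a domain. Degrees
  are only asked to be cancellative, so that multiplication by a homogeneous element keeps distinct
  degrees apart; they may themselves be monomials, as for \<open>high\<close> below.\<close>

locale grading =
  fixes w :: "'k::{ordered_cancel_comm_monoid_add, linorder} \<Rightarrow> 'v::cancel_comm_monoid_add"
  assumes w_zero: "w 0 = 0" and w_add: "w (m + m') = w m + w m'"
begin

lemma w_keys_mult:
  "w ` keys (f * g) \<subseteq> {x + y | x y. x \<in> w ` keys f \<and> y \<in> w ` keys g}"
  using keys_mult[of f g] by (force simp: w_add)

lemma homog_mult:
  "homog w x f \<Longrightarrow> homog w y g \<Longrightarrow> homog w (x + y) (f * g)"
  using w_keys_mult[of f g] by (fastforce simp: homog_def)

lemma homog_one: "homog w 0 (1 :: 'k \<Rightarrow>\<^sub>0 'a::zero_neq_one)"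
  by (simp add: homog_def w_zero)

lemma component_homog_mult:
  fixes u f :: "'k \<Rightarrow>\<^sub>0 'a::comm_ring_1"
  assumes u: "homog w x u"
  shows "component w (x + y) (u * f) = u * component w y f"
proof -
  let ?X = "insert y (w ` keys f)"
  have "u * f = (\<Sum>z\<in>?X. u * component w z f)"
    by (subst sum_components[of ?X w f, symmetric]) (auto simp: sum_distrib_left)
  then have "component w (x + y) (u * f) = (\<Sum>z\<in>?X. component w (x + y) (u * component w z f))"
    by (simp only: component_sum)
  also have "\<dots> = (\<Sum>z\<in>?X. u * component w z f when z = y)"
    by (rule sum.cong[OF refl])
      (auto simp: component_homog[OF homog_mult[OF u homog_component]] when_def)
  also have "\<dots> = u * component w y f"
    by (simp add: when_def sum.delta)
  finally show ?thesis .
qed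

text \<open>Elimination: a multiple of one vector, with homogeneous coefficients, clears a degree from
  all the others.\<close>

lemma graded_dependence:
  fixes v :: "'j \<Rightarrow> 'k \<Rightarrow>\<^sub>0 'a::idom"
  assumes "finite X" "finite J" "card X < card J" "\<And>j. j \<in> J \<Longrightarrow> w ` keys (v j) \<subseteq> X"
  shows "\<exists>c x. (\<forall>j\<in>J. homog w x (c j)) \<and> (\<exists>j\<in>J. c j \<noteq> 0) \<and> (\<Sum>j\<in>J. c j * v j) = 0"
  using assms
proof (induction "card X" arbitrary: X J v)
  case 0
  then have "v j = 0" if "j \<in> J" for j using that by auto
  moreover have "J \<noteq> {}" using 0 by auto
  ultimately show ?case by (intro exI[of _ "\<lambda>_. 1"] exI[of _ 0]) (auto simp: homog_one)
next
  case (Suc n)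
  then obtain x where x: "x \<in> X" by fastforce
  have card: "card (X - {x}) = n" using Suc x by simp
  show ?case
  proof (cases "\<forall>j\<in>J. component w x (v j) = 0")
    case True
    have "w ` keys (v j) \<subseteq> X - {x}" if "j \<in> J" for j
    proof -
      have "keys (component w x (v j)) = {}" using True that by simp
      then show ?thesis using Suc.prems(4)[OF that] unfolding keys_component by auto
    qed
    then show ?thesis using Suc.prems card Suc.hyps(2) by (intro Suc.hyps(1)[of "X - {x}"]) auto
  next
    case False
    then obtain i where i: "i \<in> J" "component w x (v i) \<noteq> 0" by blast
    define J' where "J' = J - {i}"
    have J': "finite J'" "J = insert i J'" "i \<notin> J'" using Suc.prems i by (auto simp: J'_def)
    define u where "u j = component w x (v j)" for j
    \<comment> \<open>Both products have degrees in \<open>x + X\<close>, and their parts of degree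
      \<open>x + x\<close> cancel. Thus one degree is lost, and translation by \<open>x\<close> does
      not change the number of those that remain.\<close>
    define v' where "v' j = u i * v j - u j * v i" for j
    have u: "homog w x (u j)" for j by (simp add: u_def homog_component)
    have "w ` keys (v' j) \<subseteq> (+) x ` (X - {x})" if j: "j \<in> J'" for j
    proof -
      have "w ` keys (u a * v b) \<subseteq> (+) x ` X" if b: "b \<in> J" for a b
      proof
        fix z assume "z \<in> w ` keys (u a * v b)"
        then obtain p q where "z = p + q" "p \<in> w ` keys (u a)" "q \<in> w ` keys (v b)"
          using w_keys_mult[of "u a" "v b"] by blast
        moreover from this have "p = x" using u[of a] by (auto simp: homog_def)
        ultimately show "z \<in> (+) x ` X" using Suc.prems(4)[OF b] by blast
      qed
      then have "w ` keys (u i * v j) \<subseteq> (+) x ` X" "w ` keys (u j * v i) \<subseteq> (+) x ` X"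
        using j J'(2) by blast+
      then have 1: "w ` keys (v' j) \<subseteq> (+) x ` X"
        using keys_diff[of "u i * v j" "u j * v i"] unfolding v'_def by blast
      have "component w (x + x) (v' j) = u i * u j - u j * u i"
        unfolding v'_def component_diff component_homog_mult[OF u] unfolding u_def ..
      also have "\<dots> = 0" unfolding mult.commute[of "u j" "u i"] by (rule diff_self)
      finally have c0: "keys (component w (x + x) (v' j)) = {}" unfolding keys_eq_empty .
      have "x + x \<notin> w ` keys (v' j)" 
      proof
        assume "x + x \<in> w ` keys (v' j)"
        then obtain m where "m \<in> keys (v' j)" "w m = x + x" by auto
        then have "m \<in> keys (component w (x + x) (v' j))" unfolding keys_component by simp
        then show False unfolding c0 by simp
      qed
      show ?thesis
      proof
        fix z assume z: "z \<in> w ` keys (v' j)"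
        then obtain q where "q \<in> X" "z = x + q" using 1 by blast
        moreover from this have "q \<noteq> x" using z \<open>x + x \<notin> w ` keys (v' j)\<close> by metis
        ultimately show "z \<in> (+) x ` (X - {x})" by simp
      qed
    qed
    moreover have "n = card ((+) x ` (X - {x}))" unfolding card_image[OF inj_on_add] card ..
    moreover have "card ((+) x ` (X - {x})) < card J'"
      using \<open>n = card _\<close> Suc.prems(3) Suc.hyps(2) J' by simp
    moreover have "finite ((+) x ` (X - {x}))" using Suc.prems(1) by simp
    ultimately obtain c y where c: "\<forall>j\<in>J'. homog w y (c j)" "\<exists>j\<in>J'. c j \<noteq> 0" "(\<Sum>j\<in>J'. c j * v' j) = 0"
      using Suc.hyps(1)[of "(+) x ` (X - {x})" J' v'] J'(1) by auto
    \<comment> \<open>Substituting the definition of \<open>v' j\<close> back: the coefficient of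
      \<open>v i\<close> is collected from the subtracted terms, and the common degree grows by
      \<open>x\<close>, the degree of every \<open>u j\<close>. Some coefficient stays nonzero
      because \<open>u i\<close> is nonzero in a domain.\<close>
    define c' where "c' j = (if j = i then - (\<Sum>j\<in>J'. c j * u j) else c j * u i)" for j
    have "homog w (y + x) (c' j)" if "j \<in> J" for j
      using that c(1) J' by (auto simp: c'_def intro!: homog_uminus homog_sum homog_mult u)
    moreover have "\<exists>j\<in>J. c' j \<noteq> 0" using c(2) i(2) J' by (auto simp: c'_def u_def)
    moreover have "(\<Sum>j\<in>J. c' j * v j) = 0"
    proof -
      have "(\<Sum>j\<in>J. c' j * v j) = c' i * v i + (\<Sum>j\<in>J'. c' j * v j)" using J' by simp
      also have "(\<Sum>j\<in>J'. c' j * v j) = (\<Sum>j\<in>J'. c j * u i * v j)"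
        using J' by (intro sum.cong) (auto simp: c'_def)
      also have "c' i * v i = - (\<Sum>j\<in>J'. c j * u j * v i)" by (simp add: c'_def sum_distrib_right)
      also have "- (\<Sum>j\<in>J'. c j * u j * v i) + (\<Sum>j\<in>J'. c j * u i * v j) = (\<Sum>j\<in>J'. c j * v' j)"
        by (simp add: v'_def sum_subtractf algebra_simps)
      finally show ?thesis using c(3) by simp
    qed
    ultimately show ?thesis by blast
  qed
qed

end

text \<open>The argument of Gauss's lemma. If both families had members outside \<open>P\<close>,
  the product of the highest such ones would agree modulo \<open>P\<close> with the component of
  \<open>f * g\<close> in that degree, since every other pair of the same total degree has a member
  above one of the two. With the grading by \<open>high n\<close> this makes the extension of a
  contracted prime to the full polynomial ring prime.\<close>

lemma prime_ideal_components:
  fixes P :: "('k::{ordered_cancel_comm_monoid_add, linorder} \<Rightarrow>\<^sub>0 'a::idom) set"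
    and h :: "'k \<Rightarrow> 'u::{cancel_comm_monoid_add, ordered_cancel_comm_monoid_add, linorder}"
  assumes h: "grading h" and P: "ideal_in UNIV P"
    and prime: "\<And>a b. a * b \<in> P \<Longrightarrow> a \<in> P \<or> b \<in> P"
    and fg: "\<And>z. component h z (f * g) \<in> P"
  shows "(\<forall>x. component h x f \<in> P) \<or> (\<forall>y. component h y g \<in> P)"
proof (rule ccontr)
  assume neg: "\<not> ?thesis"
  interpret grading h by fact
  define X where "X f = {x \<in> h ` keys f. component h x f \<notin> P}" for f :: "'k \<Rightarrow>\<^sub>0 'a"
  have fin: "finite (X f)" for f by (simp add: X_def)
  have inX: "x \<in> X f" if "component h x f \<notin> P" for x f
    using that ideal_inD(2)[OF P] component_eq_zero[of x h f] by (cases "x \<in> h ` keys f") (auto simp: X_def)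
  define x y where "x = Max (X f)" and "y = Max (X g)"
  have ne: "X f \<noteq> {}" "X g \<noteq> {}" using neg inX by blast+
  have xP: "component h x f \<notin> P" and yP: "component h y g \<notin> P"
    using Max_in[OF fin ne(1)] Max_in[OF fin ne(2)] by (auto simp: X_def x_def y_def)
  have big: "component h x' f \<in> P" if "x < x'" for x'
    using inX[of x' f] Max_ge[OF fin, of x' f] that unfolding x_def by (meson leD)
  have big': "component h y' g \<in> P" if "y < y'" for y'
    using inX[of y' g] Max_ge[OF fin, of y' g] that unfolding y_def by (meson leD)
  let ?F = "insert x (h ` keys f)" and ?G = "insert y (h ` keys g)"
  have "f * g = (\<Sum>a\<in>?F. component h a f) * (\<Sum>b\<in>?G. component h b g)"
    by (subst (1 2) sum_components) auto
  also have "\<dots> = (\<Sum>(a, b)\<in>?F \<times> ?G. component h a f * component h b g)"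
    by (simp only: sum_product sum.cartesian_product)
  finally have "component h (x + y) (f * g)
      = (\<Sum>p\<in>?F \<times> ?G. component h (x + y) (case p of (a, b) \<Rightarrow> component h a f * component h b g))"
    by (simp only: component_sum)
  also have "\<dots> = (\<Sum>p\<in>?F \<times> ?G. case p of (a, b) \<Rightarrow> component h a f * component h b g when x + y = a + b)"
    by (intro sum.cong refl) (auto simp: component_homog[OF homog_mult[OF homog_component homog_component]])
  also have "\<dots> = component h x f * component h y g +
      (\<Sum>p\<in>?F \<times> ?G - {(x, y)}. case p of (a, b) \<Rightarrow> component h a f * component h b g when x + y = a + b)"
    by (subst sum.remove[of _ "(x, y)"]) auto
  finally have *: "component h x f * component h y g = component h (x + y) (f * g) -
      (\<Sum>p\<in>?F \<times> ?G - {(x, y)}. case p of (a, b) \<Rightarrow> component h a f * component h b g when x + y = a + b)"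
    by simp
  have "(\<Sum>p\<in>A. case p of (a, b) \<Rightarrow> component h a f * component h b g when x + y = a + b) \<in> P"
    if "finite A" "A \<subseteq> ?F \<times> ?G - {(x, y)}" for A
    using that
  proof (induction A)
    case empty
    show ?case using ideal_inD(2)[OF P] by simp
  next
    case (insert p A)
    obtain a b where p: "p = (a, b)" by fastforce
    have "component h a f * component h b g \<in> P" if "x + y = a + b"
    proof -
      have "(a, b) \<noteq> (x, y)" using insert.prems p by auto
      then have "x < a \<or> y < b"
        using that add_less_le_mono[of a x b y] add_le_less_mono[of a x b y] by (metis less_irrefl linorder_neqE not_le)
      then show ?thesis
        using ideal_inD(4)[OF P UNIV_I big'] ideal_inD(4)[OF P UNIV_I big] by (metis mult.commute)
    qed
    then have "(component h a f * component h b g when x + y = a + b) \<in> P"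
      using ideal_inD(2)[OF P] by (simp add: when_def)
    then show ?case using insert p ideal_inD(3)[OF P] by simp
  qed
  from this[of "?F \<times> ?G - {(x, y)}"] have "component h x f * component h y g \<in> P"
    unfolding * by (intro ideal_in_diff[OF _ P] fg) (auto simp: subring_set_def)
  then show False using prime xP yP by blast
qed

section \<open>Relations between monomials along a chain of primes\<close>

fun power_prod :: "'a::comm_ring_1 list \<Rightarrow> nat list \<Rightarrow> 'a" where
  "power_prod (a # as) (m # ms) = a ^ m * power_prod as ms"
| "power_prod _ _ = 1"

text \<open>After Coquand and Lombardi: passing from \<open>Q k\<close> to \<open>Q (Suc k)\<close>, the least power of \<open>as ! k\<close> is
  cancelled and all terms with a higher power vanish.\<close>

lemma relation_along_prime_chain:
  fixes Q :: "nat \<Rightarrow> 'a::comm_ring_1 set"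
  assumes "\<And>k. ideal_in UNIV (Q k)" "\<And>k a b. a * b \<in> Q k \<Longrightarrow> a \<in> Q k \<or> b \<in> Q k"
    "\<And>k. Q k \<subseteq> Q (Suc k)"
    "\<And>k. k < length as \<Longrightarrow> as ! k \<in> Q (Suc k)" "\<And>k. k < length as \<Longrightarrow> as ! k \<notin> Q k"
    "finite T" "T \<noteq> {}" "\<And>ms. ms \<in> T \<Longrightarrow> length ms = length as"
    "(\<Sum>ms\<in>T. c ms * power_prod as ms) \<in> Q 0"
  shows "\<exists>ms\<in>T. c ms \<in> Q (length as)"
  using assms
proof (induction as arbitrary: Q T c)
  case Nil
  then have "\<And>ms. ms \<in> T \<Longrightarrow> ms = []" by simp
  then have "T = {[]}" using Nil.prems(7) by blast
  then show ?case using Nil.prems(9) by simp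
next
  case (Cons a as)
  note id = Cons.prems(1)
  define k where "k = Min (hd ` T)"
  define T0 where "T0 = {ms. k # ms \<in> T}"
  have T_ne: "ms \<noteq> []" if "ms \<in> T" for ms using Cons.prems(8)[OF that] by auto
  have "k \<in> hd ` T" unfolding k_def using Cons.prems by (intro Min_in) auto
  then obtain ms0 where ms0: "k # ms0 \<in> T" using T_ne by (metis imageE list.collapse)
  then have T0: "T0 \<noteq> {}" "(#) k ` T0 \<subseteq> T" by (auto simp: T0_def)
  have finT0: "finite T0" using finite_subset[OF T0(2) Cons.prems(6)] by (rule finite_imageD) simp
  \<comment> \<open>\<open>Z\<close> collects the terms with a higher power of \<open>a\<close>,
    each divided by \<open>a ^ Suc k\<close>.\<close>
  define Z where "Z = (\<Sum>ms\<in>T - (#) k ` T0. c ms * a ^ (hd ms - Suc k) * power_prod as (tl ms))"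
  have "(\<Sum>ms\<in>T. c ms * power_prod (a # as) ms)
      = (\<Sum>ms\<in>T - (#) k ` T0. c ms * power_prod (a # as) ms) + (\<Sum>ms\<in>(#) k ` T0. c ms * power_prod (a # as) ms)"
    using T0(2) Cons.prems(6) by (rule sum.subset_diff)
  also have "(\<Sum>ms\<in>(#) k ` T0. c ms * power_prod (a # as) ms) = a ^ k * (\<Sum>ms\<in>T0. c (k # ms) * power_prod as ms)"
    by (subst sum.reindex) (simp_all add: sum_distrib_left algebra_simps)
  also have "(\<Sum>ms\<in>T - (#) k ` T0. c ms * power_prod (a # as) ms) = a ^ k * (a * Z)"
    unfolding Z_def sum_distrib_left
  proof (rule sum.cong[OF refl])
    fix ms assume ms: "ms \<in> T - (#) k ` T0"
    then obtain m ms' where m: "ms = m # ms'" using T_ne by (metis DiffD1 list.exhaust)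
    have "k \<le> m" unfolding k_def using ms m Cons.prems(6) by (intro Min_le) (auto intro: rev_image_eqI)
    moreover have "m \<noteq> k" using ms m by (auto simp: T0_def)
    ultimately have "m = k + 1 + (m - Suc k)" by simp
    then have "a ^ m = a ^ k * a * a ^ (m - Suc k)" by (metis power_add power_one_right)
    then show "c ms * power_prod (a # as) ms = a ^ k * (a * (c ms * a ^ (hd ms - Suc k) * power_prod as (tl ms)))"
      by (simp add: m mult_ac)
  qed
  finally have "a ^ k * (a * Z + (\<Sum>ms\<in>T0. c (k # ms) * power_prod as ms)) \<in> Q 0"
    using Cons.prems(9) by (simp add: distrib_left)
  \<comment> \<open>The sets \<open>Q k\<close> are not assumed proper; that \<open>1\<close> is not
    in \<open>Q 0\<close> follows from \<open>a\<close> not being in it.\<close>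
  moreover have "a ^ j \<notin> Q 0" for j
  proof (induction j)
    case 0
    have "a \<notin> Q 0" using Cons.prems(5)[of 0] by simp
    then show ?case using ideal_inD(4)[OF id, of a 1 0] by auto
  next
    case (Suc j)
    then show ?case using Cons.prems(2)[of a "a ^ j" 0] Cons.prems(5)[of 0] by auto
  qed
  ultimately have "a * Z + (\<Sum>ms\<in>T0. c (k # ms) * power_prod as ms) \<in> Q (Suc 0)"
    using Cons.prems(2,3) by blast
  moreover have "Z * a \<in> Q (Suc 0)" using Cons.prems(4)[of 0] by (intro ideal_inD(4)[OF id]) auto
  ultimately have "a * Z + (\<Sum>ms\<in>T0. c (k # ms) * power_prod as ms) - Z * a \<in> Q (Suc 0)"
    by (intro ideal_in_diff[OF _ id]) (auto simp: subring_set_def)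
  then have "(\<Sum>ms\<in>T0. c (k # ms) * power_prod as ms) \<in> Q (Suc 0)" by (simp add: mult.commute)
  moreover have "length ms = length as" if "ms \<in> T0" for ms
    using Cons.prems(8)[of "k # ms"] that by (simp add: T0_def)
  ultimately have "\<exists>ms\<in>T0. c (k # ms) \<in> Q (Suc (length as))"
    using finT0 T0(1) Cons.prems(1-3) Cons.prems(4,5)[of "Suc _"]
    by (intro Cons.IH[of "\<lambda>k. Q (Suc k)"]) auto
  then show ?case by (auto simp: T0_def)
qed

subsection \<open>Polynomials in finitely many variables\<close>

definition vars_below :: "nat \<Rightarrow> ((nat \<Rightarrow>\<^sub>0 nat) \<Rightarrow>\<^sub>0 'a::zero) set" where
  "vars_below n = {f. \<forall>m\<in>keys f. keys m \<subseteq> {..<n}}"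

text \<open>Grading by \<open>high n\<close> amounts to reading a polynomial as one in the variables
  from \<open>n\<close> on, with coefficients in \<open>vars_below n\<close>; the components are the
  terms of this reading.\<close>

definition high :: "nat \<Rightarrow> (nat \<Rightarrow>\<^sub>0 nat) \<Rightarrow> (nat \<Rightarrow>\<^sub>0 nat)" where
  "high n m = Poly_Mapping.mapp (\<lambda>i c. c when n \<le> i) m"

definition low :: "nat \<Rightarrow> (nat \<Rightarrow>\<^sub>0 nat) \<Rightarrow> (nat \<Rightarrow>\<^sub>0 nat)" where
  "low n m = Poly_Mapping.mapp (\<lambda>i c. c when i < n) m"

lemma lookup_high: "lookup (high n m) i = (lookup m i when n \<le> i)"
  by (simp add: high_def lookup_mapp when_def in_keys_iff)

lemma lookup_low: "lookup (low n m) i = (lookup m i when i < n)"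
  by (simp add: low_def lookup_mapp when_def in_keys_iff)

lemma high_add_low: "high n m + low n m = m"
  by (rule poly_mapping_eqI) (auto simp: lookup_add lookup_high lookup_low when_def)

lemma keys_low: "keys (low n m) \<subseteq> {..<n}"
  by (auto simp: in_keys_iff lookup_low when_def split: if_splits)

lemma high_eq_zero: "keys m \<subseteq> {..<n} \<Longrightarrow> high n m = 0"
  by (rule poly_mapping_eqI)
    (metis in_keys_iff leD lessThan_iff lookup_high lookup_zero subsetD when_def)

lemma grading_high: "grading (high n)"
  by unfold_locales (auto intro!: poly_mapping_eqI simp: lookup_high lookup_add when_def)

lemma sum_monomials:
  "(\<Sum>m\<in>keys f. single m (lookup f m)) = f"
proof (rule poly_mapping_eqI)
  fix k
  show "lookup (\<Sum>m\<in>keys f. single m (lookup f m)) k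
      = lookup f k"
    by (cases "k \<in> keys f")
      (auto simp: lookup_sum lookup_single when_def sum.delta in_keys_iff)
qed

lemma vars_below_high: "f \<in> vars_below n \<Longrightarrow> homog (high n) 0 f"
  by (auto simp: vars_below_def homog_def high_eq_zero)

lemma vars_below_mono: "n \<le> n' \<Longrightarrow> vars_below n \<subseteq> vars_below n'"
  unfolding vars_below_def by force

lemma vars_below_exhaust: "\<exists>n. f \<in> vars_below n"
proof -
  have "finite (\<Union>m\<in>keys f. keys m)" by simp
  then obtain n where "\<forall>i\<in>(\<Union>m\<in>keys f. keys m). i < n"
    using finite_nat_set_iff_bounded by blast
  then show ?thesis by (auto simp: vars_below_def)
qed

lemma single_vars_below: "keys m \<subseteq> {..<n} \<Longrightarrow> single m c \<in> vars_below n"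
  by (auto simp: vars_below_def)

lemma subring_vars_below: "subring_set (vars_below n :: ((nat \<Rightarrow>\<^sub>0 nat) \<Rightarrow>\<^sub>0 'a::comm_ring_1) set)"
  unfolding subring_set_def
proof (intro conjI ballI)
  fix f g :: "(nat \<Rightarrow>\<^sub>0 nat) \<Rightarrow>\<^sub>0 'a"
  assume f: "f \<in> vars_below n" "g \<in> vars_below n"
  show "f - g \<in> vars_below n" using keys_diff[of f g] f unfolding vars_below_def by blast
  show "f * g \<in> vars_below n"
    unfolding vars_below_def
  proof (intro CollectI ballI)
    fix m assume "m \<in> keys (f * g)"
    then obtain a b where ab: "m = a + b" "a \<in> keys f" "b \<in> keys g"
      using keys_mult[of f g] by blast
    have "keys a \<subseteq> {..<n}" "keys b \<subseteq> {..<n}"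
      using ab f by (auto simp: vars_below_def)
    then show "keys m \<subseteq> {..<n}" using keys_add[of a b] ab(1) by blast
  qed
qed (auto simp: vars_below_def)

lemma poly_values_mono:
  assumes "subring_set B" "d \<le> e"
  shows "poly_values B t d \<subseteq> poly_values B t e"
proof
  fix x assume "x \<in> poly_values B t d"
  then obtain b where b: "x = (\<Sum>i<d. b i * t ^ i)" "\<forall>i. b i \<in> B" unfolding poly_values_def by blast
  have "x = (\<Sum>i<e. (if i < d then b i else 0) * t ^ i)"
    unfolding b(1) using assms(2) by (intro sum.mono_neutral_cong_left) auto
  moreover have "\<forall>i. (if i < d then b i else 0) \<in> B" using b(2) subring_setD(2)[OF assms(1)] by simp
  ultimately show "x \<in> poly_values B t e"
    unfolding poly_values_def by (intro CollectI exI[of _ "\<lambda>i. if i < d then b i else 0"]) simp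
qed

lemma single_power: "single (single n (1::nat)) (1::'a::comm_ring_1) ^ k
    = single (single n k) 1"
  by (induction k) (simp_all add: mult_single flip: single_add)

text \<open>Induction with the basis theorem; at the bottom \<open>vars_below 0\<close> is a copy of
  the coefficient field.\<close>

lemma noetherian_vars_below:
  "noetherian_set (vars_below n :: ((nat \<Rightarrow>\<^sub>0 nat) \<Rightarrow>\<^sub>0 'a::field) set)"
proof (induction n)
  case 0
  have const: "f = single 0 (lookup f 0)" if "f \<in> vars_below 0"
    for f :: "(nat \<Rightarrow>\<^sub>0 nat) \<Rightarrow>\<^sub>0 'a"
  proof (rule poly_mapping_eqI)
    fix k
    have "k \<notin> keys f" if "k \<noteq> 0"
      using that \<open>f \<in> vars_below 0\<close> by (auto simp: vars_below_def)
    then show "lookup f k = lookup (single 0 (lookup f 0)) k"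
      by (auto simp: lookup_single when_def in_keys_iff)
  qed
  show ?case
    unfolding noetherian_set_def
  proof (intro allI impI)
    fix I :: "((nat \<Rightarrow>\<^sub>0 nat) \<Rightarrow>\<^sub>0 'a) set"
    assume I: "ideal_in (vars_below 0) I"
    show "fin_gen (vars_below 0) I"
    proof (cases "I \<subseteq> {0}")
      case True
      then show ?thesis
        unfolding fin_gen_def using ideal_gen.zero[of "vars_below 0" "{}"]
        by (intro exI[of _ "{}"]) auto
    next
      case False
      then obtain f where f: "f \<in> I" "f \<noteq> 0" by blast
      define c where "c = lookup f 0"
      have fc: "f = single 0 c" using const ideal_inD(1)[OF I f(1)] by (simp add: c_def)
      then have "c \<noteq> 0" using f(2) by auto
      then have inv: "single 0 (inverse c) * f = 1" unfolding fc mult_single by simp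
      have "I \<subseteq> ideal_gen (vars_below 0) {f}"
      proof
        fix x assume "x \<in> I"
        then have "x * single 0 (inverse c) \<in> vars_below 0"
          using ideal_inD(1)[OF I] by (intro subring_setD(4)[OF subring_vars_below] single_vars_below) auto
        then have "(x * single 0 (inverse c)) * f + 0 \<in> ideal_gen (vars_below 0) {f}"
          by (intro ideal_gen.intros) auto
        then show "x \<in> ideal_gen (vars_below 0) {f}" by (simp add: mult.assoc inv)
      qed
      then show ?thesis using f unfolding fin_gen_def by (intro exI[of _ "{f}"]) auto
    qed
  qed
next
  case (Suc n)
  let ?B = "vars_below n :: ((nat \<Rightarrow>\<^sub>0 nat) \<Rightarrow>\<^sub>0 'a) set"
  let ?t = "single (single n 1) 1 :: (nat \<Rightarrow>\<^sub>0 nat) \<Rightarrow>\<^sub>0 'a"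
  have monomial: "single m c \<in> (\<Union>d. poly_values ?B ?t d)"
    if m: "keys m \<subseteq> {..<Suc n}" for m and c :: 'a
  proof -
    \<comment> \<open>As \<open>m\<close> involves only variables up to \<open>n\<close>, it is a
      power of the variable \<open>n\<close> times a monomial in the earlier ones.\<close>
    have "m = single n (lookup m n) + low n m"
    proof (rule poly_mapping_eqI)
      fix i
      show "lookup m i = lookup (single n (lookup m n) + low n m) i"
      proof (cases "i \<le> n")
        case False
        then have "i \<notin> keys m" using m by auto
        then show ?thesis using False by (simp add: lookup_add lookup_single lookup_low when_def in_keys_iff)
      qed (auto simp: lookup_add lookup_single lookup_low when_def)
    qed
    then have "single m c = ?t ^ lookup m n * single (low n m) c"
      unfolding single_power mult_single mult_1 by (rule arg_cong)
    moreover have "single (low n m) c \<in> poly_values ?B ?t 1"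
      unfolding poly_values_def
      by (intro CollectI exI[of _ "\<lambda>_. single (low n m) c"]) (simp add: single_vars_below keys_low)
    ultimately show ?thesis using poly_values_mult_power[OF subring_vars_below, of _ n ?t 1] by force
  qed
  have "vars_below (Suc n) \<subseteq> (\<Union>d. poly_values ?B ?t d)"
  proof
    fix f :: "(nat \<Rightarrow>\<^sub>0 nat) \<Rightarrow>\<^sub>0 'a" assume f: "f \<in> vars_below (Suc n)"
    have "(\<Sum>m\<in>F. single m (lookup f m)) \<in> (\<Union>d. poly_values ?B ?t d)"
      if "finite F" "F \<subseteq> keys f" for F
      using that
    proof (induction F)
      case empty
      then show ?case using poly_values_zero[OF subring_vars_below] by auto
    next
      case (insert m F)
      obtain d where d: "(\<Sum>m\<in>F. single m (lookup f m)) \<in> poly_values ?B ?t d"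
        using insert by auto
      obtain e where e: "single m (lookup f m) \<in> poly_values ?B ?t e"
        using monomial[of m "lookup f m"] insert.prems f by (auto simp: vars_below_def)
      have "single m (lookup f m) + (\<Sum>m\<in>F. single m (lookup f m))
          \<in> poly_values ?B ?t (max d e)"
        by (intro poly_values_add[OF subring_vars_below]
            subsetD[OF poly_values_mono[OF subring_vars_below max.cobounded2] e]
            subsetD[OF poly_values_mono[OF subring_vars_below max.cobounded1] d])
      then show ?case using insert.hyps by auto
    qed
    from this[of "keys f"] show "f \<in> (\<Union>d. poly_values ?B ?t d)" by (simp add: sum_monomials)
  qed
  then show ?case
    by (intro noetherian_set_adjoin[OF subring_vars_below Suc subring_vars_below, of "Suc n" ?t])
      (auto intro: vars_below_mono[THEN subsetD, of n "Suc n"] single_vars_below)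
qed

text \<open>Read \<open>f\<close> as a polynomial in the variables from \<open>n\<close> on. Its
  component for the monomial \<open>\<mu>\<close> is \<open>\<mu>\<close> times a coefficient in the
  first \<open>n\<close> variables, and since \<open>P\<close> is prime and free of monomials,
  \<open>\<mu>\<close> may be cancelled in testing membership in \<open>P\<close>. So the extension
  of the contraction consists of the polynomials whose coefficients lie in \<open>P\<close>.\<close>

lemma extended_ideal_iff:
  fixes P :: "((nat \<Rightarrow>\<^sub>0 nat) \<Rightarrow>\<^sub>0 'a::field) set"
  assumes P: "ideal_in UNIV P" and prime: "\<And>a b. a * b \<in> P \<Longrightarrow> a \<in> P \<or> b \<in> P"
    and mon: "\<And>m. single m 1 \<notin> P"
  shows "f \<in> ideal_gen UNIV (P \<inter> vars_below n) \<longleftrightarrow> (\<forall>\<mu>. component (high n) \<mu> f \<in> P)"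
proof
  interpret grading "high n" by (rule grading_high)
  assume "f \<in> ideal_gen UNIV (P \<inter> vars_below n)"
  then show "\<forall>\<mu>. component (high n) \<mu> f \<in> P"
  proof induction
    case zero
    then show ?case using ideal_inD(2)[OF P] by simp
  next
    case (step c s x)
    show ?case
    proof
      fix \<mu>
      have "component (high n) (0 + \<mu>) (s * c) = s * component (high n) \<mu> c"
        using step by (intro component_homog_mult vars_below_high) auto
      then have "component (high n) \<mu> (c * s + x) = component (high n) \<mu> c * s + component (high n) \<mu> x"
        by (simp add: component_add mult.commute)
      then show "component (high n) \<mu> (c * s + x) \<in> P"
        using step ideal_inD(3)[OF P] ideal_inD(4)[OF P] by simp
    qed
  qed
next
  assume f: "\<forall>\<mu>. component (high n) \<mu> f \<in> P"
  have comp: "component (high n) \<mu> f \<in> ideal_gen UNIV (P \<inter> vars_below n)" for \<mu>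
  proof -
    let ?c = "component (high n) \<mu> f"
    \<comment> \<open>\<open>g\<close> is the coefficient of \<open>\<mu>\<close>: every monomial of
      the component is \<open>\<mu>\<close> times its low part.\<close>
    define g where "g = (\<Sum>m\<in>keys ?c. single (low n m) (lookup ?c m))"
    have "single \<mu> 1 * g = (\<Sum>m\<in>keys ?c. single m (lookup ?c m))"
      unfolding g_def sum_distrib_left
      by (intro sum.cong refl) (metis (mono_tags, lifting) high_add_low keys_component mem_Collect_eq mult_1 mult_single)
    then have g: "?c = single \<mu> 1 * g" by (simp add: sum_monomials)
    then have "g \<in> P" using f prime mon by metis
    moreover have "g \<in> vars_below n"
      unfolding g_def by (intro subring_set_sum[OF subring_vars_below] single_vars_below keys_low)
    ultimately show ?thesis unfolding g
      by (intro ideal_gen_mult ideal_gen_self) (auto simp: subring_set_def)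
  qed
  have "(\<Sum>\<mu>\<in>F. component (high n) \<mu> f) \<in> ideal_gen UNIV (P \<inter> vars_below n)" for F
    by (induction F rule: infinite_finite_induct) (auto intro: ideal_gen.zero ideal_gen_add comp)
  from this[of "high n ` keys f"] show "f \<in> ideal_gen UNIV (P \<inter> vars_below n)"
    by (subst (asm) sum_components) auto
qed

subsection \<open>Prime ideals without homogeneous elements\<close>

text \<open>The points of \<open>(1/M) \<int>^r\<close> with coordinates of absolute value at most
  \<open>c/M\<close>. A common denominator \<open>M\<close> turns finitely many degrees into lattice
  points, and the number of points grows only like \<open>c ^ r\<close>.\<close>

definition degree_box :: "nat \<Rightarrow> nat \<Rightarrow> nat \<Rightarrow> (nat \<Rightarrow>\<^sub>0 rat) set" where
  "degree_box r M c = {v. \<forall>i. if i < r then of_nat M * lookup v i \<in> \<int> \<and>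
      \<bar>of_nat M * lookup v i\<bar> \<le> of_nat c else lookup v i = 0}"

lemma degree_box_zero: "0 \<in> degree_box r M c"
  by (simp add: degree_box_def)

lemma degree_box_add:
  assumes "u \<in> degree_box r M c" "v \<in> degree_box r M d"
  shows "u + v \<in> degree_box r M (c + d)"
proof -
  have "\<bar>of_nat M * lookup u i + of_nat M * lookup v i\<bar> \<le> of_nat c + of_nat d"
    if "i < r" for i
  proof -
    have "\<bar>of_nat M * lookup u i\<bar> \<le> of_nat c" "\<bar>of_nat M * lookup v i\<bar> \<le> of_nat d"
      using assms that unfolding degree_box_def mem_Collect_eq by metis+
    then show ?thesis by linarith
  qed
  moreover have "of_nat M * lookup u i + of_nat M * lookup v i \<in> \<int>" if "i < r" for i
    using assms that by (intro Ints_add) (auto simp: degree_box_def split: if_splits)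
  moreover have "lookup u i = 0 \<and> lookup v i = 0" if "\<not> i < r" for i
    using assms that by (auto simp: degree_box_def split: if_splits)
  ultimately show ?thesis by (simp add: degree_box_def lookup_add distrib_left)
qed

lemma degree_box_mono: "c \<le> d \<Longrightarrow> degree_box r M c \<subseteq> degree_box r M d"
  using degree_box_add[of _ r M c 0 "d - c"] degree_box_zero by fastforce

lemma card_degree_box:
  assumes "M > 0"
  shows "finite (degree_box r M c)" "card (degree_box r M c) \<le> (2 * c + 1) ^ r"
proof -
  define F where "F v = (\<lambda>i\<in>{..<r}. \<lfloor>of_nat M * lookup v i\<rfloor>)" for v :: "nat \<Rightarrow>\<^sub>0 rat"
  have inj: "inj_on F (degree_box r M c)"
  proof (rule inj_onI, rule poly_mapping_eqI)
    fix u v i assume uv: "u \<in> degree_box r M c" "v \<in> degree_box r M c" "F u = F v"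
    show "lookup u i = lookup v i"
    proof (cases "i < r")
      case True
      then have "of_nat M * lookup u i \<in> \<int>" "of_nat M * lookup v i \<in> \<int>"
        using uv by (auto simp: degree_box_def split: if_splits)
      moreover have "\<lfloor>of_nat M * lookup u i\<rfloor> = \<lfloor>of_nat M * lookup v i\<rfloor>"
        using fun_cong[OF uv(3), of i] True by (simp add: F_def)
      ultimately have "of_nat M * lookup u i = of_nat M * lookup v i"
        by (metis Ints_cases floor_of_int)
      then show ?thesis using assms by simp
    next
      case False
      then show ?thesis using uv by (auto simp: degree_box_def split: if_splits)
    qed
  qed
  have sub: "F ` degree_box r M c \<subseteq> {..<r} \<rightarrow>\<^sub>E {- int c..int c}"
  proof (rule image_subsetI, rule PiE_I)
    fix v i assume v: "v \<in> degree_box r M c" "i \<in> {..<r}"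
    then have "of_nat M * lookup v i \<in> \<int>" "\<bar>of_nat M * lookup v i\<bar> \<le> of_nat c"
      by (auto simp: degree_box_def split: if_splits)
    then obtain z where z: "of_nat M * lookup v i = of_int z" "\<bar>of_int z\<bar> \<le> (of_int (int c) :: rat)"
      by (metis Ints_cases of_int_of_nat_eq)
    then have "\<bar>z\<bar> \<le> int c" by linarith
    then show "F v i \<in> {- int c..int c}" using v(2) z(1) by (auto simp: F_def)
  qed (simp add: F_def)
  have fin: "finite ({..<r} \<rightarrow>\<^sub>E {- int c..int c})" by (intro finite_PiE) auto
  show "finite (degree_box r M c)" using finite_subset[OF sub fin] inj by (rule finite_imageD)
  have "card (degree_box r M c) \<le> card ({..<r} \<rightarrow>\<^sub>E {- int c..int c})"
    using card_image[OF inj] card_mono[OF fin sub] by simp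
  also have "\<dots> = (2 * c + 1) ^ r" by (subst card_PiE) (simp_all add: nat_add_distrib nat_mult_distrib)
  finally show "card (degree_box r M c) \<le> (2 * c + 1) ^ r" .
qed

lemma common_denominator:
  assumes "finite (Q :: rat set)"
  shows "\<exists>M::nat. M > 0 \<and> (\<forall>q\<in>Q. of_nat M * q \<in> \<int>)"
  using assms
proof induction
  case empty
  then show ?case by (intro exI[of _ 1]) auto
next
  case (insert q Q)
  then obtain M :: nat where M: "M > 0" "\<forall>q\<in>Q. of_nat M * q \<in> \<int>" by blast
  obtain a b where ab: "quotient_of q = (a, b)" by fastforce
  have b: "b > 0" "q = of_int a / of_int b" using quotient_of_denom_pos[OF ab] quotient_of_div[OF ab] by auto
  have "of_nat (M * nat b) * x \<in> \<int>" if "x \<in> insert q Q" for x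
  proof (cases "x = q")
    case True
    have "of_nat (M * nat b) * x = of_nat M * of_int a" using b True by simp
    also have "\<dots> \<in> \<int>" by (intro Ints_mult) auto
    finally show ?thesis .
  next
    case False
    then have "of_nat M * x \<in> \<int>" using M that by auto
    then have "of_nat (nat b) * (of_nat M * x) \<in> \<int>" by (rule Ints_mult[OF Ints_of_nat])
    then show ?thesis by (simp add: mult_ac)
  qed
  then show ?case using M b by (intro exI[of _ "M * nat b"]) auto
qed

lemma finite_in_degree_box:
  assumes "finite U" "\<And>u i. u \<in> U \<Longrightarrow> r \<le> i \<Longrightarrow> lookup u i = 0"
  obtains M D where "M > 0" "U \<subseteq> degree_box r M D"
proof -
  let ?Q = "(\<lambda>(u, i). lookup u i) ` (U \<times> {..<r})"
  have fin: "finite ?Q" using assms by auto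
  obtain M :: nat where M: "M > 0" "\<forall>q\<in>?Q. of_nat M * q \<in> \<int>" using common_denominator[OF fin] by blast
  define D where "D = nat \<lceil>\<Sum>q\<in>?Q. \<bar>of_nat M * q\<bar>\<rceil>"
  have D: "\<bar>of_nat M * q\<bar> \<le> of_nat D" if "q \<in> ?Q" for q
  proof -
    have "\<bar>of_nat M * q\<bar> \<le> (\<Sum>q\<in>?Q. \<bar>of_nat M * q\<bar>)" using fin that by (intro member_le_sum) auto
    also have "\<dots> \<le> of_nat D" unfolding D_def by (rule of_nat_ceiling)
    finally show ?thesis .
  qed
  have "u \<in> degree_box r M D" if "u \<in> U" for u
  proof -
    have "lookup u i \<in> ?Q" if "i < r" for i
      using \<open>u \<in> U\<close> that by (intro image_eqI[of _ _ "(u, i)"]) auto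
    then have "of_nat M * lookup u i \<in> \<int> \<and> \<bar>of_nat M * lookup u i\<bar> \<le> of_nat D"
      if "i < r" for i using M(2) D that by blast
    then show ?thesis using assms(2)[OF that] by (simp add: degree_box_def)
  qed
  then show ?thesis using that M(1) by blast
qed

text \<open>If all degrees occurring in the \<open>r + 1\<close> polynomials lie in a box of size
  \<open>D\<close>, the monomials in them with exponents at most \<open>d\<close> have degrees in
  the box of size \<open>(r + 1) d D\<close>. Their number \<open>(d + 1) ^ (r + 1)\<close>
  eventually exceeds the number of points in that box, and elimination gives the relation.\<close>

lemma homogeneous_relation:
  fixes as :: "('k::{ordered_cancel_comm_monoid_add, linorder} \<Rightarrow>\<^sub>0 'a::idom) list" and w :: "'k \<Rightarrow> nat \<Rightarrow>\<^sub>0 rat"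
  assumes w: "grading w" and r: "\<And>m i. r \<le> i \<Longrightarrow> lookup (w m) i = 0"
    and len: "length as = Suc r"
  obtains T c x where "finite T" "T \<noteq> {}" "\<And>ms. ms \<in> T \<Longrightarrow> length ms = length as"
    "\<And>ms. ms \<in> T \<Longrightarrow> homog w x (c ms)" "\<And>ms. ms \<in> T \<Longrightarrow> c ms \<noteq> 0"
    "(\<Sum>ms\<in>T. c ms * power_prod as ms) = 0"
proof -
  interpret grading w by fact
  have "finite (\<Union>a\<in>set as. w ` keys a)" by simp
  then obtain M D where M: "M > 0" and D: "(\<Union>a\<in>set as. w ` keys a) \<subseteq> degree_box r M D"
    by (rule finite_in_degree_box[of _ r]) (use r in auto)
  have mult: "w ` keys (f * g) \<subseteq> degree_box r M (c + d)"
    if fg: "w ` keys f \<subseteq> degree_box r M c" "w ` keys g \<subseteq> degree_box r M d"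
    for f g :: "'k \<Rightarrow>\<^sub>0 'a" and c d
  proof
    fix z assume "z \<in> w ` keys (f * g)"
    then obtain x y where "z = x + y" "x \<in> w ` keys f" "y \<in> w ` keys g"
      using w_keys_mult[of f g] by blast
    then show "z \<in> degree_box r M (c + d)" using fg degree_box_add by blast
  qed
  have one: "w ` keys (1 :: 'k \<Rightarrow>\<^sub>0 'a) \<subseteq> degree_box r M 0"
    by (simp add: w_zero degree_box_zero)
  have pow: "w ` keys (a ^ k) \<subseteq> degree_box r M (k * D)" if "a \<in> set as" for a k
  proof (induction k)
    case (Suc k)
    have "w ` keys a \<subseteq> degree_box r M D" using D that by blast
    from mult[OF this Suc] show ?case by simp
  qed (use one in simp)
  have prod: "w ` keys (power_prod bs ms) \<subseteq> degree_box r M (length bs * (d * D))"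
    if "set bs \<subseteq> set as" "length ms = length bs" "set ms \<subseteq> {..d}" for bs ms d
    using that
  proof (induction bs ms rule: power_prod.induct)
    case (1 a bs m ms)
    have "w ` keys (a ^ m) \<subseteq> degree_box r M (m * D)" using 1 by (intro pow) auto
    also have "\<dots> \<subseteq> degree_box r M (d * D)" using 1 by (intro degree_box_mono) auto
    finally have "w ` keys (a ^ m * power_prod bs ms) \<subseteq> degree_box r M (d * D + length bs * (d * D))"
      using 1 by (intro mult) auto
    then show ?case by simp
  next
    case ("2_1" bs)
    then show ?case using one degree_box_mono[of 0 "length [] * (d * D)" r M] by auto
  next
    case ("2_2" ms)
    then show ?case using one by auto
  qed
  \<comment> \<open>The box has at most \<open>(2 (r + 1) d D + 1) ^ r \<le> (K (d + 1)) ^ r\<close>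
    points; with \<open>d = K ^ r\<close> this bound is \<open>d (d + 1) ^ r\<close>, which is less
    than \<open>(d + 1) ^ Suc r\<close>.\<close>
  define K where "K = 2 * Suc r * D + 1"
  define d where "d = K ^ r"
  define J where "J = {ms. set ms \<subseteq> {..d} \<and> length ms = Suc r}"
  have finJ: "finite J" unfolding J_def by (intro finite_lists_length_eq) auto
  have "card (degree_box r M (length as * (d * D))) \<le> (2 * (Suc r * (d * D)) + 1) ^ r"
    using card_degree_box(2)[OF M] len by metis
  also have "\<dots> \<le> (K * (d + 1)) ^ r"
    by (intro power_mono) (auto simp: K_def algebra_simps)
  also have "\<dots> = d * (d + 1) ^ r" unfolding power_mult_distrib d_def ..
  also have "\<dots> < (d + 1) ^ Suc r" by simp
  also have "\<dots> = card J" unfolding J_def by (subst card_lists_length_eq) auto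
  finally have "card (degree_box r M (length as * (d * D))) < card J" .
  moreover have "w ` keys (power_prod as ms) \<subseteq> degree_box r M (length as * (d * D))" if "ms \<in> J" for ms
    using that len by (intro prod) (auto simp: J_def)
  ultimately obtain c x where c: "\<forall>ms\<in>J. homog w x (c ms)" "\<exists>ms\<in>J. c ms \<noteq> 0"
      "(\<Sum>ms\<in>J. c ms * power_prod as ms) = 0"
    using graded_dependence[OF card_degree_box(1)[OF M] finJ, of r "length as * (d * D)" "power_prod as"] by blast
  \<comment> \<open>Vanishing coefficients are dropped: the descent along primes may end at any
    coefficient of the relation and has to end at a nonzero one.\<close>
  show ?thesis
  proof (rule that[of "{ms \<in> J. c ms \<noteq> 0}" x c])
    have "(\<Sum>ms\<in>J. c ms * power_prod as ms) = (\<Sum>ms\<in>{ms \<in> J. c ms \<noteq> 0}. c ms * power_prod as ms)"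
      using finJ by (intro sum.mono_neutral_right) auto
    then show "(\<Sum>ms\<in>{ms \<in> J. c ms \<noteq> 0}. c ms * power_prod as ms) = 0" using c by simp
    show "finite {ms \<in> J. c ms \<noteq> 0}" using finJ by simp
  qed (use c len in \<open>auto simp: J_def\<close>)
qed

theorem prime_ideal_fin_gen:
  fixes P :: "((nat \<Rightarrow>\<^sub>0 nat) \<Rightarrow>\<^sub>0 'a::field) set" and w :: "(nat \<Rightarrow>\<^sub>0 nat) \<Rightarrow> nat \<Rightarrow>\<^sub>0 rat"
  assumes w: "grading w" and r: "\<And>m i. r \<le> i \<Longrightarrow> lookup (w m) i = 0"
    and P: "ideal_in UNIV P" and prime: "\<And>a b. a * b \<in> P \<Longrightarrow> a \<in> P \<or> b \<in> P"
    and nohom: "\<And>x f. f \<in> P \<Longrightarrow> homog w x f \<Longrightarrow> f = 0"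
  shows "fin_gen UNIV P"
proof (rule ccontr)
  assume nfg: "\<not> fin_gen UNIV P"
  have ring: "subring_set (UNIV :: ((nat \<Rightarrow>\<^sub>0 nat) \<Rightarrow>\<^sub>0 'a) set)" by (simp add: subring_set_def)
  define Q where "Q n = ideal_gen UNIV (P \<inter> vars_below n)" for n
  have idQ: "ideal_in UNIV (Q n)" for n unfolding Q_def by (rule ideal_in_gen[OF ring]) simp
  have mon: "single m 1 \<notin> P" for m
    using nohom[OF _ homog_single[of w m 1]] by (metis lookup_single_eq lookup_zero one_neq_zero)
  have Q_iff: "f \<in> Q n \<longleftrightarrow> (\<forall>\<mu>. component (high n) \<mu> f \<in> P)" for f n
    unfolding Q_def by (rule extended_ideal_iff[OF P _ mon]) (rule prime)
  have primeQ: "a \<in> Q n \<or> b \<in> Q n" if "a * b \<in> Q n" for a b n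
    unfolding Q_iff
  proof (rule prime_ideal_components[OF grading_high P])
    show "component (high n) z (a * b) \<in> P" for z using that unfolding Q_iff by blast
  qed (rule prime)
  have QP: "Q n \<subseteq> P" for n unfolding Q_def by (intro ideal_gen_subset[OF P]) auto
  have Q_mono: "Q n \<subseteq> Q n'" if "n \<le> n'" for n n'
    unfolding Q_def using vars_below_mono[OF that] by (intro ideal_gen_mono) auto
  \<comment> \<open>The contraction lies in a Noetherian ring, so \<open>Q n\<close> is contained in
    a finitely generated ideal inside \<open>P\<close> and misses some element of \<open>P\<close>.
    That element involves finitely many variables and so lies in a later
    \<open>Q n'\<close>.\<close>
  have step: "\<exists>n' a. n \<le> n' \<and> a \<in> Q n' \<and> a \<notin> Q n" for n
  proof -
    have "ideal_in (vars_below n) (P \<inter> vars_below n)"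
      unfolding ideal_in_def
      by (intro conjI ballI IntI ideal_inD(2-4)[OF P] subring_setD(2,4,6)[OF subring_vars_below]) auto
    then have "fin_gen (vars_below n) (P \<inter> vars_below n)"
      using noetherian_vars_below[of n, unfolded noetherian_set_def, THEN spec] by (rule rev_mp)
    then obtain S where S: "finite S" "S \<subseteq> P \<inter> vars_below n" "P \<inter> vars_below n \<subseteq> ideal_gen (vars_below n) S"
      unfolding fin_gen_def by (elim exE conjE)
    have "P \<inter> vars_below n \<subseteq> ideal_gen UNIV S"
      using S(3) ideal_gen_mono[of S S "vars_below n" UNIV] by simp
    then have "Q n \<subseteq> ideal_gen UNIV S" unfolding Q_def by (rule ideal_gen_trans[OF ring])
    moreover have "\<not> P \<subseteq> ideal_gen UNIV S" using nfg S unfolding fin_gen_def by simp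
    ultimately obtain a where a: "a \<in> P" "a \<notin> Q n" by auto
    obtain k where k: "a \<in> vars_below k" using vars_below_exhaust by blast
    then have "a \<in> vars_below (max n k)" using vars_below_mono[of k "max n k"] by auto
    then have "a \<in> Q (max n k)" unfolding Q_def using a(1) by (intro ideal_gen_self[OF ring]) auto
    then show ?thesis using a(2) by (intro exI[of _ "max n k"] exI[of _ a]) auto
  qed
  then obtain nx ax where nx: "\<And>n. n \<le> nx n" "\<And>n. ax n \<in> Q (nx n)" "\<And>n. ax n \<notin> Q n" by metis
  \<comment> \<open>Iterating \<open>nx\<close> from \<open>0\<close> picks a strictly increasing
    subchain; \<open>r + 1\<close> of its steps are enough for a relation.\<close>
  define N where "N k = (nx ^^ k) 0" for k
  define as where "as = map (\<lambda>k. ax (N k)) [0..<Suc r]"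
  obtain T c x where T: "finite T" "T \<noteq> {}" "\<And>ms. ms \<in> T \<Longrightarrow> length ms = length as"
    and c: "\<And>ms. ms \<in> T \<Longrightarrow> homog w x (c ms)" "\<And>ms. ms \<in> T \<Longrightarrow> c ms \<noteq> 0"
    and rel: "(\<Sum>ms\<in>T. c ms * power_prod as ms) = 0"
    by (rule homogeneous_relation[OF w r, of r as]) (auto simp: as_def)
  have "\<exists>ms\<in>T. c ms \<in> Q (N (length as))"
  proof (rule relation_along_prime_chain[where Q = "\<lambda>k. Q (N k)"])
    show "Q (N k) \<subseteq> Q (N (Suc k))" for k by (rule Q_mono) (simp add: N_def nx)
    show "as ! k \<in> Q (N (Suc k))" if "k < length as" for k
      using that nx(2)[of "N k"] by (simp add: as_def N_def del: upt_Suc)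
    show "as ! k \<notin> Q (N k)" if "k < length as" for k
      using that nx(3)[of "N k"] by (simp add: as_def del: upt_Suc)
    show "(\<Sum>ms\<in>T. c ms * power_prod as ms) \<in> Q (N 0)" unfolding rel by (rule ideal_inD(2)[OF idQ])
  qed (use T idQ primeQ in auto)
  \<comment> \<open>The coefficient found is nonzero, homogeneous and in \<open>P\<close>.\<close>
  then show False using c nohom QP by blast
qed

subsection \<open>Inverting the homogeneous elements\<close>

text \<open>The localization at the nonzero homogeneous elements, realized as a subring of the field
  of fractions.\<close>

definition hom_fracs :: "('k::{ordered_cancel_comm_monoid_add, linorder} \<Rightarrow> 'v) \<Rightarrow> ('k \<Rightarrow>\<^sub>0 'a::idom) fract set" where
  "hom_fracs w = {Fract a b | a b x. b \<noteq> 0 \<and> homog w x b}"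

text \<open>Degree \<open>x\<close> means that the degree of the numerator minus that of the
  denominator is \<open>x\<close>. Since \<open>0\<close> is homogeneous of every degree, each part
  contains \<open>0\<close>, even for an \<open>x\<close> that is not a difference of occurring
  degrees.\<close>

definition frac_part :: "('k::{ordered_cancel_comm_monoid_add, linorder} \<Rightarrow> 'v::ab_group_add) \<Rightarrow> 'v \<Rightarrow> ('k \<Rightarrow>\<^sub>0 'a::idom) fract set" where
  "frac_part w x = {Fract a b | a b y. b \<noteq> 0 \<and> homog w y b \<and> homog w (x + y) a}"

lemma frac_part_subset: "frac_part w x \<subseteq> hom_fracs w"
  unfolding frac_part_def hom_fracs_def by blast

lemma zero_in_frac_part: "grading w \<Longrightarrow> 0 \<in> frac_part w x"
  unfolding frac_part_def Zero_fract_def using grading.homog_one by fastforce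

lemma frac_part_uminus:
  assumes "p \<in> frac_part w x"
  shows "- p \<in> frac_part w x"
proof -
  obtain a b y where p: "p = Fract a b" "b \<noteq> 0" "homog w y b" "homog w (x + y) a"
    using assms unfolding frac_part_def by blast
  then have "- p = Fract (- a) b" "homog w (x + y) (- a)" by (simp_all add: homog_uminus)
  then show ?thesis using p unfolding frac_part_def by blast
qed

lemma frac_part_add:
  assumes w: "grading w" and p: "p \<in> frac_part w x" "q \<in> frac_part w x"
  shows "p + q \<in> frac_part w x"
proof -
  interpret grading w by fact
  obtain a b y where a: "p = Fract a b" "b \<noteq> 0" "homog w y b" "homog w (x + y) a"
    using p(1) unfolding frac_part_def by blast
  obtain c d z where c: "q = Fract c d" "d \<noteq> 0" "homog w z d" "homog w (x + z) c"
    using p(2) unfolding frac_part_def by blast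
  have "homog w ((x + y) + z) (a * d)" "homog w ((x + z) + y) (c * b)"
    using a c by (auto intro: homog_mult)
  then have "homog w (x + (y + z)) (a * d + c * b)" by (intro homog_add) (simp_all add: algebra_simps)
  moreover have "homog w (y + z) (b * d)" "b * d \<noteq> 0" using a c by (auto intro: homog_mult)
  moreover have "p + q = Fract (a * d + c * b) (b * d)" using a c by simp
  ultimately show ?thesis unfolding frac_part_def by blast
qed

lemma frac_part_mult:
  assumes w: "grading w" and p: "p \<in> frac_part w x" "q \<in> frac_part w x'"
  shows "p * q \<in> frac_part w (x + x')"
proof -
  interpret grading w by fact
  obtain a b y where a: "p = Fract a b" "b \<noteq> 0" "homog w y b" "homog w (x + y) a"
    using p(1) unfolding frac_part_def by blast
  obtain c d z where c: "q = Fract c d" "d \<noteq> 0" "homog w z d" "homog w (x' + z) c"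
    using p(2) unfolding frac_part_def by blast
  have "homog w ((x + y) + (x' + z)) (a * c)" using a c by (intro homog_mult)
  then have "homog w ((x + x') + (y + z)) (a * c)" by (simp add: algebra_simps)
  moreover have "homog w (y + z) (b * d)" "b * d \<noteq> 0" using a c by (auto intro: homog_mult)
  moreover have "p * q = Fract (a * c) (b * d)" using a c by simp
  ultimately show ?thesis unfolding frac_part_def by blast
qed

lemma subring_hom_fracs:
  fixes w :: "'k::{ordered_cancel_comm_monoid_add, linorder} \<Rightarrow> 'v::cancel_comm_monoid_add"
  assumes w: "grading w"
  shows "subring_set (hom_fracs w :: ('k \<Rightarrow>\<^sub>0 'a::idom) fract set)"
  unfolding subring_set_def
proof (intro conjI ballI)
  interpret grading w by fact
  show "1 \<in> (hom_fracs w :: ('k \<Rightarrow>\<^sub>0 'a) fract set)"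
    unfolding hom_fracs_def One_fract_def using homog_one by fastforce
  fix p q :: "('k \<Rightarrow>\<^sub>0 'a) fract"
  assume "p \<in> hom_fracs w" "q \<in> hom_fracs w"
  then obtain a b x c d y where a: "p = Fract a b" "b \<noteq> 0" "homog w x b"
    and c: "q = Fract c d" "d \<noteq> 0" "homog w y d"
    unfolding hom_fracs_def by blast
  have bd: "homog w (x + y) (b * d)" "b * d \<noteq> 0" using a c by (auto intro: homog_mult)
  have "p - q = Fract (a * d - c * b) (b * d)" "p * q = Fract (a * c) (b * d)" using a c by simp_all
  with bd show "p - q \<in> hom_fracs w" "p * q \<in> hom_fracs w" unfolding hom_fracs_def by blast+
qed

lemma Fract_1_ideal_gen:
  fixes C :: "'a::idom fract set"
  assumes "\<And>a. Fract a 1 \<in> C" "a \<in> ideal_gen UNIV S"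
  shows "Fract a 1 \<in> ideal_gen C ((\<lambda>a. Fract a 1) ` S)"
  using assms(2)
proof induction
  case zero
  then show ?case using ideal_gen.zero by (simp add: fract_collapse)
next
  case (step c s x)
  have "Fract (c * s + x) 1 = Fract c 1 * Fract s 1 + Fract x 1" by simp
  then show ?case by (simp only:) (intro ideal_gen.step assms(1) imageI step)
qed

text \<open>By Cohen's theorem only primes matter. A proper prime contracts to a prime of the
  polynomial ring without nonzero homogeneous elements, because these have become units; generators
  of the contraction generate the prime, since clearing a denominator multiplies by a unit.\<close>

lemma noetherian_hom_fracs:
  fixes w :: "(nat \<Rightarrow>\<^sub>0 nat) \<Rightarrow> nat \<Rightarrow>\<^sub>0 rat"
  assumes w: "grading w" and r: "\<And>m i. r \<le> i \<Longrightarrow> lookup (w m) i = 0"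
  shows "noetherian_set (hom_fracs w :: ((nat \<Rightarrow>\<^sub>0 nat) \<Rightarrow>\<^sub>0 'a::field) fract set)" (is "noetherian_set ?R")
proof (rule noetherian_set_prime_ideals)
  interpret grading w by fact
  show R: "subring_set ?R" by (rule subring_hom_fracs[OF w])
  fix P assume P: "ideal_in ?R P" and ne: "1 \<notin> P"
    and prime: "\<And>a b. a \<in> ?R \<Longrightarrow> b \<in> ?R \<Longrightarrow> a * b \<in> P \<Longrightarrow> a \<in> P \<or> b \<in> P"
  have poly: "Fract a 1 \<in> ?R" for a
    unfolding hom_fracs_def using homog_one by fastforce
  define P' where "P' = {a. Fract a 1 \<in> P}"
  have "ideal_in UNIV P'"
    unfolding ideal_in_def
  proof (intro conjI ballI)
    show "0 \<in> P'" using ideal_inD(2)[OF P] by (simp add: P'_def fract_collapse)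
    show "x + y \<in> P'" if "x \<in> P'" "y \<in> P'" for x y
      using that ideal_inD(3)[OF P, of "Fract x 1" "Fract y 1"] by (simp add: P'_def)
    show "c * x \<in> P'" if "x \<in> P'" for c x
      using that ideal_inD(4)[OF P poly[of c], of "Fract x 1"] by (simp add: P'_def)
  qed simp
  moreover have "a \<in> P' \<or> b \<in> P'" if "a * b \<in> P'" for a b
    using that prime[OF poly[of a] poly[of b]] by (simp add: P'_def)
  moreover have "f = 0" if f: "f \<in> P'" "homog w x f" for x f
  proof (rule ccontr)
    assume "f \<noteq> 0"
    then have "Fract 1 f \<in> ?R" unfolding hom_fracs_def using f(2) by blast
    then have "Fract 1 f * Fract f 1 \<in> P" 
      using f(1) ideal_inD(4)[OF P, of "Fract 1 f" "Fract f 1"] unfolding P'_def mem_Collect_eq by blast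
    moreover have "Fract 1 f * Fract f 1 = 1" using \<open>f \<noteq> 0\<close> by (simp add: One_fract_def eq_fract)
    ultimately show False using ne by simp
  qed
  ultimately have "fin_gen UNIV P'" by (intro prime_ideal_fin_gen[OF w r])
  then obtain S where S: "finite S" "S \<subseteq> P'" "P' \<subseteq> ideal_gen UNIV S" unfolding fin_gen_def by (elim exE conjE)
  show "fin_gen ?R P"
    unfolding fin_gen_def
  proof (intro exI conjI)
    show "finite ((\<lambda>a. Fract a 1) ` S)" using S(1) by simp
    show "(\<lambda>a. Fract a 1) ` S \<subseteq> P" using S(2) by (auto simp: P'_def)
    show "P \<subseteq> ideal_gen ?R ((\<lambda>a. Fract a 1) ` S)"
    proof
      fix p assume p: "p \<in> P"
      then have "p \<in> ?R" by (rule ideal_inD(1)[OF P])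
      then obtain a b x where a: "p = Fract a b" "b \<noteq> 0" "homog w x b" unfolding hom_fracs_def by blast
      have "Fract b 1 * p = Fract a 1" using a by (simp add: eq_fract)
      moreover have "Fract b 1 * p \<in> P" by (rule ideal_inD(4)[OF P poly p])
      ultimately have "a \<in> P'" unfolding P'_def by (simp only: mem_Collect_eq)
      then have "Fract a 1 \<in> ideal_gen ?R ((\<lambda>a. Fract a 1) ` S)"
        using S(3) by (intro Fract_1_ideal_gen poly) blast
      moreover have "Fract 1 b \<in> ?R" unfolding hom_fracs_def using a by blast
      ultimately have "Fract 1 b * Fract a 1 \<in> ideal_gen ?R ((\<lambda>a. Fract a 1) ` S)"
        by (intro ideal_gen_mult[OF R])
      then show "p \<in> ideal_gen ?R ((\<lambda>a. Fract a 1) ` S)" using a by simp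
    qed
  qed
qed

lemma sum_Fract: "finite F \<Longrightarrow> b \<noteq> 0 \<Longrightarrow> (\<Sum>i\<in>F. Fract (a i) b) = Fract (\<Sum>i\<in>F. a i) b"
  by (induction F rule: finite_induct) (simp_all add: Zero_fract_def eq_fract algebra_simps)

lemma hom_fracs_decomposition:
  fixes w :: "'k::{ordered_cancel_comm_monoid_add, linorder} \<Rightarrow> 'v::ab_group_add"
  assumes "p \<in> hom_fracs w"
  obtains X c where "finite X" "\<And>x. c x \<in> frac_part w x" "p = (\<Sum>x\<in>X. c x)"
proof -
  obtain a b y where a: "p = Fract a b" "b \<noteq> 0" "homog w y b" using assms unfolding hom_fracs_def by blast
  let ?X = "(\<lambda>z. z - y) ` w ` keys a"
  have "Fract (component w (x + y) a) b \<in> frac_part w x" for x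
    unfolding frac_part_def
    by (intro CollectI exI[of _ "component w (x + y) a"] exI[of _ b] exI[of _ y] conjI refl a homog_component)
  moreover have "p = (\<Sum>x\<in>?X. Fract (component w (x + y) a) b)"
  proof -
    have "(\<Sum>x\<in>?X. Fract (component w (x + y) a) b) = (\<Sum>z\<in>w ` keys a. Fract (component w z a) b)"
      by (subst sum.reindex) (auto intro: inj_onI)
    also have "\<dots> = Fract (\<Sum>z\<in>w ` keys a. component w z a) b" using a by (intro sum_Fract) auto
    also have "(\<Sum>z\<in>w ` keys a. component w z a) = a" by (rule sum_components) auto
    finally show ?thesis using a by simp
  qed
  ultimately show ?thesis by (intro that[of ?X "\<lambda>x. Fract (component w (x + y) a) b"]) auto
qed

lemma frac_part_common_denominator:
  assumes w: "grading w" and "finite F" "\<And>i. i \<in> F \<Longrightarrow> c i \<in> frac_part w (\<phi> i)"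
  shows "\<exists>b y a. b \<noteq> 0 \<and> homog w y b \<and> (\<forall>i\<in>F. c i = Fract (a i) b \<and> homog w (\<phi> i + y) (a i))"
proof -
  interpret grading w by fact
  show ?thesis
    using assms(2,3)
  proof (induction F rule: finite_induct)
    case empty
    show ?case using homog_one by (metis empty_iff one_neq_zero)
  next
    case (insert j F)
    then obtain b y a where b: "b \<noteq> 0" "homog w y b" "\<forall>i\<in>F. c i = Fract (a i) b \<and> homog w (\<phi> i + y) (a i)" by blast
    obtain a' b' y' where c: "c j = Fract a' b'" "b' \<noteq> 0" "homog w y' b'" "homog w (\<phi> j + y') a'"
      using insert.prems[of j] unfolding frac_part_def by blast
    let ?a = "\<lambda>i. if i = j then a' * b else a i * b'"
    have "c i = Fract (?a i) (b * b') \<and> homog w (\<phi> i + (y + y')) (?a i)" if "i \<in> insert j F" for i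
    proof (cases "i = j")
      case True
      have "homog w ((\<phi> j + y') + y) (a' * b)" using b c by (intro homog_mult)
      moreover have "\<phi> j + y' + y = \<phi> j + (y + y')" by (simp add: algebra_simps)
      ultimately show ?thesis using True b c by (simp add: eq_fract algebra_simps)
    next
      case False
      then have "homog w ((\<phi> i + y) + y') (a i * b')" using b c that by (intro homog_mult) auto
      then show ?thesis using False b c that by (auto simp: eq_fract algebra_simps)
    qed
    moreover have "homog w (y + y') (b * b')" "b * b' \<noteq> 0" using b c by (auto intro: homog_mult)
    ultimately show ?case by (intro exI[of _ "b * b'"] exI[of _ "y + y'"] exI[of _ ?a] conjI ballI) metis+
  qed
qed

text \<open>Over a common homogeneous denominator of degree \<open>y\<close> the numerators are
  homogeneous of the distinct degrees \<open>\<phi> i + y\<close>, so taking the component of one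
  such degree in their sum isolates one numerator.\<close>

lemma frac_part_independent:
  assumes w: "grading w" and F: "finite F" and c: "\<And>i. i \<in> F \<Longrightarrow> c i \<in> frac_part w (\<phi> i)"
    and inj: "inj_on \<phi> F" and sum: "(\<Sum>i\<in>F. c i) = 0" and j: "j \<in> F"
  shows "c j = 0"
proof -
  have "\<exists>b y a. b \<noteq> 0 \<and> homog w y b \<and> (\<forall>i\<in>F. c i = Fract (a i) b \<and> homog w (\<phi> i + y) (a i))"
    by (rule frac_part_common_denominator[OF w F]) (rule c)
  then obtain b y a where b: "b \<noteq> 0" "homog w y b"
    and "\<forall>i\<in>F. c i = Fract (a i) b \<and> homog w (\<phi> i + y) (a i)" by (elim exE conjE)
  then have a: "\<And>i. i \<in> F \<Longrightarrow> c i = Fract (a i) b" "\<And>i. i \<in> F \<Longrightarrow> homog w (\<phi> i + y) (a i)"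
    by simp_all
  have "(\<Sum>i\<in>F. c i) = (\<Sum>i\<in>F. Fract (a i) b)" by (intro sum.cong refl a)
  then have "Fract (\<Sum>i\<in>F. a i) b = 0" using sum sum_Fract[OF F b(1)] by metis
  then have "(\<Sum>i\<in>F. a i) = 0" using b(1) by (simp add: Zero_fract_def eq_fract)
  then have "component w (\<phi> j + y) (\<Sum>i\<in>F. a i) = 0" by simp
  then have "(\<Sum>i\<in>F. component w (\<phi> j + y) (a i)) = 0" by (simp only: component_sum)
  also have "(\<Sum>i\<in>F. component w (\<phi> j + y) (a i)) = (\<Sum>i\<in>F. if i = j then a i else 0)"
  proof (rule sum.cong[OF refl])
    fix i assume i: "i \<in> F"
    show "component w (\<phi> j + y) (a i) = (if i = j then a i else 0)"
      using component_homog[OF a(2)[OF i], of "\<phi> j + y"] inj_onD[OF inj _ i j] by (auto simp: when_def)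
  qed
  also have "\<dots> = a j" using F j by simp
  finally show ?thesis using a(1)[OF j] by (simp add: Zero_fract_def eq_fract b)
qed

subsection \<open>Transporting a ring along an injection\<close>

text \<open>The ring is built inside a type of fractions, while the theorem asks for a ring record
  over a fixed type; an injection into that type carries it over.
  \<open>inv_into UNIV \<iota>\<close> decodes correctly on the range of
  \<open>\<iota>\<close>.\<close>

definition transport_ring :: "('a::comm_ring_1 \<Rightarrow> 'b) \<Rightarrow> 'a set \<Rightarrow> 'b ring" where
  "transport_ring \<iota> C = \<lparr>carrier = \<iota> ` C, monoid.mult = (\<lambda>x y. \<iota> (inv_into UNIV \<iota> x * inv_into UNIV \<iota> y)),
     monoid.one = \<iota> 1, ring.zero = \<iota> 0, ring.add = (\<lambda>x y. \<iota> (inv_into UNIV \<iota> x + inv_into UNIV \<iota> y))\<rparr>"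

context
  fixes \<iota> :: "'a::comm_ring_1 \<Rightarrow> 'b" and C :: "'a set"
  assumes inj: "inj \<iota>" and C: "subring_set C"
begin

lemma transport_ring_simps:
  "carrier (transport_ring \<iota> C) = \<iota> ` C"
  "\<iota> x \<otimes>\<^bsub>transport_ring \<iota> C\<^esub> \<iota> y = \<iota> (x * y)"
  "\<iota> x \<oplus>\<^bsub>transport_ring \<iota> C\<^esub> \<iota> y = \<iota> (x + y)"
  "\<one>\<^bsub>transport_ring \<iota> C\<^esub> = \<iota> 1"
  "\<zero>\<^bsub>transport_ring \<iota> C\<^esub> = \<iota> 0"
  using inj by (simp_all add: transport_ring_def)

lemma cring_transport_ring: "cring (transport_ring \<iota> C)"
proof (rule cringI)
  show "abelian_group (transport_ring \<iota> C)"
  proof (rule abelian_groupI)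
    fix x assume "x \<in> carrier (transport_ring \<iota> C)"
    then obtain a where a: "a \<in> C" "x = \<iota> a" by (auto simp: transport_ring_simps)
    then show "\<exists>y\<in>carrier (transport_ring \<iota> C). y \<oplus>\<^bsub>transport_ring \<iota> C\<^esub> x = \<zero>\<^bsub>transport_ring \<iota> C\<^esub>"
      using subring_setD(5)[OF C a(1)] by (intro bexI[of _ "\<iota> (- a)"]) (auto simp: transport_ring_simps)
  qed (auto simp: transport_ring_simps subring_setD(2,6)[OF C] algebra_simps)
  show "Group.comm_monoid (transport_ring \<iota> C)"
    by (rule comm_monoidI) (auto simp: transport_ring_simps subring_setD(1,4)[OF C] mult_ac)
qed (auto simp: transport_ring_simps algebra_simps)

lemma finsum_transport_ring:
  assumes "\<And>i. i \<in> F \<Longrightarrow> f i \<in> C" "finite F"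
  shows "finsum (transport_ring \<iota> C) (\<lambda>i. \<iota> (f i)) F = \<iota> (sum f F)"
proof -
  interpret cring "transport_ring \<iota> C" by (rule cring_transport_ring)
  show ?thesis
    using assms(2,1)
  proof (induction F rule: finite_induct)
    case (insert i F)
    have "(\<lambda>i. \<iota> (f i)) \<in> F \<rightarrow> carrier (transport_ring \<iota> C)" "\<iota> (f i) \<in> carrier (transport_ring \<iota> C)"
      using insert.prems by (auto simp: transport_ring_simps(1))
    then show ?case using insert by (simp add: finsum_insert transport_ring_simps(3))
  qed (simp add: transport_ring_simps)
qed

lemma noetherian_transport_ring:
  assumes "noetherian_set C"
  shows "noetherian_ring (transport_ring \<iota> C)"
proof -
  interpret cring "transport_ring \<iota> C" by (rule cring_transport_ring)
  show ?thesis
  proof (rule noetherian_ringI)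
    fix I assume "ideal I (transport_ring \<iota> C)"
    then interpret I: ideal I "transport_ring \<iota> C" .
    define J where "J = {x \<in> C. \<iota> x \<in> I}"
    have "ideal_in C J"
      unfolding ideal_in_def J_def
    proof (intro conjI ballI)
      show "0 \<in> {x \<in> C. \<iota> x \<in> I}"
        using I.additive_subgroup_axioms additive_subgroup.zero_closed subring_setD(2)[OF C]
        by (fastforce simp: transport_ring_simps(5))
    next
      fix x y assume "x \<in> {x \<in> C. \<iota> x \<in> I}" "y \<in> {x \<in> C. \<iota> x \<in> I}"
      then show "x + y \<in> {x \<in> C. \<iota> x \<in> I}"
        using I.a_closed[of "\<iota> x" "\<iota> y"] subring_setD(6)[OF C, of x y] by (simp add: transport_ring_simps)
    next
      fix c x assume "c \<in> C" "x \<in> {x \<in> C. \<iota> x \<in> I}"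
      then show "c * x \<in> {x \<in> C. \<iota> x \<in> I}"
        using I.I_l_closed[of "\<iota> x" "\<iota> c"] subring_setD(4)[OF C, of c x] by (simp add: transport_ring_simps)
    qed auto
    then have "fin_gen C J" using assms unfolding noetherian_set_def by simp
    then obtain S where S: "finite S" "S \<subseteq> J" "J \<subseteq> ideal_gen C S" unfolding fin_gen_def by (elim exE conjE)
    have SI: "\<iota> ` S \<subseteq> I" using S(2) by (auto simp: J_def)
    have SC: "\<iota> ` S \<subseteq> carrier (transport_ring \<iota> C)" using SI I.a_subset by blast
    interpret G: ideal "genideal (transport_ring \<iota> C) (\<iota> ` S)" "transport_ring \<iota> C"
      by (rule genideal_ideal[OF SC])
    have gen: "\<iota> x \<in> genideal (transport_ring \<iota> C) (\<iota> ` S)" if "x \<in> ideal_gen C S" for x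
      using that
    proof induction
      case zero
      show ?case using G.zero_closed by (simp add: transport_ring_simps)
    next
      case (step c s x)
      have "\<iota> s \<in> genideal (transport_ring \<iota> C) (\<iota> ` S)" using genideal_self[OF SC] step by blast
      then have "\<iota> c \<otimes>\<^bsub>transport_ring \<iota> C\<^esub> \<iota> s \<in> genideal (transport_ring \<iota> C) (\<iota> ` S)"
        using step by (intro G.I_l_closed) (auto simp: transport_ring_simps(1))
      from G.a_closed[OF this step.IH] show ?case by (simp add: transport_ring_simps)
    qed
    have "I = genideal (transport_ring \<iota> C) (\<iota> ` S)"
    proof
      show "I \<subseteq> genideal (transport_ring \<iota> C) (\<iota> ` S)"
      proof
        fix x assume "x \<in> I"
        then have "x \<in> \<iota> ` C" using I.a_subset by (auto simp: transport_ring_simps(1))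
        then obtain y where "x = \<iota> y" "y \<in> C" by blast
        then show "x \<in> genideal (transport_ring \<iota> C) (\<iota> ` S)" using \<open>x \<in> I\<close> S(3) gen by (auto simp: J_def)
      qed
    qed (rule genideal_minimal[OF I.ideal_axioms SI])
    then show "\<exists>A\<subseteq>carrier (transport_ring \<iota> C). finite A \<and> I = genideal (transport_ring \<iota> C) A"
      using SC S(1) by blast
  qed
qed

end

section \<open>Countability of the field of fractions\<close>

lemma countable_poly_mapping:
  assumes "countable (UNIV :: 'a::linorder set)" "countable (UNIV :: 'b::zero set)"
  shows "countable (UNIV :: ('a \<Rightarrow>\<^sub>0 'b) set)"
proof -
  have "countable (lists (UNIV :: ('a \<times> 'b) set))"
    using assms by (intro countable_lists) (metis UNIV_Times_UNIV countable_SIGMA)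
  then have "countable (Poly_Mapping.the_value ` lists (UNIV :: ('a \<times> 'b) set))" by (rule countable_image)
  moreover have "f \<in> Poly_Mapping.the_value ` lists (UNIV :: ('a \<times> 'b) set)" for f
    using the_value_items[of f] by (metis UNIV_I image_eqI lists_UNIV)
  ultimately show ?thesis by (metis UNIV_eq_I)
qed

lemma countable_fract:
  assumes "countable (UNIV :: 'a::idom set)"
  shows "countable (UNIV :: 'a fract set)"
proof -
  have "countable ((\<lambda>(a, b). Fract a b) ` (UNIV :: ('a \<times> 'a) set))"
    using assms by (intro countable_image) (metis UNIV_Times_UNIV countable_SIGMA)
  moreover have "x \<in> (\<lambda>(a, b). Fract a b) ` (UNIV :: ('a \<times> 'a) set)" for x :: "'a fract"
    by (cases x) force
  ultimately show ?thesis by (metis UNIV_eq_I)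
qed

text \<open>With rational coefficients and countably many variables the field of fractions is
  countable, so constant functions with natural values suffice as codes, whatever the type
  \<open>'g\<close> is.\<close>

lemma ex_inj_fract_poly:
  "\<exists>\<iota> :: ((nat \<Rightarrow>\<^sub>0 nat) \<Rightarrow>\<^sub>0 rat) fract \<Rightarrow> 'g \<Rightarrow> rat. inj \<iota>"
proof -
  have "countable (UNIV :: ((nat \<Rightarrow>\<^sub>0 nat) \<Rightarrow>\<^sub>0 rat) fract set)"
    by (intro countable_fract countable_poly_mapping) auto
  then obtain f :: "((nat \<Rightarrow>\<^sub>0 nat) \<Rightarrow>\<^sub>0 rat) fract \<Rightarrow> nat" where f: "inj f" unfolding countable_def by blast
  have "inj (\<lambda>x (_::'g). rat_of_nat (f x))"
    by (rule injI) (metis f inj_eq of_nat_eq_iff)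
  then show ?thesis by blast
qed

subsection \<open>A Noetherian graded ring with full support\<close>

lemma graded_noetherian_ring_exists:
  fixes G :: "('g, 'm) monoid_scheme" and \<phi> :: "'g \<Rightarrow> nat \<Rightarrow>\<^sub>0 rat"
  assumes G: "comm_group G" and inj\<phi>: "inj_on \<phi> (carrier G)"
    and hom: "\<And>x y. x \<in> carrier G \<Longrightarrow> y \<in> carrier G \<Longrightarrow> \<phi> (x \<otimes>\<^bsub>G\<^esub> y) = \<phi> x + \<phi> y"
    and r: "\<And>x i. x \<in> carrier G \<Longrightarrow> r \<le> i \<Longrightarrow> lookup (\<phi> x) i = 0"
  shows "\<exists>(R :: ('g \<Rightarrow> rat) ring) A. graded_ring R G A \<and> noetherian_ring R \<and> graded_supp R G A = carrier G"
proof -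
  interpret G: comm_group G by fact
  define \<Gamma> where "\<Gamma> = \<phi> ` carrier G"
  have \<phi>1: "\<phi> \<one>\<^bsub>G\<^esub> = 0" using hom[of "\<one>\<^bsub>G\<^esub>" "\<one>\<^bsub>G\<^esub>"] by simp
  have \<Gamma>0: "0 \<in> \<Gamma>" unfolding \<Gamma>_def using \<phi>1 by (metis G.one_closed imageI)
  have \<Gamma>_add: "u + v \<in> \<Gamma>" if uv: "u \<in> \<Gamma>" "v \<in> \<Gamma>" for u v
  proof -
    obtain x y where "x \<in> carrier G" "u = \<phi> x" "y \<in> carrier G" "v = \<phi> y"
      using uv unfolding \<Gamma>_def by (elim imageE)
    then have "u + v = \<phi> (x \<otimes>\<^bsub>G\<^esub> y)" "x \<otimes>\<^bsub>G\<^esub> y \<in> carrier G" using hom[of x y] by simp_all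
    then show ?thesis unfolding \<Gamma>_def by (rule image_eqI)
  qed
  have \<phi>_inv: "\<phi> (inv\<^bsub>G\<^esub> x) = - \<phi> x" if "x \<in> carrier G" for x
    using hom[of "inv\<^bsub>G\<^esub> x" x] that \<phi>1 by (simp add: eq_neg_iff_add_eq_0)
  have \<Gamma>_uminus: "- u \<in> \<Gamma>" if u: "u \<in> \<Gamma>" for u
  proof -
    obtain x where "x \<in> carrier G" "u = \<phi> x" using u unfolding \<Gamma>_def by (elim imageE)
    then have "- u = \<phi> (inv\<^bsub>G\<^esub> x)" "inv\<^bsub>G\<^esub> x \<in> carrier G" using \<phi>_inv[of x] by simp_all
    then show ?thesis unfolding \<Gamma>_def by (rule image_eqI)
  qed
  have \<Gamma>_cancel: "u \<in> \<Gamma>" if "u + v \<in> \<Gamma>" "v \<in> \<Gamma>" for u v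
    using \<Gamma>_add[OF that(1) \<Gamma>_uminus[OF that(2)]] by simp
  have "countable (UNIV :: (nat \<Rightarrow>\<^sub>0 rat) set)" by (intro countable_poly_mapping) auto
  then have "countable \<Gamma>" by (rule countable_subset[OF subset_UNIV])
  \<comment> \<open>An enumeration with possible repetitions, which also covers a trivial
    \<open>\<Gamma>\<close>. The variable \<open>j\<close> gets degree \<open>e j\<close>, so every
    element of \<open>\<Gamma>\<close> is the degree of a variable.\<close>
  define e where "e = from_nat_into \<Gamma>"
  have e: "range e = \<Gamma>" unfolding e_def using \<Gamma>0 \<open>countable \<Gamma>\<close> by (intro range_from_nat_into) auto
  \<comment> \<open>The product is that of the ring \<open>nat \<Rightarrow>\<^sub>0 rat\<close>, in
    which \<open>of_nat k * v\<close> is the \<open>k\<close>-fold sum of \<open>v\<close>.\<close>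
  define w :: "(nat \<Rightarrow>\<^sub>0 nat) \<Rightarrow> nat \<Rightarrow>\<^sub>0 rat"
    where "w m = (\<Sum>j\<in>keys m. of_nat (lookup m j) * e j)" for m
  have w_superset: "w m = (\<Sum>j\<in>K. of_nat (lookup m j) * e j)"
    if "finite K" "keys m \<subseteq> K" for m K
    unfolding w_def using that by (intro sum.mono_neutral_left) (auto simp: in_keys_iff)
  have w: "grading w"
  proof
    show "w 0 = 0" by (simp add: w_def)
    fix m m' :: "nat \<Rightarrow>\<^sub>0 nat"
    let ?K = "keys m \<union> keys m'"
    have "w (m + m') = (\<Sum>j\<in>?K. of_nat (lookup (m + m') j) * e j)"
      by (rule w_superset) (auto dest: subsetD[OF keys_add])
    also have "\<dots> = (\<Sum>j\<in>?K. of_nat (lookup m j) * e j) + (\<Sum>j\<in>?K. of_nat (lookup m' j) * e j)"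
      by (simp add: lookup_add sum.distrib distrib_right)
    also have "\<dots> = w m + w m'" by (subst (1 2) w_superset[of ?K]) auto
    finally show "w (m + m') = w m + w m'" .
  qed
  have mult_\<Gamma>: "of_nat k * v \<in> \<Gamma>" if "v \<in> \<Gamma>" for k :: nat and v
    by (induction k) (simp_all add: \<Gamma>0 \<Gamma>_add that distrib_right)
  have e_\<Gamma>: "e j \<in> \<Gamma>" for j unfolding e[symmetric] by (rule rangeI)
  have w_\<Gamma>: "w m \<in> \<Gamma>" for m
  proof -
    have "(\<Sum>j\<in>K. of_nat (lookup m j) * e j) \<in> \<Gamma>" for K
      by (induction K rule: infinite_finite_induct) (simp_all add: \<Gamma>0 \<Gamma>_add mult_\<Gamma> e_\<Gamma>)
    then show ?thesis unfolding w_def .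
  qed
  have w_r: "lookup (w m) i = 0" if "r \<le> i" for m i
    using w_\<Gamma>[of m] r that unfolding \<Gamma>_def by auto
  define C where "C = (hom_fracs w :: ((nat \<Rightarrow>\<^sub>0 nat) \<Rightarrow>\<^sub>0 rat) fract set)"
  have C: "subring_set C" unfolding C_def by (rule subring_hom_fracs[OF w])
  define B where "B x = (frac_part w x :: ((nat \<Rightarrow>\<^sub>0 nat) \<Rightarrow>\<^sub>0 rat) fract set)" for x
  have BC: "B x \<subseteq> C" for x unfolding B_def C_def by (rule frac_part_subset)
  have homog_\<Gamma>: "x \<in> \<Gamma>" if a: "homog w x a" "a \<noteq> 0" for x and a :: "(nat \<Rightarrow>\<^sub>0 nat) \<Rightarrow>\<^sub>0 rat"
  proof -
    have "keys a \<noteq> {}" using a(2) by simp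
    then obtain m where "m \<in> keys a" by blast
    then show ?thesis using a(1) w_\<Gamma>[of m] by (auto simp: homog_def)
  qed
  \<comment> \<open>The parts are indexed by all rational vectors, the grading only by
    \<open>G\<close>. Nothing is lost: a nonzero fraction has the degrees of its numerator and
    denominator in the group \<open>\<Gamma>\<close>, hence also their difference.\<close>
  have B_\<Gamma>: "p = 0" if p: "p \<in> B x" and x: "x \<notin> \<Gamma>" for p x
  proof -
    obtain a b y where ab: "p = Fract a b" "b \<noteq> 0" "homog w y b" "homog w (x + y) a"
      using p unfolding B_def frac_part_def by blast
    have "a = 0" using homog_\<Gamma>[OF ab(4)] homog_\<Gamma>[OF ab(3,2)] \<Gamma>_cancel[of x y] x by auto
    then show ?thesis using ab by (simp add: fract_collapse)
  qed
  obtain \<iota> :: "((nat \<Rightarrow>\<^sub>0 nat) \<Rightarrow>\<^sub>0 rat) fract \<Rightarrow> 'g \<Rightarrow> rat" where \<iota>: "inj \<iota>" using ex_inj_fract_poly by blast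
  define T where "T = transport_ring \<iota> C"
  define A where "A g = \<iota> ` B (\<phi> g)" for g
  note T_simps = transport_ring_simps[OF \<iota> C, folded T_def]
  interpret T: cring T unfolding T_def by (rule cring_transport_ring[OF \<iota> C])
  have T_sum: "finsum T (\<lambda>i. \<iota> (f i)) F = \<iota> (sum f F)" if "\<And>i. i \<in> F \<Longrightarrow> f i \<in> C" "finite F"
    for f and F :: "'g set"
    unfolding T_def by (rule finsum_transport_ring[OF \<iota> C that])
  have AC: "A g \<subseteq> carrier T" for g unfolding A_def T_simps using BC by blast
  have sub: "additive_subgroup (A g) T" for g
  proof (rule additive_subgroup.intro, rule T.add.subgroupI)
    show "A g \<subseteq> carrier T" by (rule AC)
    show "A g \<noteq> {}" unfolding A_def B_def using zero_in_frac_part[OF w] by blast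
    fix a assume a: "a \<in> A g"
    then obtain p where p: "p \<in> B (\<phi> g)" "a = \<iota> p" by (auto simp: A_def)
    have "- p \<in> B (\<phi> g)" using p(1) unfolding B_def by (rule frac_part_uminus)
    then have m: "\<iota> (- p) \<in> A g" by (simp add: A_def)
    then have "\<ominus>\<^bsub>T\<^esub> a = \<iota> (- p)"
      using a AC by (intro T.minus_equality) (auto simp: p(2) T_simps)
    then show "\<ominus>\<^bsub>T\<^esub> a \<in> A g" using m by simp
    fix b assume "b \<in> A g"
    then obtain q where q: "q \<in> B (\<phi> g)" "b = \<iota> q" by (auto simp: A_def)
    have "p + q \<in> B (\<phi> g)" using p(1) q(1) unfolding B_def by (rule frac_part_add[OF w])
    then show "a \<oplus>\<^bsub>T\<^esub> b \<in> A g" by (simp add: A_def p q T_simps)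
  qed
  have mult: "x \<otimes>\<^bsub>T\<^esub> y \<in> A (g \<otimes>\<^bsub>G\<^esub> h)"
    if gh: "g \<in> carrier G" "h \<in> carrier G" and xy: "x \<in> A g" "y \<in> A h" for g h x y
  proof -
    obtain p q where p: "x = \<iota> p" "p \<in> B (\<phi> g)" and q: "y = \<iota> q" "q \<in> B (\<phi> h)"
      using xy by (auto simp: A_def)
    have "p * q \<in> B (\<phi> g + \<phi> h)" using p(2) q(2) unfolding B_def by (rule frac_part_mult[OF w])
    then show ?thesis by (simp add: A_def p q T_simps hom gh)
  qed
  have exists: "\<exists>x. x \<in> (\<Pi>\<^sub>E g\<in>carrier G. A g) \<and> finite {g \<in> carrier G. x g \<noteq> \<zero>\<^bsub>T\<^esub>} \<and>
      t = (\<Oplus>\<^bsub>T\<^esub>g\<in>{g \<in> carrier G. x g \<noteq> \<zero>\<^bsub>T\<^esub>}. x g)" if t: "t \<in> carrier T" for t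
  proof -
    obtain p where p: "p \<in> C" "t = \<iota> p" using t by (auto simp: T_simps)
    obtain X c where X: "finite X" and c: "\<And>x. c x \<in> B x" and pc: "p = (\<Sum>x\<in>X. c x)"
      using hom_fracs_decomposition[of p w] p(1) unfolding C_def B_def by metis
    \<comment> \<open>Distinct \<open>g\<close> have distinct \<open>\<phi> g\<close>, so the finite
      sum over degrees in \<open>X\<close> can be indexed by group elements; degrees of
      \<open>X\<close> outside \<open>\<Gamma>\<close> contribute \<open>0\<close>.\<close>
    define d where "d g = (if \<phi> g \<in> X then c (\<phi> g) else 0)" for g
    define x where "x = (\<lambda>g\<in>carrier G. \<iota> (d g))"
    let ?F = "{g \<in> carrier G. \<phi> g \<in> X}" and ?S = "{g \<in> carrier G. d g \<noteq> 0}"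
    have finF: "finite ?F"
      using X inj\<phi> by (intro inj_on_finite[of \<phi> ?F X]) (auto intro: inj_on_subset)
    have dB: "d g \<in> B (\<phi> g)" for g using c zero_in_frac_part[OF w] by (auto simp: d_def B_def)
    have S: "{g \<in> carrier G. x g \<noteq> \<zero>\<^bsub>T\<^esub>} = ?S"
      using \<iota> by (auto simp: x_def T_simps inj_eq)
    have finS: "finite ?S" using finF by (rule rev_finite_subset) (auto simp: d_def)
    have "(\<Oplus>\<^bsub>T\<^esub>g\<in>?S. x g) = (\<Oplus>\<^bsub>T\<^esub>g\<in>?S. \<iota> (d g))"
      using dB BC by (intro T.finsum_cong') (auto simp: x_def T_simps)
    also have "\<dots> = \<iota> (\<Sum>g\<in>?S. d g)" using dB BC finS by (intro T_sum) auto
    also have "(\<Sum>g\<in>?S. d g) = (\<Sum>g\<in>?F. d g)"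
      using finF by (intro sum.mono_neutral_left) (auto simp: d_def)
    also have "\<dots> = (\<Sum>g\<in>?F. c (\<phi> g))" by (intro sum.cong) (auto simp: d_def)
    also have "\<dots> = (\<Sum>x\<in>\<phi> ` ?F. c x)"
      using inj\<phi> by (subst sum.reindex) (auto intro: inj_on_subset)
    also have "\<dots> = p"
      unfolding pc
    proof (intro sum.mono_neutral_left X ballI)
      fix x assume "x \<in> X - \<phi> ` ?F"
      then have "x \<notin> \<Gamma>" by (auto simp: \<Gamma>_def)
      then show "c x = 0" by (rule B_\<Gamma>[OF c])
    qed auto
    finally have "t = (\<Oplus>\<^bsub>T\<^esub>g\<in>?S. x g)" using p by simp
    moreover have "x \<in> (\<Pi>\<^sub>E g\<in>carrier G. A g)" using dB by (auto simp: x_def A_def)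
    ultimately show ?thesis using finS by (intro exI[of _ x]) (simp add: S)
  qed
  have unique: "x = y"
    if x: "x \<in> (\<Pi>\<^sub>E g\<in>carrier G. A g)" "finite {g \<in> carrier G. x g \<noteq> \<zero>\<^bsub>T\<^esub>}"
      and y: "y \<in> (\<Pi>\<^sub>E g\<in>carrier G. A g)" "finite {g \<in> carrier G. y g \<noteq> \<zero>\<^bsub>T\<^esub>}"
      and xy: "(\<Oplus>\<^bsub>T\<^esub>g\<in>{g \<in> carrier G. x g \<noteq> \<zero>\<^bsub>T\<^esub>}. x g) = (\<Oplus>\<^bsub>T\<^esub>g\<in>{g \<in> carrier G. y g \<noteq> \<zero>\<^bsub>T\<^esub>}. y g)"
    for x y
  proof -
    define F where "F = {g \<in> carrier G. x g \<noteq> \<zero>\<^bsub>T\<^esub>} \<union> {g \<in> carrier G. y g \<noteq> \<zero>\<^bsub>T\<^esub>}"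
    have F: "finite F" "F \<subseteq> carrier G" using x y by (auto simp: F_def)
    \<comment> \<open>\<open>d z g\<close> is the fraction behind the component \<open>z g\<close>.
      Uniqueness is thereby reduced to the independence of the parts \<open>B (\<phi> g)\<close>,
      which have distinct degrees.\<close>
    define d where "d z g = (SOME p. p \<in> B (\<phi> g) \<and> z g = \<iota> p)" for z g
    have d: "d z g \<in> B (\<phi> g) \<and> z g = \<iota> (d z g)" if "z \<in> (\<Pi>\<^sub>E g\<in>carrier G. A g)" "g \<in> carrier G" for z g
    proof -
      have "z g \<in> A g" using that by auto
      then show ?thesis unfolding d_def A_def by (intro someI_ex[of "\<lambda>p. p \<in> B (\<phi> g) \<and> z g = \<iota> p"]) auto
    qed
    have total: "(\<Oplus>\<^bsub>T\<^esub>g\<in>{g \<in> carrier G. z g \<noteq> \<zero>\<^bsub>T\<^esub>}. z g) = \<iota> (\<Sum>g\<in>F. d z g)"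
      if z: "z \<in> (\<Pi>\<^sub>E g\<in>carrier G. A g)" and zF: "{g \<in> carrier G. z g \<noteq> \<zero>\<^bsub>T\<^esub>} \<subseteq> F" for z
    proof -
      let ?S = "{g \<in> carrier G. z g \<noteq> \<zero>\<^bsub>T\<^esub>}"
      have "(\<Oplus>\<^bsub>T\<^esub>g\<in>?S. z g) = (\<Oplus>\<^bsub>T\<^esub>g\<in>?S. \<iota> (d z g))"
        using d[OF z] BC by (intro T.finsum_cong') (auto simp: T_simps)
      also have "\<dots> = \<iota> (\<Sum>g\<in>?S. d z g)" using d[OF z] BC finite_subset[OF zF F(1)] by (intro T_sum) auto
      also have "(\<Sum>g\<in>?S. d z g) = (\<Sum>g\<in>F. d z g)"
      proof (intro sum.mono_neutral_left F(1) zF ballI)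
        fix g assume g: "g \<in> F - ?S"
        then have "\<iota> (d z g) = \<iota> 0" using d[OF z, of g] F(2) by (auto simp: T_simps)
        then show "d z g = 0" using \<iota> by (simp add: inj_eq)
      qed
      finally show ?thesis .
    qed
    have "\<iota> (\<Sum>g\<in>F. d x g) = \<iota> (\<Sum>g\<in>F. d y g)"
      using xy total[OF x(1)] total[OF y(1)] by (simp add: F_def)
    then have "(\<Sum>g\<in>F. d x g - d y g) = 0" using \<iota> by (simp add: inj_eq sum_subtractf)
    moreover have "d x g - d y g \<in> B (\<phi> g)" if "g \<in> F" for g
    proof -
      have "d x g + - d y g \<in> B (\<phi> g)"
        using d[OF x(1), of g] d[OF y(1), of g] F(2) that unfolding B_def
        by (intro frac_part_add[OF w] frac_part_uminus) auto
      then show ?thesis by simp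
    qed
    ultimately have eqF: "d x g - d y g = 0" if "g \<in> F" for g
      using frac_part_independent[OF w F(1), of "\<lambda>g. d x g - d y g" \<phi> g] that F(2) inj\<phi>
      unfolding B_def by (auto intro: inj_on_subset)
    show "x = y"
    proof (rule PiE_ext[OF x(1) y(1)])
      fix g assume g: "g \<in> carrier G"
      show "x g = y g"
      proof (cases "g \<in> F")
        case True
        then show ?thesis using eqF[of g] d[OF x(1) g] d[OF y(1) g] by simp
      next
        case False
        then show ?thesis using g by (auto simp: F_def)
      qed
    qed
  qed
  have "graded_ring T G A"
  proof (intro graded_ring.intro graded_ring_axioms.intro T.cring_axioms G)
    show "\<exists>!x. x \<in> (\<Pi>\<^sub>E g\<in>carrier G. A g) \<and> finite {g \<in> carrier G. x g \<noteq> \<zero>\<^bsub>T\<^esub>} \<and>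
      t = (\<Oplus>\<^bsub>T\<^esub>g\<in>{g \<in> carrier G. x g \<noteq> \<zero>\<^bsub>T\<^esub>}. x g)" if "t \<in> carrier T" for t
      using exists[OF that] by (rule ex_ex1I) (rule unique, auto)
  qed (use sub mult in auto)
  moreover have "noetherian_ring T"
    unfolding T_def C_def by (intro noetherian_transport_ring[OF \<iota> C[unfolded C_def]] noetherian_hom_fracs[OF w w_r])
  moreover have "graded_supp T G A = carrier G"
  proof -
    have "A g \<noteq> {\<zero>\<^bsub>T\<^esub>}" if g: "g \<in> carrier G" for g
    proof -
      \<comment> \<open>The variable \<open>j\<close> is a nonzero element of degree
        \<open>\<phi> g\<close>.\<close>
      obtain j where j: "e j = \<phi> g" using e g unfolding \<Gamma>_def by (metis imageE imageI)
      let ?Y = "single (single j 1) 1 :: (nat \<Rightarrow>\<^sub>0 nat) \<Rightarrow>\<^sub>0 rat"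
      have "w (single j 1) = \<phi> g" by (simp add: w_def j)
      then have "homog w (\<phi> g + 0) ?Y" using homog_single[of w "single j 1" 1] by simp
      then have "Fract ?Y 1 \<in> B (\<phi> g)"
        unfolding B_def frac_part_def using grading.homog_one[OF w] one_neq_zero by blast
      moreover have "Fract ?Y 1 \<noteq> 0"
        by (simp add: Zero_fract_def eq_fract) (metis lookup_single_eq lookup_zero one_neq_zero)
      then have "\<iota> (Fract ?Y 1) \<noteq> \<zero>\<^bsub>T\<^esub>" using \<iota> by (simp add: T_simps inj_eq)
      ultimately show ?thesis unfolding A_def by blast
    qed
    then show ?thesis by (auto simp: graded_supp_def)
  qed
  ultimately show ?thesis by blast
qed

subsection \<open>Homogeneous components\<close>

context graded_ring
begin

definition part :: "'g \<Rightarrow> 'r \<Rightarrow> 'r" where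
  "part g r = (THE x. x \<in> (\<Pi>\<^sub>E g\<in>carrier G. A g) \<and> finite {g \<in> carrier G. x g \<noteq> \<zero>} \<and>
     r = (\<Oplus>g\<in>{g \<in> carrier G. x g \<noteq> \<zero>}. x g)) g"

lemma homogeneous_closed: "g \<in> carrier G \<Longrightarrow> a \<in> A g \<Longrightarrow> a \<in> carrier R"
  using additive_subgroup.a_Hcarr[OF component_subgroup] .

lemma homogeneous_zero: "g \<in> carrier G \<Longrightarrow> \<zero> \<in> A g"
  using additive_subgroup.zero_closed[OF component_subgroup] .

lemma homogeneous_add: "g \<in> carrier G \<Longrightarrow> a \<in> A g \<Longrightarrow> b \<in> A g \<Longrightarrow> a \<oplus> b \<in> A g"
  using additive_subgroup.a_closed[OF component_subgroup] .

lemma part_props: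
  assumes "r \<in> carrier R"
  shows "g \<in> carrier G \<Longrightarrow> part g r \<in> A g" "finite {g \<in> carrier G. part g r \<noteq> \<zero>}"
    "r = (\<Oplus>g\<in>{g \<in> carrier G. part g r \<noteq> \<zero>}. part g r)"
proof -
  define x where "x = (THE x. x \<in> (\<Pi>\<^sub>E g\<in>carrier G. A g) \<and> finite {g \<in> carrier G. x g \<noteq> \<zero>} \<and>
     r = (\<Oplus>g\<in>{g \<in> carrier G. x g \<noteq> \<zero>}. x g))"
  have x: "x \<in> (\<Pi>\<^sub>E g\<in>carrier G. A g) \<and> finite {g \<in> carrier G. x g \<noteq> \<zero>} \<and>
     r = (\<Oplus>g\<in>{g \<in> carrier G. x g \<noteq> \<zero>}. x g)"
    unfolding x_def by (rule theI'[OF direct_sum[OF assms]])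
  have p: "part g r = x g" for g by (simp add: part_def x_def)
  show "g \<in> carrier G \<Longrightarrow> part g r \<in> A g" "finite {g \<in> carrier G. part g r \<noteq> \<zero>}"
    "r = (\<Oplus>g\<in>{g \<in> carrier G. part g r \<noteq> \<zero>}. part g r)"
    unfolding p using x by auto
qed

lemma part_closed [simp]: "r \<in> carrier R \<Longrightarrow> g \<in> carrier G \<Longrightarrow> part g r \<in> carrier R"
  using part_props(1) homogeneous_closed by blast

lemma part_sum_superset:
  assumes "r \<in> carrier R" "finite F" "F \<subseteq> carrier G" "{g \<in> carrier G. part g r \<noteq> \<zero>} \<subseteq> F"
  shows "(\<Oplus>g\<in>F. part g r) = r"
proof -
  have "(\<Oplus>g\<in>{g \<in> carrier G. part g r \<noteq> \<zero>}. part g r) = (\<Oplus>g\<in>F. part g r)"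
    using assms by (intro add.finprod_mono_neutral_cong_left) auto
  then show ?thesis using part_props(3)[OF assms(1)] by simp
qed

text \<open>Uniqueness of the decomposition in usable form: \<open>F\<close> may exceed the support,
  and \<open>x\<close> need not be extensional.\<close>

lemma part_unique:
  assumes x: "\<And>g. g \<in> carrier G \<Longrightarrow> x g \<in> A g" and F: "finite F" "F \<subseteq> carrier G"
    and zero: "\<And>g. g \<in> carrier G \<Longrightarrow> g \<notin> F \<Longrightarrow> x g = \<zero>" and sum: "r = (\<Oplus>g\<in>F. x g)"
    and g: "g \<in> carrier G"
  shows "part g r = x g"
proof -
  define y where "y = (\<lambda>g\<in>carrier G. x g)"
  have xc: "x g \<in> carrier R" if "g \<in> carrier G" for g using x that homogeneous_closed by blast
  have r: "r \<in> carrier R" unfolding sum using F xc by (intro finsum_closed) auto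
  have S: "{g \<in> carrier G. y g \<noteq> \<zero>} = {g \<in> carrier G. x g \<noteq> \<zero>}" by (auto simp: y_def)
  have sub: "{g \<in> carrier G. x g \<noteq> \<zero>} \<subseteq> F" using zero by auto
  have "(\<Oplus>g\<in>{g \<in> carrier G. x g \<noteq> \<zero>}. y g) = (\<Oplus>g\<in>F. x g)"
    using F xc sub by (intro add.finprod_mono_neutral_cong_left) (auto simp: y_def)
  then have "y \<in> (\<Pi>\<^sub>E g\<in>carrier G. A g) \<and> finite {g \<in> carrier G. y g \<noteq> \<zero>} \<and>
      r = (\<Oplus>g\<in>{g \<in> carrier G. y g \<noteq> \<zero>}. y g)"
    unfolding S using x sum finite_subset[OF sub F(1)] by (auto simp: y_def)
  then have "(THE x. x \<in> (\<Pi>\<^sub>E g\<in>carrier G. A g) \<and> finite {g \<in> carrier G. x g \<noteq> \<zero>} \<and>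
     r = (\<Oplus>g\<in>{g \<in> carrier G. x g \<noteq> \<zero>}. x g)) = y"
    by (rule the1_equality[OF direct_sum[OF r]])
  then show ?thesis using g by (simp add: part_def y_def)
qed

lemma part_add:
  assumes r: "r \<in> carrier R" and s: "s \<in> carrier R" and g: "g \<in> carrier G"
  shows "part g (r \<oplus> s) = part g r \<oplus> part g s"
proof -
  let ?F = "{g \<in> carrier G. part g r \<noteq> \<zero>} \<union> {g \<in> carrier G. part g s \<noteq> \<zero>}"
  have F: "finite ?F" "?F \<subseteq> carrier G" using part_props(2)[OF r] part_props(2)[OF s] by auto
  have "r \<oplus> s = (\<Oplus>g\<in>?F. part g r) \<oplus> (\<Oplus>g\<in>?F. part g s)"
    using part_sum_superset[OF r F] part_sum_superset[OF s F] by simp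
  also have "\<dots> = (\<Oplus>g\<in>?F. part g r \<oplus> part g s)" using r s F(2) by (intro finsum_addf[symmetric]) auto
  finally show ?thesis
    using r s g F by (intro part_unique[of "\<lambda>g. part g r \<oplus> part g s" ?F]) (auto intro: homogeneous_add part_props(1))
qed

lemma part_homogeneous:
  assumes h: "h \<in> carrier G" "a \<in> A h" and g: "g \<in> carrier G"
  shows "part g a = (if g = h then a else \<zero>)"
proof (rule part_unique[of _ "{h}"])
  have "(\<Oplus>g\<in>{h}. if g = h then a else \<zero>) = a" using homogeneous_closed[OF h] by simp
  then show "a = (\<Oplus>g\<in>{h}. if g = h then a else \<zero>)" by simp
qed (use h g homogeneous_zero in auto)

lemma part_mult:
  assumes h: "h \<in> carrier G" "a \<in> A h" and r: "r \<in> carrier R" and g: "g \<in> carrier G"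
  shows "part (h \<otimes>\<^bsub>G\<^esub> g) (a \<otimes> r) = a \<otimes> part g r"
proof -
  let ?S = "{g \<in> carrier G. part g r \<noteq> \<zero>}" and ?F = "(\<otimes>\<^bsub>G\<^esub>) h ` {g \<in> carrier G. part g r \<noteq> \<zero>}"
  let ?x = "\<lambda>k. a \<otimes> part (inv\<^bsub>G\<^esub> h \<otimes>\<^bsub>G\<^esub> k) r"
  have a: "a \<in> carrier R" using homogeneous_closed[OF h] .
  have inv: "inv\<^bsub>G\<^esub> h \<otimes>\<^bsub>G\<^esub> (h \<otimes>\<^bsub>G\<^esub> k) = k" "h \<otimes>\<^bsub>G\<^esub> (inv\<^bsub>G\<^esub> h \<otimes>\<^bsub>G\<^esub> k) = k" if "k \<in> carrier G" for k
    using h that by (simp_all add: G.m_assoc[symmetric])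
  have "a \<otimes> r = a \<otimes> (\<Oplus>g\<in>?S. part g r)" using part_props(3)[OF r] by simp
  also have "\<dots> = (\<Oplus>g\<in>?S. a \<otimes> part g r)" using a r part_props(2)[OF r] by (intro finsum_rdistr) auto
  also have "\<dots> = (\<Oplus>g\<in>?S. ?x (h \<otimes>\<^bsub>G\<^esub> g))" using a r by (intro finsum_cong') (auto simp: inv)
  also have "\<dots> = (\<Oplus>k\<in>?F. ?x k)"
    using a r h by (intro finsum_reindex[symmetric]) (auto simp: inv intro!: inj_onI)
  finally have sum: "a \<otimes> r = (\<Oplus>k\<in>?F. ?x k)" .
  have "part (h \<otimes>\<^bsub>G\<^esub> g) (a \<otimes> r) = ?x (h \<otimes>\<^bsub>G\<^esub> g)"
  proof (rule part_unique[OF _ _ _ _ sum])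
    fix k assume k: "k \<in> carrier G"
    have "a \<otimes> part (inv\<^bsub>G\<^esub> h \<otimes>\<^bsub>G\<^esub> k) r \<in> A (h \<otimes>\<^bsub>G\<^esub> (inv\<^bsub>G\<^esub> h \<otimes>\<^bsub>G\<^esub> k))"
      using h k r by (intro component_mult part_props(1)) auto
    then show "?x k \<in> A k" using inv(2)[OF k] by simp
    assume "k \<notin> ?F"
    then have "part (inv\<^bsub>G\<^esub> h \<otimes>\<^bsub>G\<^esub> k) r = \<zero>"
      using inv(2)[OF k] k h by (metis (mono_tags, lifting) G.inv_closed G.m_closed image_eqI mem_Collect_eq)
    then show "?x k = \<zero>" using a by simp
  qed (use part_props(2)[OF r] h g in auto)
  then show ?thesis using inv(1)[OF g] by simp
qed

lemma part_uminus:
  assumes r: "r \<in> carrier R" and g: "g \<in> carrier G"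
  shows "part g (\<ominus> r) = \<ominus> part g r"
proof -
  have "part g \<zero> = \<zero>" using part_homogeneous[OF g homogeneous_zero[OF g] g] by simp
  then have "part g (\<ominus> r) \<oplus> part g r = \<zero>" using part_add[of "\<ominus> r" r g] r g by (simp add: l_neg)
  then show ?thesis using r g by (intro minus_equality[symmetric]) auto
qed

text \<open>The grading only demands closure under products. Let \<open>e\<close> be the part of
  \<open>1\<close> of neutral degree. Comparing parts of degree \<open>h\<close> in
  \<open>a = a \<otimes> 1\<close> gives \<open>a \<otimes> e = a\<close> for \<open>a\<close> of
  degree \<open>h\<close>; summing this over the parts of \<open>1\<close> gives
  \<open>e = 1\<close>.\<close>

lemma one_homogeneous: "\<one> \<in> A \<one>\<^bsub>G\<^esub>"
proof -
  let ?e = "part \<one>\<^bsub>G\<^esub> \<one>"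
  have e: "?e \<in> carrier R" by simp
  have *: "a \<otimes> ?e = a" if "h \<in> carrier G" "a \<in> A h" for h a
    using part_mult[OF that, of \<one> "\<one>\<^bsub>G\<^esub>"] part_homogeneous[OF that, of h] that homogeneous_closed[OF that] by simp
  let ?S = "{g \<in> carrier G. part g \<one> \<noteq> \<zero>}"
  have "?e = \<one> \<otimes> ?e" by simp
  also have "\<dots> = (\<Oplus>g\<in>?S. part g \<one>) \<otimes> ?e" using part_props(3)[OF one_closed] by simp
  also have "\<dots> = (\<Oplus>g\<in>?S. part g \<one> \<otimes> ?e)" using part_props(2)[OF one_closed] e by (intro finsum_ldistr) auto
  also have "\<dots> = (\<Oplus>g\<in>?S. part g \<one>)" by (intro finsum_cong') (auto intro!: * part_props(1))
  also have "\<dots> = \<one>" using part_props(3)[OF one_closed] by simp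
  finally show ?thesis using part_props(1)[OF one_closed G.one_closed] by simp
qed

section \<open>Homogeneous ideals and the degrees occurring in their quotients\<close>

definition homogeneous_ideal :: "'r set \<Rightarrow> bool" where
  "homogeneous_ideal I \<longleftrightarrow> ideal I R \<and> (\<forall>r\<in>I. \<forall>g\<in>carrier G. part g r \<in> I)"

text \<open>For a homogeneous ideal, the support of the graded ring \<open>R/I\<close>, expressed
  without forming the quotient.\<close>

definition supp_mod :: "'r set \<Rightarrow> 'g set" where
  "supp_mod I = {g \<in> carrier G. \<not> A g \<subseteq> I}"

lemma homogeneous_ideal_sum:
  assumes I: "homogeneous_ideal I" and h: "h \<in> carrier G" "a \<in> A h"
  shows "homogeneous_ideal (set_add R I (PIdl a))" "I \<subseteq> set_add R I (PIdl a)" "a \<in> set_add R I (PIdl a)"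
    "b \<in> set_add R I (PIdl a) \<Longrightarrow> \<exists>y\<in>I. \<exists>x\<in>carrier R. b = y \<oplus> x \<otimes> a"
proof -
  have a: "a \<in> carrier R" using homogeneous_closed[OF h] .
  interpret I: ideal I R using I by (simp add: homogeneous_ideal_def)
  have mem: "b \<in> set_add R I (PIdl a) \<longleftrightarrow> (\<exists>y\<in>I. \<exists>x\<in>carrier R. b = y \<oplus> x \<otimes> a)" for b
    unfolding set_add_def' cgenideal_def by blast
  have "ideal (set_add R I (PIdl a)) R" by (intro add_ideals I.ideal_axioms cgenideal_ideal a)
  moreover have "part g b \<in> set_add R I (PIdl a)" if b: "b \<in> set_add R I (PIdl a)" and g: "g \<in> carrier G" for b g
  proof -
    obtain y x where yx: "y \<in> I" "x \<in> carrier R" "b = y \<oplus> x \<otimes> a" using b unfolding mem by blast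
    let ?k = "inv\<^bsub>G\<^esub> h \<otimes>\<^bsub>G\<^esub> g"
    have "part g (a \<otimes> x) = a \<otimes> part ?k x"
      using part_mult[OF h yx(2), of ?k] h g by (simp add: G.m_assoc[symmetric])
    then have "part g b = part g y \<oplus> part ?k x \<otimes> a"
      using yx a g h I.a_Hcarr by (simp add: part_add m_comm[of _ a])
    moreover have "part g y \<in> I" using I yx(1) g by (simp add: homogeneous_ideal_def)
    moreover have "part ?k x \<in> carrier R" using yx h g by simp
    ultimately show ?thesis unfolding mem by blast
  qed
  ultimately show "homogeneous_ideal (set_add R I (PIdl a))" by (simp add: homogeneous_ideal_def)
  show "I \<subseteq> set_add R I (PIdl a)"
  proof
    fix y assume y: "y \<in> I"
    then have "y = y \<oplus> \<zero> \<otimes> a" using a I.a_Hcarr by simp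
    then show "y \<in> set_add R I (PIdl a)" unfolding mem using y by blast
  qed
  have "a = \<zero> \<oplus> \<one> \<otimes> a" using a by simp
  then show "a \<in> set_add R I (PIdl a)" unfolding mem using I.zero_closed by blast
  show "b \<in> set_add R I (PIdl a) \<Longrightarrow> \<exists>y\<in>I. \<exists>x\<in>carrier R. b = y \<oplus> x \<otimes> a" by (simp only: mem)
qed

lemma homogeneous_ideal_colon:
  assumes I: "homogeneous_ideal I" and h: "h \<in> carrier G" "a \<in> A h"
  shows "homogeneous_ideal {r \<in> carrier R. a \<otimes> r \<in> I}" "I \<subseteq> {r \<in> carrier R. a \<otimes> r \<in> I}"
proof -
  have a: "a \<in> carrier R" using homogeneous_closed[OF h] .
  interpret I: ideal I R using I by (simp add: homogeneous_ideal_def)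
  let ?Q = "{r \<in> carrier R. a \<otimes> r \<in> I}"
  have "ideal ?Q R"
  proof (rule idealI[OF ring_axioms])
    show "subgroup ?Q (add_monoid R)"
    proof (rule add.subgroupI)
      show "?Q \<noteq> {}" using a I.zero_closed by (intro ex_in_conv[THEN iffD1] exI[of _ \<zero>]) simp
      fix r assume r: "r \<in> ?Q"
      then show "\<ominus> r \<in> ?Q" using a I.a_inv_closed[of "a \<otimes> r"] by (simp add: r_minus)
      fix s assume "s \<in> ?Q"
      then show "r \<oplus> s \<in> ?Q" using r a I.a_closed by (simp add: r_distr)
    qed auto
    fix r x assume r: "r \<in> ?Q" "x \<in> carrier R"
    then have "x \<otimes> (a \<otimes> r) \<in> I" by (auto intro: I.I_l_closed[of "a \<otimes> r"])
    moreover have "a \<otimes> (x \<otimes> r) = x \<otimes> (a \<otimes> r)" "r \<otimes> x = x \<otimes> r"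
      using r a m_lcomm[of a x r] m_comm[of r x] by auto
    ultimately show "x \<otimes> r \<in> ?Q" "r \<otimes> x \<in> ?Q" using r by auto
  qed
  moreover have "part g r \<in> ?Q" if "r \<in> ?Q" "g \<in> carrier G" for r g
  proof -
    have "part (h \<otimes>\<^bsub>G\<^esub> g) (a \<otimes> r) \<in> I" using that I h by (auto simp: homogeneous_ideal_def)
    then show ?thesis using that part_mult[OF h, of r g] by simp
  qed
  ultimately show "homogeneous_ideal ?Q" by (simp add: homogeneous_ideal_def)
  show "I \<subseteq> ?Q" using a I.I_l_closed I.a_Hcarr by auto
qed

end

text \<open>Finite rank of the subgroup generated by \<open>S\<close>, tested on \<open>S\<close>
  itself: up to positive multiples, finitely many elements of \<open>S\<close> suffice. The negation
  directly supplies the next independent degree.\<close>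

definition finite_rank :: "('g, 'm) monoid_scheme \<Rightarrow> 'g set \<Rightarrow> bool" where
  "finite_rank G S \<longleftrightarrow> (\<exists>F\<subseteq>S. finite F \<and> (\<forall>s\<in>S. \<exists>n::nat. 0 < n \<and> s [^]\<^bsub>G\<^esub> n \<in> generate G F))"

lemma (in noetherian_ring) exists_maximal_ideal_in:
  assumes "U \<noteq> {}" "U \<subseteq> {I. ideal I R}"
  obtains M where "M \<in> U" "\<And>X. X \<in> U \<Longrightarrow> M \<subseteq> X \<Longrightarrow> X = M"
proof -
  have "\<Union>K \<in> U" if K: "K \<noteq> {}" "subset.chain U K" for K
  proof -
    have "subset.chain {I. ideal I R} K" using K(2) assms(2) unfolding subset_chain_def by blast
    then have "\<Union>K \<in> K" by (rule ideal_chain_is_trivial[OF K(1)])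
    then show ?thesis using K(2) unfolding subset_chain_def by blast
  qed
  from subset_Zorn_nonempty[OF assms(1) this] show ?thesis using that by auto
qed

text \<open>A negative exponent is turned positive by an inverse. This is infinite order of
  \<open>h\<close> modulo \<open>H\<close>, in the form needed for sums over integer
  exponents.\<close>

lemma (in comm_group) int_pow_in_subgroup:
  assumes H: "subgroup H G" and h: "h \<in> carrier G" "\<And>n::nat. 0 < n \<Longrightarrow> h [^] n \<notin> H"
    and k: "h [^] (k::int) \<in> H"
  shows "k = 0"
proof (rule ccontr)
  assume "k \<noteq> 0"
  have "h [^] (int (nat \<bar>k\<bar>)) \<in> H"
  proof (cases "k < 0")
    case True
    then have "h [^] (int (nat \<bar>k\<bar>)) = inv (h [^] k)" using h(1) by (simp add: int_pow_neg)
    then show ?thesis using subgroup.m_inv_closed[OF H k] by simp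
  qed (use k in simp)
  then have "h [^] (nat \<bar>k\<bar>) \<in> H" by (simp only: int_pow_int)
  then show False using h(2)[of "nat \<bar>k\<bar>"] \<open>k \<noteq> 0\<close> by simp
qed

text \<open>A separate constant, because the simplifier turns natural powers with exponent \<open>nat k\<close>
  into integer powers, which are not available for non-units.\<close>

definition top_gap :: "nat \<Rightarrow> int \<Rightarrow> nat" where
  "top_gap N n = nat (int N - n)"

lemma top_gap_zero [simp]: "top_gap N 0 = N"
  by (simp add: top_gap_def)

lemma top_gap_Suc: "n < int N \<Longrightarrow> top_gap N n = Suc (top_gap N (n + 1))"
  by (simp add: top_gap_def)

section \<open>Setting homogeneous elements of independent degrees equal to one\<close>

context graded_ring
begin

text \<open>Setting the elements of \<open>xs\<close> equal to \<open>1\<close> without inverting them: the parts of \<open>r\<close> whose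
  degrees differ from \<open>\<gamma>\<close> by an element of the span of the degrees in \<open>xs\<close> are multiplied by
  monomials that move them all to one degree; \<open>N\<close> bounds the exponents.\<close>

fun dehom :: "('g \<times> 'r) list \<Rightarrow> nat \<Rightarrow> 'g \<Rightarrow> 'r \<Rightarrow> 'r" where
  "dehom [] N \<gamma> r = part \<gamma> r"
| "dehom ((h, a) # xs) N \<gamma> r =
     (\<Oplus>n\<in>{- int N..int N}. dehom xs N (\<gamma> \<otimes>\<^bsub>G\<^esub> h [^]\<^bsub>G\<^esub> n) r \<otimes> a [^] top_gap N n)"

abbreviation span :: "('g \<times> 'r) list \<Rightarrow> 'g set" where
  "span xs \<equiv> generate G (fst ` set xs)"

text \<open>Each degree has infinite order modulo the span of the entries behind it, so the most
  recently chosen element stands at the head.\<close>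

fun indep :: "('g \<times> 'r) list \<Rightarrow> bool" where
  "indep [] \<longleftrightarrow> True"
| "indep ((h, a) # xs) \<longleftrightarrow> h \<in> carrier G \<and> a \<in> A h \<and> indep xs \<and> (\<forall>n::nat. 0 < n \<longrightarrow> h [^]\<^bsub>G\<^esub> n \<notin> span xs)"

lemma indep_carrier: "indep xs \<Longrightarrow> fst ` set xs \<subseteq> carrier G"
  by (induction xs rule: indep.induct) auto

lemma indep_mem: "indep xs \<Longrightarrow> (h, a) \<in> set xs \<Longrightarrow> h \<in> carrier G \<and> a \<in> A h"
  by (induction xs rule: indep.induct) auto

lemma subgroup_span: "indep xs \<Longrightarrow> subgroup (span xs) G"
  by (rule G.generate_is_subgroup[OF indep_carrier])

lemma dehom_closed:
  "indep xs \<Longrightarrow> \<gamma> \<in> carrier G \<Longrightarrow> r \<in> carrier R \<Longrightarrow> dehom xs N \<gamma> r \<in> carrier R"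
proof (induction xs N \<gamma> r rule: dehom.induct)
  case (2 h a xs N \<gamma> r)
  then have "dehom xs N (\<gamma> \<otimes>\<^bsub>G\<^esub> h [^]\<^bsub>G\<^esub> n) r \<otimes> a [^] top_gap N n \<in> carrier R"
    if "n \<in> {- int N..int N}" for n using that homogeneous_closed[of h a] by simp
  then show ?case by (auto intro!: finsum_closed)
qed simp

lemma dehom_add:
  "indep xs \<Longrightarrow> \<gamma> \<in> carrier G \<Longrightarrow> r \<in> carrier R \<Longrightarrow> s \<in> carrier R \<Longrightarrow>
    dehom xs N \<gamma> (r \<oplus> s) = dehom xs N \<gamma> r \<oplus> dehom xs N \<gamma> s"
proof (induction xs arbitrary: \<gamma>)
  case (Cons x xs)
  obtain h a where x: "x = (h, a)" by fastforce
  have h: "h \<in> carrier G" "a \<in> carrier R" "indep xs" using Cons.prems homogeneous_closed[of h a] by (auto simp: x)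
  have "dehom (x # xs) N \<gamma> (r \<oplus> s) = (\<Oplus>n\<in>{- int N..int N}.
      dehom xs N (\<gamma> \<otimes>\<^bsub>G\<^esub> h [^]\<^bsub>G\<^esub> n) r \<otimes> a [^] top_gap N n \<oplus> dehom xs N (\<gamma> \<otimes>\<^bsub>G\<^esub> h [^]\<^bsub>G\<^esub> n) s \<otimes> a [^] top_gap N n)"
    unfolding x dehom.simps using Cons.prems h Cons.IH
    by (intro finsum_cong') (auto simp: l_distr dehom_closed)
  also have "\<dots> = dehom (x # xs) N \<gamma> r \<oplus> dehom (x # xs) N \<gamma> s"
    unfolding x dehom.simps using Cons.prems h by (intro finsum_addf) (auto simp: dehom_closed)
  finally show ?case .
qed (simp add: part_add)

text \<open>Multiplication by a homogeneous element shifts all parts at once and leaves the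
  exponents \<open>n\<close> alone, so it only translates \<open>\<gamma>\<close>. This is what
  makes the eventual kernel below an ideal.\<close>

lemma dehom_mult:
  assumes \<delta>: "\<delta> \<in> carrier G" "s \<in> A \<delta>" and r: "r \<in> carrier R"
  shows "indep xs \<Longrightarrow> \<gamma> \<in> carrier G \<Longrightarrow> dehom xs N (\<delta> \<otimes>\<^bsub>G\<^esub> \<gamma>) (s \<otimes> r) = s \<otimes> dehom xs N \<gamma> r"
proof (induction xs arbitrary: \<gamma>)
  case (Cons x xs)
  obtain h a where x: "x = (h, a)" by fastforce
  have s: "s \<in> carrier R" using homogeneous_closed[OF \<delta>] .
  have h: "h \<in> carrier G" "a \<in> carrier R" "indep xs" using Cons.prems homogeneous_closed[of h a] by (auto simp: x)
  have "dehom (x # xs) N (\<delta> \<otimes>\<^bsub>G\<^esub> \<gamma>) (s \<otimes> r) = (\<Oplus>n\<in>{- int N..int N}.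
      s \<otimes> (dehom xs N (\<gamma> \<otimes>\<^bsub>G\<^esub> h [^]\<^bsub>G\<^esub> n) r \<otimes> a [^] top_gap N n))"
    unfolding x dehom.simps using Cons.prems h Cons.IH s r \<delta>
    by (intro finsum_cong') (auto simp: G.m_assoc m_assoc dehom_closed)
  also have "\<dots> = s \<otimes> dehom (x # xs) N \<gamma> r"
    unfolding x dehom.simps using Cons.prems h s r by (intro finsum_rdistr[symmetric]) (auto simp: dehom_closed)
  finally show ?case .
qed (simp add: part_mult[OF \<delta> r])

lemma dehom_ideal:
  assumes I: "homogeneous_ideal I" and r: "r \<in> I"
  shows "indep xs \<Longrightarrow> \<gamma> \<in> carrier G \<Longrightarrow> dehom xs N \<gamma> r \<in> I"
proof (induction xs arbitrary: \<gamma>)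
  case Nil
  then show ?case using I r by (simp add: homogeneous_ideal_def)
next
  case (Cons x xs)
  interpret I: ideal I R using I by (simp add: homogeneous_ideal_def)
  obtain h a where x: "x = (h, a)" by fastforce
  have h: "h \<in> carrier G" "a \<in> carrier R" "indep xs" using Cons.prems homogeneous_closed[of h a] by (auto simp: x)
  have summand: "dehom xs N (\<gamma> \<otimes>\<^bsub>G\<^esub> h [^]\<^bsub>G\<^esub> n) r \<otimes> a [^] top_gap N n \<in> I" for n
    using h Cons by (intro I.I_r_closed) auto
  have "(\<Oplus>n\<in>F. dehom xs N (\<gamma> \<otimes>\<^bsub>G\<^esub> h [^]\<^bsub>G\<^esub> n) r \<otimes> a [^] top_gap N n) \<in> I" if "finite F" for F
    using that
  proof (induction F rule: finite_induct)
    case (insert n F)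
    then show ?case using summand I.a_Hcarr by (subst finsum_insert) (auto intro!: I.a_closed)
  qed simp
  then show ?case by (simp add: x)
qed

text \<open>Only the parts of \<open>r\<close> with degrees in the coset of \<open>\<gamma>\<close>
  modulo the span enter into \<open>dehom\<close>.\<close>

lemma dehom_vanish:
  assumes r: "r \<in> carrier R"
  shows "indep xs \<Longrightarrow> \<gamma> \<in> carrier G \<Longrightarrow> (\<And>u. u \<in> span xs \<Longrightarrow> part (\<gamma> \<otimes>\<^bsub>G\<^esub> u) r = \<zero>) \<Longrightarrow> dehom xs N \<gamma> r = \<zero>"
proof (induction xs arbitrary: \<gamma>)
  case Nil
  then show ?case using Nil.prems(3)[OF generate.one] by simp
next
  case (Cons x xs)
  obtain h a where x: "x = (h, a)" by fastforce
  have h: "h \<in> carrier G" "a \<in> carrier R" "indep xs" using Cons.prems homogeneous_closed[of h a] by (auto simp: x)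
  have "dehom xs N (\<gamma> \<otimes>\<^bsub>G\<^esub> h [^]\<^bsub>G\<^esub> n) r = \<zero>" for n :: int
  proof (rule Cons.IH)
    fix u assume u: "u \<in> span xs"
    have uc: "u \<in> carrier G" using u subgroup.mem_carrier[OF subgroup_span[OF h(3)]] by blast
    have "h [^]\<^bsub>G\<^esub> n \<in> span (x # xs)"
      using Cons.prems(1) by (intro G.subgroup_int_pow_closed subgroup_span generate.incl) (auto simp: x)
    moreover have "u \<in> span (x # xs)" using u G.mono_generate[of "fst ` set xs" "fst ` set (x # xs)"] by auto
    ultimately have "h [^]\<^bsub>G\<^esub> n \<otimes>\<^bsub>G\<^esub> u \<in> span (x # xs)" by (rule generate.eng)
    then show "part (\<gamma> \<otimes>\<^bsub>G\<^esub> h [^]\<^bsub>G\<^esub> n \<otimes>\<^bsub>G\<^esub> u) r = \<zero>"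
      using Cons.prems(3)[of "h [^]\<^bsub>G\<^esub> n \<otimes>\<^bsub>G\<^esub> u"] Cons.prems(2) h uc by (simp add: G.m_assoc)
  qed (use h Cons.prems in auto)
  then show ?case using h by (simp add: x finsum_zero')
qed

text \<open>For homogeneous \<open>r\<close> of degree \<open>\<gamma>\<close>, independence leaves
  only the index \<open>0\<close> at each level, so \<open>dehom\<close> is \<open>r\<close> times
  the product of the powers \<open>a [^] N\<close>, one for each entry. None of these factors is a
  zero divisor modulo \<open>I\<close>.\<close>

lemma dehom_homogeneous_notin:
  assumes I: "homogeneous_ideal I" and r: "r \<in> A \<gamma>" "r \<notin> I" and \<gamma>: "\<gamma> \<in> carrier G"
    and nzd: "\<And>a h r. h \<in> carrier G \<Longrightarrow> a \<in> A h \<Longrightarrow> a \<notin> I \<Longrightarrow> r \<in> carrier R \<Longrightarrow> r \<otimes> a \<in> I \<Longrightarrow> r \<in> I"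
  shows "indep xs \<Longrightarrow> snd ` set xs \<inter> I = {} \<Longrightarrow> dehom xs N \<gamma> r \<notin> I"
proof (induction xs)
  case Nil
  then show ?case using r part_homogeneous[OF \<gamma> r(1) \<gamma>] by simp
next
  case (Cons x xs)
  obtain h a where x: "x = (h, a)" by fastforce
  have rc: "r \<in> carrier R" using homogeneous_closed[OF \<gamma> r(1)] .
  have h: "h \<in> carrier G" "a \<in> carrier R" "indep xs" "a \<in> A h" "a \<notin> I"
    using Cons.prems homogeneous_closed[of h a] by (auto simp: x)
  have ind: "h [^]\<^bsub>G\<^esub> n \<notin> span xs" if "0 < n" for n :: nat using Cons.prems that by (simp add: x)
  have zero: "dehom xs N (\<gamma> \<otimes>\<^bsub>G\<^esub> h [^]\<^bsub>G\<^esub> n) r = \<zero>" if n: "n \<noteq> 0" for n :: int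
  proof (rule dehom_vanish[OF rc h(3)])
    fix u assume u: "u \<in> span xs"
    have uc: "u \<in> carrier G" using u subgroup.mem_carrier[OF subgroup_span[OF h(3)]] by blast
    have "\<gamma> \<otimes>\<^bsub>G\<^esub> h [^]\<^bsub>G\<^esub> n \<otimes>\<^bsub>G\<^esub> u \<noteq> \<gamma>"
    proof
      assume "\<gamma> \<otimes>\<^bsub>G\<^esub> h [^]\<^bsub>G\<^esub> n \<otimes>\<^bsub>G\<^esub> u = \<gamma>"
      then have "h [^]\<^bsub>G\<^esub> n \<otimes>\<^bsub>G\<^esub> u = \<one>\<^bsub>G\<^esub>" using \<gamma> h uc by (simp add: G.m_assoc G.l_cancel_one)
      then have "h [^]\<^bsub>G\<^esub> n = inv\<^bsub>G\<^esub> u" using h uc by (intro G.inv_equality[symmetric]) auto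
      then have "h [^]\<^bsub>G\<^esub> n \<in> span xs" using subgroup.m_inv_closed[OF subgroup_span[OF h(3)] u] by simp
      then show False using G.int_pow_in_subgroup[OF subgroup_span[OF h(3)] h(1) ind] n by blast
    qed
    then show "part (\<gamma> \<otimes>\<^bsub>G\<^esub> h [^]\<^bsub>G\<^esub> n \<otimes>\<^bsub>G\<^esub> u) r = \<zero>"
      using part_homogeneous[OF \<gamma> r(1), of "\<gamma> \<otimes>\<^bsub>G\<^esub> h [^]\<^bsub>G\<^esub> n \<otimes>\<^bsub>G\<^esub> u"] \<gamma> h uc by simp
  qed (use \<gamma> h in auto)
  have dc: "dehom xs N \<gamma> r \<in> carrier R" using dehom_closed[OF h(3) \<gamma> rc] .
  have "dehom (x # xs) N \<gamma> r = (\<Oplus>n\<in>{- int N..int N}. if 0 = n then dehom xs N \<gamma> r \<otimes> a [^] N else \<zero>)"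
    unfolding x dehom.simps using zero \<gamma> h dc by (intro finsum_cong') auto
  also have "\<dots> = dehom xs N \<gamma> r \<otimes> a [^] N" using dc h by (intro finsum_singleton) auto
  finally have eq: "dehom (x # xs) N \<gamma> r = dehom xs N \<gamma> r \<otimes> a [^] N" .
  have "dehom xs N \<gamma> r \<otimes> a [^] k \<notin> I" for k :: nat
  proof (induction k)
    case 0
    have "dehom xs N \<gamma> r \<notin> I" using Cons.IH[OF h(3)] Cons.prems(2) by simp
    then show ?case using dc by simp
  next
    case (Suc k)
    then show ?case using nzd[OF h(1,4,5), of "dehom xs N \<gamma> r \<otimes> a [^] k"] dc h by (auto simp: m_assoc)
  qed
  then show ?case unfolding eq .
qed

text \<open>At most one coset index \<open>n\<close> meets the subgroup spanned by the tail, so setting a degree-\<open>h\<close>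
  element equal to \<open>1\<close> only affects boundary terms, which disappear for large \<open>N\<close>.\<close>

lemma dehom_minus_one:
  assumes "indep xs" "(h, a) \<in> set xs" "\<gamma> \<in> carrier G"
  shows "\<exists>N0. \<forall>N\<ge>N0. dehom xs N \<gamma> (a \<oplus> \<ominus> \<one>) = \<zero>"
  using assms
proof (induction xs arbitrary: \<gamma>)
  case (Cons x xs)
  obtain k b where x: "x = (k, b)" by fastforce
  have k: "k \<in> carrier G" "b \<in> carrier R" "indep xs" "b \<in> A k"
    using Cons.prems homogeneous_closed[of k b] by (auto simp: x)
  have h: "h \<in> carrier G" "a \<in> A h" "a \<in> carrier R"
    using indep_mem[OF Cons.prems(1,2)] homogeneous_closed[of h a] by auto
  have \<gamma>: "\<gamma> \<in> carrier G" by fact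
  note H = subgroup_span[OF k(3)]
  have ind: "k [^]\<^bsub>G\<^esub> n \<notin> span xs" if "0 < n" for n :: nat using Cons.prems(1) that by (simp add: x)
  have atmost: "m = n" if mn: "\<gamma> \<otimes>\<^bsub>G\<^esub> k [^]\<^bsub>G\<^esub> m \<in> span xs" "\<gamma> \<otimes>\<^bsub>G\<^esub> k [^]\<^bsub>G\<^esub> n \<in> span xs" for m n :: int
  proof -
    have "inv\<^bsub>G\<^esub> (\<gamma> \<otimes>\<^bsub>G\<^esub> k [^]\<^bsub>G\<^esub> n) \<otimes>\<^bsub>G\<^esub> (\<gamma> \<otimes>\<^bsub>G\<^esub> k [^]\<^bsub>G\<^esub> m) \<in> span xs"
      by (rule subgroup.m_closed[OF H subgroup.m_inv_closed[OF H mn(2)] mn(1)])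
    also have "inv\<^bsub>G\<^esub> (\<gamma> \<otimes>\<^bsub>G\<^esub> k [^]\<^bsub>G\<^esub> n) \<otimes>\<^bsub>G\<^esub> (\<gamma> \<otimes>\<^bsub>G\<^esub> k [^]\<^bsub>G\<^esub> m) = inv\<^bsub>G\<^esub> (k [^]\<^bsub>G\<^esub> n) \<otimes>\<^bsub>G\<^esub> k [^]\<^bsub>G\<^esub> m"
    proof -
      have "inv\<^bsub>G\<^esub> (\<gamma> \<otimes>\<^bsub>G\<^esub> k [^]\<^bsub>G\<^esub> n) = inv\<^bsub>G\<^esub> (k [^]\<^bsub>G\<^esub> n) \<otimes>\<^bsub>G\<^esub> inv\<^bsub>G\<^esub> \<gamma>"
        using \<gamma> k by (intro G.inv_mult_group) auto
      moreover have "inv\<^bsub>G\<^esub> \<gamma> \<otimes>\<^bsub>G\<^esub> (\<gamma> \<otimes>\<^bsub>G\<^esub> k [^]\<^bsub>G\<^esub> m) = k [^]\<^bsub>G\<^esub> m"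
        using \<gamma> k by (simp add: G.m_assoc[symmetric])
      ultimately show ?thesis using \<gamma> k by (simp add: G.m_assoc)
    qed
    also have "\<dots> = k [^]\<^bsub>G\<^esub> (m - n)"
    proof -
      have "inv\<^bsub>G\<^esub> (k [^]\<^bsub>G\<^esub> n) \<otimes>\<^bsub>G\<^esub> k [^]\<^bsub>G\<^esub> m = k [^]\<^bsub>G\<^esub> (- n) \<otimes>\<^bsub>G\<^esub> k [^]\<^bsub>G\<^esub> m"
        using k by (simp add: G.int_pow_neg)
      also have "\<dots> = k [^]\<^bsub>G\<^esub> (- n + m)" using k by (intro G.int_pow_mult[symmetric])
      finally show ?thesis by simp
    qed
    finally show ?thesis using G.int_pow_in_subgroup[OF H k(1) ind] by force
  qed
  have vanish: "dehom xs N \<gamma>' r = \<zero>"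
    if r: "r \<in> carrier R" "\<And>g. g \<in> carrier G \<Longrightarrow> g \<notin> span xs \<Longrightarrow> part g r = \<zero>"
      and \<gamma>': "\<gamma>' \<in> carrier G" "\<gamma>' \<notin> span xs" for N r \<gamma>'
  proof (rule dehom_vanish[OF r(1) k(3) \<gamma>'(1)])
    fix u assume u: "u \<in> span xs"
    have uc: "u \<in> carrier G" using u subgroup.mem_carrier[OF H] by blast
    have "\<gamma>' \<otimes>\<^bsub>G\<^esub> u \<notin> span xs"
    proof
      assume "\<gamma>' \<otimes>\<^bsub>G\<^esub> u \<in> span xs"
      then have "\<gamma>' \<otimes>\<^bsub>G\<^esub> u \<otimes>\<^bsub>G\<^esub> inv\<^bsub>G\<^esub> u \<in> span xs"
        by (rule subgroup.m_closed[OF H _ subgroup.m_inv_closed[OF H u]])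
      then show False using \<gamma>' uc by (simp add: G.m_assoc)
    qed
    then show "part (\<gamma>' \<otimes>\<^bsub>G\<^esub> u) r = \<zero>" using r(2) \<gamma>' uc by simp
  qed
  have one_span: "part g \<one> = \<zero>" if "g \<in> carrier G" "g \<notin> span xs" for g
    using part_homogeneous[OF G.one_closed one_homogeneous that(1)] that(2) generate.one by metis
    have shift: "\<gamma> \<otimes>\<^bsub>G\<^esub> k [^]\<^bsub>G\<^esub> n = k \<otimes>\<^bsub>G\<^esub> (\<gamma> \<otimes>\<^bsub>G\<^esub> k [^]\<^bsub>G\<^esub> (n - 1))" for n :: int
    proof -
      have "k [^]\<^bsub>G\<^esub> n = k [^]\<^bsub>G\<^esub> (1 + (n - 1))" by simp
      also have "\<dots> = k [^]\<^bsub>G\<^esub> (1::int) \<otimes>\<^bsub>G\<^esub> k [^]\<^bsub>G\<^esub> (n - 1)" using k by (intro G.int_pow_mult)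
      finally show ?thesis using \<gamma> k by (simp add: G.m_lcomm)
    qed
  \<comment> \<open>As \<open>b\<close> has degree \<open>k\<close>, its value at index
    \<open>n\<close> is \<open>b\<close> times the value of \<open>1\<close> at index
    \<open>n - 1\<close>.\<close>
  have b_shift: "dehom xs N (\<gamma> \<otimes>\<^bsub>G\<^esub> k [^]\<^bsub>G\<^esub> n) b = b \<otimes> dehom xs N (\<gamma> \<otimes>\<^bsub>G\<^esub> k [^]\<^bsub>G\<^esub> (n - 1)) \<one>" for N and n :: int
  proof -
    have "dehom xs N (k \<otimes>\<^bsub>G\<^esub> (\<gamma> \<otimes>\<^bsub>G\<^esub> k [^]\<^bsub>G\<^esub> (n - 1))) (b \<otimes> \<one>) = b \<otimes> dehom xs N (\<gamma> \<otimes>\<^bsub>G\<^esub> k [^]\<^bsub>G\<^esub> (n - 1)) \<one>"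
      using k \<gamma> by (intro dehom_mult) auto
    then show ?thesis using k by (simp add: shift[of n])
  qed
  have minus_one: "dehom xs N (\<gamma> \<otimes>\<^bsub>G\<^esub> k [^]\<^bsub>G\<^esub> n) (\<ominus> \<one>) = \<ominus> dehom xs N (\<gamma> \<otimes>\<^bsub>G\<^esub> k [^]\<^bsub>G\<^esub> n) \<one>" for N and n :: int
  proof -
    have one_neg: "\<ominus> \<one> \<in> A \<one>\<^bsub>G\<^esub>"
      by (rule additive_subgroup.a_inv_closed[OF component_subgroup[OF G.one_closed] one_homogeneous])
    have "dehom xs N (\<one>\<^bsub>G\<^esub> \<otimes>\<^bsub>G\<^esub> (\<gamma> \<otimes>\<^bsub>G\<^esub> k [^]\<^bsub>G\<^esub> n)) (\<ominus> \<one> \<otimes> \<one>) = \<ominus> \<one> \<otimes> dehom xs N (\<gamma> \<otimes>\<^bsub>G\<^esub> k [^]\<^bsub>G\<^esub> n) \<one>"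
      using k \<gamma> by (intro dehom_mult[OF G.one_closed one_neg]) auto
    then show ?thesis using k \<gamma> by (simp add: l_minus dehom_closed)
  qed
  show ?case
  proof (cases "\<exists>n::int. \<gamma> \<otimes>\<^bsub>G\<^esub> k [^]\<^bsub>G\<^esub> n \<in> span xs")
    case True
    then obtain m :: int where m: "\<gamma> \<otimes>\<^bsub>G\<^esub> k [^]\<^bsub>G\<^esub> m \<in> span xs" by blast
    have off: "dehom xs N (\<gamma> \<otimes>\<^bsub>G\<^esub> k [^]\<^bsub>G\<^esub> n) r = \<zero>"
      if "r \<in> carrier R" "\<And>g. g \<in> carrier G \<Longrightarrow> g \<notin> span xs \<Longrightarrow> part g r = \<zero>" "n \<noteq> m" for N r and n :: int
      using atmost[OF m] that k \<gamma> by (intro vanish) auto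
    show ?thesis
    proof (cases "(h, a) \<in> set xs")
      case True
      \<comment> \<open>Both degrees of \<open>a - 1\<close>, namely \<open>h\<close> and the
        neutral one, lie in the span of the tail. So only the index \<open>m\<close> survives, and
        there the induction hypothesis applies.\<close>
      have hs: "h \<in> span xs" using True by (force intro: generate.incl)
      have "part g (a \<oplus> \<ominus> \<one>) = \<zero>" if "g \<in> carrier G" "g \<notin> span xs" for g
        using part_add[of a "\<ominus> \<one>" g] part_uminus[of \<one> g] part_homogeneous[OF h(1,2), of g] one_span[OF that] that h hs
        by auto
      note off' = off[OF _ this]
      obtain N0 where N0: "\<forall>N\<ge>N0. dehom xs N (\<gamma> \<otimes>\<^bsub>G\<^esub> k [^]\<^bsub>G\<^esub> m) (a \<oplus> \<ominus> \<one>) = \<zero>"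
        using Cons.IH[OF k(3) True, of "\<gamma> \<otimes>\<^bsub>G\<^esub> k [^]\<^bsub>G\<^esub> m"] \<gamma> k by auto
      have "dehom (x # xs) N \<gamma> (a \<oplus> \<ominus> \<one>) = \<zero>" if N: "N \<ge> N0" for N
      proof -
        have "dehom xs N (\<gamma> \<otimes>\<^bsub>G\<^esub> k [^]\<^bsub>G\<^esub> n) (a \<oplus> \<ominus> \<one>) = \<zero>" for n :: int
          using N0 N off'[of n N] h by (cases "n = m") auto
        then show ?thesis using k by (simp add: x finsum_zero')
      qed
      then show ?thesis by blast
    next
      case False
      then have hk: "h = k" "a = b" using Cons.prems(2) by (auto simp: x)
      \<comment> \<open>Let \<open>T\<close> be the value of \<open>1\<close> at index
        \<open>m\<close>. Then \<open>b\<close> contributes \<open>b T\<close> at index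
        \<open>m + 1\<close>, weighted with the power \<open>N - m - 1\<close> of \<open>b\<close>,
        and \<open>- 1\<close> contributes \<open>- T\<close> at index \<open>m\<close>, weighted
        with the power \<open>N - m\<close>; the two cancel. The bound on \<open>N\<close> keeps
        both indices within the range of summation.\<close>
      have "dehom (x # xs) N \<gamma> (a \<oplus> \<ominus> \<one>) = \<zero>" if N: "N \<ge> nat \<bar>m\<bar> + 1" for N
      proof -
        define T where "T = dehom xs N (\<gamma> \<otimes>\<^bsub>G\<^esub> k [^]\<^bsub>G\<^esub> m) \<one>"
        have T: "T \<in> carrier R" unfolding T_def using k \<gamma> by (intro dehom_closed) auto
        have mN: "m \<in> {- int N..int N}" "m + 1 \<in> {- int N..int N}" "m < int N" using N by auto
        have one: "dehom xs N (\<gamma> \<otimes>\<^bsub>G\<^esub> k [^]\<^bsub>G\<^esub> n) \<one> = (if m = n then T else \<zero>)" for n :: int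
          using off[OF one_closed one_span, of n N] by (auto simp: T_def)
        have b: "dehom xs N (\<gamma> \<otimes>\<^bsub>G\<^esub> k [^]\<^bsub>G\<^esub> n) b = (if m + 1 = n then b \<otimes> T else \<zero>)" for n :: int
          using one[of "n - 1"] k by (auto simp: b_shift)
        have minus: "dehom xs N (\<gamma> \<otimes>\<^bsub>G\<^esub> k [^]\<^bsub>G\<^esub> n) (\<ominus> \<one>) = (if m = n then \<ominus> T else \<zero>)" for n :: int
          using one[of n] by (simp add: minus_one)
        have "dehom (x # xs) N \<gamma> (a \<oplus> \<ominus> \<one>) = (\<Oplus>n\<in>{- int N..int N}.
            (if m + 1 = n then b \<otimes> T \<otimes> b [^] top_gap N n else \<zero>) \<oplus> (if m = n then \<ominus> T \<otimes> b [^] top_gap N n else \<zero>))"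
          unfolding x hk dehom.simps using k \<gamma> T
          by (intro finsum_cong') (auto simp: dehom_add b minus)
        also have "\<dots> = (\<Oplus>n\<in>{- int N..int N}. if m + 1 = n then b \<otimes> T \<otimes> b [^] top_gap N n else \<zero>) \<oplus>
            (\<Oplus>n\<in>{- int N..int N}. if m = n then \<ominus> T \<otimes> b [^] top_gap N n else \<zero>)"
          using k T by (intro finsum_addf) auto
        also have "(\<Oplus>n\<in>{- int N..int N}. if m + 1 = n then b \<otimes> T \<otimes> b [^] top_gap N n else \<zero>) = b \<otimes> T \<otimes> b [^] top_gap N (m + 1)"
          using k T mN by (intro finsum_singleton) auto
        also have "(\<Oplus>n\<in>{- int N..int N}. if m = n then \<ominus> T \<otimes> b [^] top_gap N n else \<zero>) = \<ominus> T \<otimes> b [^] top_gap N m"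
          using k T mN by (intro finsum_singleton) auto
        also have "b \<otimes> T \<otimes> b [^] top_gap N (m + 1) \<oplus> \<ominus> T \<otimes> b [^] top_gap N m = \<zero>"
        proof -
          have "T \<otimes> b [^] top_gap N m = b \<otimes> T \<otimes> b [^] top_gap N (m + 1)"
            unfolding top_gap_Suc[OF mN(3)] using k T by (simp add: m_ac)
          then show ?thesis using k T by (simp add: l_minus r_neg)
        qed
        finally show ?thesis .
      qed
      then show ?thesis by blast
    qed
  next
    case False
    \<comment> \<open>No index meets the span of the tail, so every summand vanishes.\<close>
    have "dehom xs N (\<gamma> \<otimes>\<^bsub>G\<^esub> k [^]\<^bsub>G\<^esub> n) (a \<oplus> \<ominus> \<one>) = \<zero>" for n :: int and N
    proof (cases "(h, a) \<in> set xs")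
      case True
      have hs: "h \<in> span xs" using True by (force intro: generate.incl)
      have "part g (a \<oplus> \<ominus> \<one>) = \<zero>" if "g \<in> carrier G" "g \<notin> span xs" for g
        using part_add[of a "\<ominus> \<one>" g] part_uminus[of \<one> g] part_homogeneous[OF h(1,2), of g] one_span[OF that] that h hs
        by auto
      then show ?thesis using False h \<gamma> k by (intro vanish) auto
    next
      case out: False
      then have hk: "h = k" "a = b" using Cons.prems(2) by (auto simp: x)
      have one: "dehom xs N (\<gamma> \<otimes>\<^bsub>G\<^esub> k [^]\<^bsub>G\<^esub> n) \<one> = \<zero>" for n :: int
        using False \<gamma> k by (intro vanish one_span) auto
      have "dehom xs N (\<gamma> \<otimes>\<^bsub>G\<^esub> k [^]\<^bsub>G\<^esub> n) (b \<oplus> \<ominus> \<one>)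
          = dehom xs N (\<gamma> \<otimes>\<^bsub>G\<^esub> k [^]\<^bsub>G\<^esub> n) b \<oplus> dehom xs N (\<gamma> \<otimes>\<^bsub>G\<^esub> k [^]\<^bsub>G\<^esub> n) (\<ominus> \<one>)"
        using \<gamma> k by (intro dehom_add) auto
      then show ?thesis using k one by (simp add: hk b_shift minus_one)
    qed
    then show ?thesis using k by (simp add: x finsum_zero')
  qed
qed simp

text \<open>Stands for the kernel, modulo \<open>I\<close>, of setting the entries of
  \<open>xs\<close> to \<open>1\<close>. For a fixed \<open>N\<close> terms at the ends of the
  summation range may survive; hence \<open>N\<close> is taken large, with a bound that may depend
  on \<open>r\<close> and \<open>\<gamma>\<close>.\<close>

definition dehom_kernel :: "'r set \<Rightarrow> ('g \<times> 'r) list \<Rightarrow> 'r set" where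
  "dehom_kernel I xs = {r \<in> carrier R. \<forall>\<gamma>\<in>carrier G. \<exists>N0. \<forall>N\<ge>N0. dehom xs N \<gamma> r \<in> I}"

text \<open>A homogeneous factor translates \<open>\<gamma>\<close>, and a general factor is the sum
  of its parts. For a sum, the larger of the two bounds on \<open>N\<close> works.\<close>

lemma dehom_kernel_ideal:
  assumes I: "homogeneous_ideal I" and xs: "indep xs"
  shows "ideal (dehom_kernel I xs) R" "I \<subseteq> dehom_kernel I xs"
proof -
  interpret I: ideal I R using I by (simp add: homogeneous_ideal_def)
  let ?Z = "dehom_kernel I xs"
  show IZ: "I \<subseteq> ?Z"
    using dehom_ideal[OF I _ xs] I.a_Hcarr by (auto simp: dehom_kernel_def)
  have add: "r \<oplus> s \<in> ?Z" if rs: "r \<in> ?Z" "s \<in> ?Z" for r s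
  proof -
    have "\<exists>N0. \<forall>N\<ge>N0. dehom xs N \<gamma> (r \<oplus> s) \<in> I" if \<gamma>: "\<gamma> \<in> carrier G" for \<gamma>
    proof -
      obtain N1 N2 where N1: "\<forall>N\<ge>N1. dehom xs N \<gamma> r \<in> I" and N2: "\<forall>N\<ge>N2. dehom xs N \<gamma> s \<in> I"
        using rs \<gamma> unfolding dehom_kernel_def by blast
      have "dehom xs N \<gamma> (r \<oplus> s) \<in> I" if "N \<ge> max N1 N2" for N
        using that rs N1 N2 \<gamma> I.a_closed dehom_add[OF xs \<gamma>, of r s N] by (simp add: dehom_kernel_def)
      then show ?thesis by blast
    qed
    then show ?thesis using rs by (simp add: dehom_kernel_def)
  qed
  have hmult: "s \<otimes> r \<in> ?Z" if s: "\<delta> \<in> carrier G" "s \<in> A \<delta>" and r: "r \<in> ?Z" for \<delta> s r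
  proof -
    have sc: "s \<in> carrier R" and rc: "r \<in> carrier R"
      using homogeneous_closed[OF s] r by (auto simp: dehom_kernel_def)
    have "\<exists>N0. \<forall>N\<ge>N0. dehom xs N \<gamma> (s \<otimes> r) \<in> I" if \<gamma>: "\<gamma> \<in> carrier G" for \<gamma>
    proof -
      let ?\<gamma> = "inv\<^bsub>G\<^esub> \<delta> \<otimes>\<^bsub>G\<^esub> \<gamma>"
      have c: "?\<gamma> \<in> carrier G" "\<delta> \<otimes>\<^bsub>G\<^esub> ?\<gamma> = \<gamma>" using s \<gamma> by (simp_all add: G.m_assoc[symmetric])
      obtain N0 where N0: "\<forall>N\<ge>N0. dehom xs N ?\<gamma> r \<in> I" using r c(1) unfolding dehom_kernel_def by blast
      have "dehom xs N \<gamma> (s \<otimes> r) \<in> I" if "N \<ge> N0" for N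
        using dehom_mult[OF s rc xs c(1), of N] N0 that sc I.I_l_closed by (simp add: c(2))
      then show ?thesis by blast
    qed
    then show ?thesis using sc rc by (simp add: dehom_kernel_def)
  qed
  have zero: "\<zero> \<in> ?Z" using IZ I.zero_closed by blast
  have carr: "?Z \<subseteq> carrier R" by (auto simp: dehom_kernel_def)
  have mult: "s \<otimes> r \<in> ?Z" if s: "s \<in> carrier R" and r: "r \<in> ?Z" for s r
  proof -
    have rc: "r \<in> carrier R" using r carr by blast
    have "(\<Oplus>g\<in>F. part g s \<otimes> r) \<in> ?Z" if "finite F" "F \<subseteq> carrier G" for F
      using that
    proof (induction F rule: finite_induct)
      case (insert g F)
      then have "part g s \<otimes> r \<in> ?Z" using s r by (intro hmult[of g] part_props(1)) auto
      then show ?case using insert s rc by (subst finsum_insert) (auto intro!: add)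
    qed (simp add: zero)
    moreover have "(\<Oplus>g\<in>{g \<in> carrier G. part g s \<noteq> \<zero>}. part g s \<otimes> r) = s \<otimes> r"
      using finsum_ldistr[of "{g \<in> carrier G. part g s \<noteq> \<zero>}" r "\<lambda>g. part g s"] part_props(2,3)[OF s] s rc by auto
    ultimately show ?thesis using part_props(2)[OF s] by (metis (no_types, lifting) mem_Collect_eq subsetI)
  qed
  show "ideal ?Z R"
  proof (rule idealI[OF ring_axioms])
    show "subgroup ?Z (add_monoid R)"
    proof (rule add.subgroupI[OF carr])
      show "?Z \<noteq> {}" using zero by blast
      show "\<ominus> r \<in> ?Z" if r: "r \<in> ?Z" for r
      proof -
        have "\<ominus> r = \<ominus> \<one> \<otimes> r" using r carr by (auto simp: l_minus)
        then show ?thesis using mult[of "\<ominus> \<one>" r] r by simp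
      qed
    qed (rule add)
    fix r s assume "r \<in> ?Z" "s \<in> carrier R"
    then show "s \<otimes> r \<in> ?Z" "r \<otimes> s \<in> ?Z" using mult[of s r] m_comm[of r s] carr by auto
  qed
qed

text \<open>From the exact sequence \<open>0 \<rightarrow> R/(I : a) \<rightarrow> R/I \<rightarrow>
  R/(I + aR) \<rightarrow> 0\<close>, whose first map is multiplication by \<open>a\<close> and
  raises degrees by \<open>h\<close>: the degrees of \<open>R/I\<close> come from the two outer
  terms, and adjoining \<open>h\<close> to the two finite sets accounts for the shift.\<close>

lemma finite_rank_colon:
  assumes I: "homogeneous_ideal I" and h: "h \<in> carrier G" "a \<in> A h" "a \<notin> I"
    and 1: "finite_rank G (supp_mod (set_add R I (PIdl a)))"
    and 2: "finite_rank G (supp_mod {r \<in> carrier R. a \<otimes> r \<in> I})"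
  shows "finite_rank G (supp_mod I)"
proof -
  let ?K = "set_add R I (PIdl a)" and ?J = "{r \<in> carrier R. a \<otimes> r \<in> I}"
  interpret I: ideal I R using I by (simp add: homogeneous_ideal_def)
  obtain F1 where F1: "F1 \<subseteq> supp_mod ?K" "finite F1"
      "\<forall>s\<in>supp_mod ?K. \<exists>n::nat. 0 < n \<and> s [^]\<^bsub>G\<^esub> n \<in> generate G F1"
    using 1 unfolding finite_rank_def by (elim exE conjE)
  obtain F2 where F2: "F2 \<subseteq> supp_mod ?J" "finite F2"
      "\<forall>s\<in>supp_mod ?J. \<exists>n::nat. 0 < n \<and> s [^]\<^bsub>G\<^esub> n \<in> generate G F2"
    using 2 unfolding finite_rank_def by (elim exE conjE)
  let ?F = "insert h (F1 \<union> F2)"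
  have sub: "supp_mod ?K \<subseteq> supp_mod I" "supp_mod ?J \<subseteq> supp_mod I"
    using homogeneous_ideal_sum(2)[OF I h(1,2)] homogeneous_ideal_colon(2)[OF I h(1,2)]
    unfolding supp_mod_def by blast+
  have "h \<in> supp_mod I" using h by (auto simp: supp_mod_def)
  then have Fsub: "?F \<subseteq> supp_mod I" using F1(1) F2(1) sub by blast
  then have FG: "?F \<subseteq> carrier G" by (auto simp: supp_mod_def)
  have "\<exists>n::nat. 0 < n \<and> s [^]\<^bsub>G\<^esub> n \<in> generate G ?F" if s: "s \<in> supp_mod I" for s
  proof (cases "s \<in> supp_mod ?K")
    case True
    then obtain n :: nat where "0 < n" "s [^]\<^bsub>G\<^esub> n \<in> generate G F1" using F1(3) by blast
    moreover have "generate G F1 \<subseteq> generate G ?F" by (rule G.mono_generate) auto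
    ultimately show ?thesis by blast
  next
    case False
    have sG: "s \<in> carrier G" using s by (simp add: supp_mod_def)
    obtain b where b: "b \<in> A s" "b \<notin> I" using s by (auto simp: supp_mod_def)
    have "b \<in> ?K" using False b sG by (auto simp: supp_mod_def)
    then obtain y x where yx: "y \<in> I" "x \<in> carrier R" "b = y \<oplus> x \<otimes> a"
      using homogeneous_ideal_sum(4)[OF I h(1,2)] by blast
    have ac: "a \<in> carrier R" using homogeneous_closed[OF h(1,2)] .
    let ?s = "inv\<^bsub>G\<^esub> h \<otimes>\<^bsub>G\<^esub> s"
    have s': "?s \<in> carrier G" "h \<otimes>\<^bsub>G\<^esub> ?s = s" using h sG by (simp_all add: G.m_assoc[symmetric])
    \<comment> \<open>The part of degree \<open>s\<close> in \<open>b = y + x a\<close> shows that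
      \<open>a\<close> times the part of \<open>x\<close> of degree \<open>s - h\<close> lies
      outside \<open>I\<close>.\<close>
    have "b = part s b" using part_homogeneous[OF sG b(1) sG] by simp
    also have "\<dots> = part s y \<oplus> part s (a \<otimes> x)"
      using yx ac sG I.a_Hcarr by (simp add: part_add m_comm[of x a])
    also have "part s (a \<otimes> x) = a \<otimes> part ?s x" using part_mult[OF h(1,2) yx(2) s'(1)] s'(2) by simp
    finally have "b = part s y \<oplus> a \<otimes> part ?s x" .
    moreover have "part s y \<in> I" using I yx(1) sG by (simp add: homogeneous_ideal_def)
    ultimately have "a \<otimes> part ?s x \<notin> I" using b(2) I.a_closed by auto
    then have "?s \<in> supp_mod ?J" using part_props(1)[OF yx(2) s'(1)] s'(1) by (auto simp: supp_mod_def)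
    then obtain n :: nat where n: "0 < n" "?s [^]\<^bsub>G\<^esub> n \<in> generate G F2" using F2(3) by blast
    have "generate G F2 \<subseteq> generate G ?F" by (rule G.mono_generate) auto
    then have "?s [^]\<^bsub>G\<^esub> n \<in> generate G ?F" using n(2) by blast
    moreover have "h [^]\<^bsub>G\<^esub> int n \<in> generate G ?F"
      by (intro G.subgroup_int_pow_closed G.generate_is_subgroup FG generate.incl) simp
    then have "h [^]\<^bsub>G\<^esub> n \<in> generate G ?F" by (simp only: int_pow_int)
    ultimately have "h [^]\<^bsub>G\<^esub> n \<otimes>\<^bsub>G\<^esub> ?s [^]\<^bsub>G\<^esub> n \<in> generate G ?F" by (intro generate.eng)
    moreover have "h [^]\<^bsub>G\<^esub> n \<otimes>\<^bsub>G\<^esub> ?s [^]\<^bsub>G\<^esub> n = s [^]\<^bsub>G\<^esub> n"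
      using G.nat_pow_distrib[of h ?s n] h(1) s' by simp
    ultimately show ?thesis using n(1) by auto
  qed
  then show ?thesis unfolding finite_rank_def using Fsub F1(2) F2(2) by (intro exI[of _ ?F]) auto
qed

theorem finite_rank_supp:
  assumes noeth: "noetherian_ring R"
  shows "finite_rank G (graded_supp R G A)"
proof (rule ccontr)
  assume inf: "\<not> ?thesis"
  interpret N: noetherian_ring R by fact
  define U where "U = {I. homogeneous_ideal I \<and> \<not> finite_rank G (supp_mod I)}"
  have "part g \<zero> = \<zero>" if "g \<in> carrier G" for g
    using part_homogeneous[OF that homogeneous_zero[OF that] that] by simp
  then have "homogeneous_ideal {\<zero>}" using zeroideal by (simp add: homogeneous_ideal_def)
  moreover have "supp_mod {\<zero>} = graded_supp R G A"
    using homogeneous_zero by (auto simp: supp_mod_def graded_supp_def)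
  ultimately have "{\<zero>} \<in> U" using inf by (simp add: U_def)
  then have "U \<noteq> {}" by blast
  moreover have "U \<subseteq> {I. ideal I R}" by (auto simp: U_def homogeneous_ideal_def)
  ultimately obtain M where MU: "M \<in> U" and max: "\<And>X. X \<in> U \<Longrightarrow> M \<subseteq> X \<Longrightarrow> X = M"
    using N.exists_maximal_ideal_in[of U] by metis
  have M: "homogeneous_ideal M" and Minf: "\<not> finite_rank G (supp_mod M)" using MU by (auto simp: U_def)
  interpret M: ideal M R using M by (simp add: homogeneous_ideal_def)
  have nzd: "r \<in> M" if h: "h \<in> carrier G" "a \<in> A h" "a \<notin> M" and r: "r \<in> carrier R" "r \<otimes> a \<in> M" for a h r
  proof (rule ccontr)
    assume "r \<notin> M"
    \<comment> \<open>If \<open>r\<close> were a counterexample, both the colon ideal and the sum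
      would be strictly larger than \<open>M\<close>. Their quotients would then have degrees of
      finite rank, and so would \<open>R/M\<close>.\<close>
    let ?K = "set_add R M (PIdl a)" and ?J = "{r \<in> carrier R. a \<otimes> r \<in> M}"
    have "r \<in> ?J" using r homogeneous_closed[OF h(1,2)] m_comm[of r a] by simp
    then have "?J \<noteq> M" using \<open>r \<notin> M\<close> by metis
    then have "?J \<notin> U" using max[of ?J] homogeneous_ideal_colon(2)[OF M h(1,2)] by blast
    then have J: "finite_rank G (supp_mod ?J)"
      using homogeneous_ideal_colon(1)[OF M h(1,2)] by (simp add: U_def)
    have "?K \<noteq> M" using homogeneous_ideal_sum(3)[OF M h(1,2)] h(3) by metis
    then have "?K \<notin> U" using max[of ?K] homogeneous_ideal_sum(2)[OF M h(1,2)] by blast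
    then have "finite_rank G (supp_mod ?K)"
      using homogeneous_ideal_sum(1)[OF M h(1,2)] by (simp add: U_def)
    then show False using finite_rank_colon[OF M h _ J] Minf by blast
  qed
  have ex: "\<exists>x\<in>supp_mod M. \<forall>n::nat. 0 < n \<longrightarrow> x [^]\<^bsub>G\<^esub> n \<notin> generate G F" if "finite F" "F \<subseteq> supp_mod M" for F
  proof (rule ccontr)
    assume "\<not> ?thesis"
    then have "\<forall>s\<in>supp_mod M. \<exists>n::nat. 0 < n \<and> s [^]\<^bsub>G\<^esub> n \<in> generate G F" by simp
    then have "finite_rank G (supp_mod M)"
      unfolding finite_rank_def using that by (intro exI[of _ F] conjI)
    then show False using Minf by simp
  qed
  obtain g :: "nat \<Rightarrow> 'g" where g: "\<And>k. g k \<in> supp_mod M"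
      "\<And>k. \<forall>n::nat. 0 < n \<longrightarrow> g k [^]\<^bsub>G\<^esub> n \<notin> generate G (g ` {..<k})"
    using greedy_sequence[of "supp_mod M" "\<lambda>F x. \<forall>n::nat. 0 < n \<longrightarrow> x [^]\<^bsub>G\<^esub> n \<notin> generate G F", OF ex] by metis
  have gG: "g k \<in> carrier G" for k using g(1)[of k] by (simp add: supp_mod_def)
  have "\<exists>a. a \<in> A (g k) \<and> a \<notin> M" for k using g(1)[of k] by (auto simp: supp_mod_def)
  then obtain a where a: "\<And>k. a k \<in> A (g k)" "\<And>k. a k \<notin> M" by metis
  have ac: "a k \<in> carrier R" for k using homogeneous_closed[OF gG a(1)] .
  \<comment> \<open>The list is reversed because \<open>indep\<close> compares each entry with those
    behind it.\<close>
  define xs where "xs m = map (\<lambda>k. (g k, a k)) (rev [0..<m])" for m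
  have span_xs: "fst ` set (xs m) = g ` {..<m}" for m by (force simp: xs_def image_image)
  have xs_Suc: "xs (Suc m) = (g m, a m) # xs m" for m by (simp add: xs_def)
  have ind: "indep (xs m)" for m
  proof (induction m)
    case (Suc m)
    then show ?case unfolding xs_Suc using gG a(1) g(2)[of m] by (simp add: span_xs)
  qed (simp add: xs_def)
  define Z where "Z m = dehom_kernel M (xs m)" for m
  have Z: "ideal (Z m) R" "M \<subseteq> Z m" for m unfolding Z_def using dehom_kernel_ideal[OF M ind] by auto
  have aZ: "a k \<oplus> \<ominus> \<one> \<in> Z m" if "k < m" for k m
  proof -
    have "(g k, a k) \<in> set (xs m)" using that by (auto simp: xs_def)
    then have "\<exists>N0. \<forall>N\<ge>N0. dehom (xs m) N \<gamma> (a k \<oplus> \<ominus> \<one>) \<in> M" if "\<gamma> \<in> carrier G" for \<gamma>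
      using dehom_minus_one[OF ind _ that, of "g k" "a k" m] M.zero_closed by metis
    then show ?thesis using ac by (simp add: Z_def dehom_kernel_def)
  qed
  \<comment> \<open>In the coset of \<open>g m\<close> modulo the earlier degrees \<open>1\<close>
    has no part. So \<open>a m - 1\<close> has the same value as \<open>a m\<close>, which is
    homogeneous and not in \<open>M\<close>.\<close>
  have notZ: "a m \<oplus> \<ominus> \<one> \<notin> Z m" for m
  proof
    assume "a m \<oplus> \<ominus> \<one> \<in> Z m"
    then obtain N where N: "dehom (xs m) N (g m) (a m \<oplus> \<ominus> \<one>) \<in> M"
      using gG[of m] unfolding Z_def dehom_kernel_def by blast
    have "dehom (xs m) N (g m) (\<ominus> \<one>) = \<zero>"
    proof (rule dehom_vanish[OF _ ind gG])
      fix u assume u: "u \<in> span (xs m)"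
      have uc: "u \<in> carrier G" using u subgroup.mem_carrier[OF subgroup_span[OF ind]] by blast
      have "g m \<otimes>\<^bsub>G\<^esub> u \<noteq> \<one>\<^bsub>G\<^esub>"
      proof
        assume "g m \<otimes>\<^bsub>G\<^esub> u = \<one>\<^bsub>G\<^esub>"
        then have "g m = inv\<^bsub>G\<^esub> u" using gG uc by (intro G.inv_equality[symmetric]) auto
        then have "g m \<in> span (xs m)" using subgroup.m_inv_closed[OF subgroup_span[OF ind] u] by simp
        then show False using g(2)[of m] gG[of m] unfolding span_xs by (auto dest: spec[of _ 1])
      qed
      then show "part (g m \<otimes>\<^bsub>G\<^esub> u) (\<ominus> \<one>) = \<zero>"
        using part_uminus[OF one_closed, of "g m \<otimes>\<^bsub>G\<^esub> u"]
          part_homogeneous[OF G.one_closed one_homogeneous, of "g m \<otimes>\<^bsub>G\<^esub> u"] gG uc by simp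
    qed simp
    then have "dehom (xs m) N (g m) (a m) \<in> M"
      using N dehom_add[OF ind gG ac, of "\<ominus> \<one>" m N m] dehom_closed[OF ind gG ac] by simp
    moreover have disj: "snd ` set (xs m) \<inter> M = {}" using a(2) by (auto simp: xs_def)
    have "dehom (xs m) N (g m) (a m) \<notin> M"
      by (rule dehom_homogeneous_notin[OF M a(1) a(2) gG _ ind disj]) (rule nzd)
    ultimately show False by blast
  qed
  \<comment> \<open>These ideals form an increasing chain by construction; the kernels
    \<open>Z m\<close> serve as upper bounds that omit \<open>a m - 1\<close>.\<close>
  define J where "J m = Idl (M \<union> (\<lambda>k. a k \<oplus> \<ominus> \<one>) ` {..<m})" for m
  have gen_carr: "M \<union> (\<lambda>k. a k \<oplus> \<ominus> \<one>) ` {..<m} \<subseteq> carrier R" for m using M.a_subset ac by auto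
  have J: "ideal (J m) R" "M \<union> (\<lambda>k. a k \<oplus> \<ominus> \<one>) ` {..<m} \<subseteq> J m" for m
    unfolding J_def using genideal_ideal[OF gen_carr] genideal_self[OF gen_carr] by auto
  have J_mono: "J m \<subseteq> J n" if "m \<le> n" for m n
    unfolding J_def using gen_carr that J(2)[of n, unfolded J_def] by (intro genideal_minimal genideal_ideal) auto
  have "subset.chain {I. ideal I R} (range J)"
    unfolding subset_chain_def
  proof (intro conjI ballI)
    fix X Y assume "X \<in> range J" "Y \<in> range J"
    then obtain i j where "X = J i" "Y = J j" by blast
    then show "X \<subseteq> Y \<or> Y \<subseteq> X" using J_mono[of i j] J_mono[of j i] by (cases "i \<le> j") auto
  qed (use J(1) in auto)
  then have "\<Union>(range J) \<in> range J" by (intro N.ideal_chain_is_trivial) auto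
  then obtain m where m: "\<Union>(range J) = J m" by blast
  have "a m \<oplus> \<ominus> \<one> \<in> J (Suc m)" using J(2)[of "Suc m"] by auto
  then have "a m \<oplus> \<ominus> \<one> \<in> J m" using m by blast
  moreover have "J m \<subseteq> Z m" unfolding J_def using Z aZ by (intro genideal_minimal) auto
  ultimately show False using notZ by blast
qed

end

subsection \<open>The rational vector space of an abelian group\<close>

text \<open>Scalar multiplication on representatives; the same expression occurs inside
  \<open>rat_tensor\<close>.\<close>

definition rescale :: "rat \<Rightarrow> (rat \<times> 'h \<Rightarrow>\<^sub>0 int) \<Rightarrow> (rat \<times> 'h \<Rightarrow>\<^sub>0 int)" where
  "rescale q = frag_extend (\<lambda>(p, h). frag_of (q * p, h))"

lemma rescale_simps [simp]:
  "rescale q 0 = 0" "rescale q (frag_of (p, h)) = frag_of (q * p, h)"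
  "rescale q (x + y) = rescale q x + rescale q y" "rescale q (x - y) = rescale q x - rescale q y"
  "rescale q (- x) = - rescale q x"
  by (simp_all add: rescale_def frag_extend_add frag_extend_diff frag_extend_minus)

context
  fixes H :: "('h, 'm) monoid_scheme"
  assumes H: "comm_group H"
begin

interpretation H: comm_group H by (rule H)

abbreviation (input) rat_frags :: "(rat \<times> 'h \<Rightarrow>\<^sub>0 int) set" where
  "rat_frags \<equiv> {x. keys x \<subseteq> UNIV \<times> carrier H}"

definition rat_relations :: "(rat \<times> 'h \<Rightarrow>\<^sub>0 int) set" where
  "rat_relations = tensor_relations (add_monoid rat_field) H"

definition rel_kernel :: "(rat \<times> 'h \<Rightarrow>\<^sub>0 int) set" where
  "rel_kernel = tensor_kernel (add_monoid rat_field) H"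

lemma rel_kernel_generate: "rel_kernel = generate (free_Abelian_group (UNIV \<times> carrier H)) rat_relations"
  by (simp add: rel_kernel_def rat_relations_def tensor_kernel_def)

definition tcls :: "(rat \<times> 'h \<Rightarrow>\<^sub>0 int) \<Rightarrow> (rat \<times> 'h \<Rightarrow>\<^sub>0 int) set" where
  "tcls x = (\<lambda>k. k + x) ` rel_kernel"

lemma rat_frags_simps:
  "0 \<in> rat_frags" "frag_of (p, h) \<in> rat_frags \<longleftrightarrow> h \<in> carrier H"
  "x \<in> rat_frags \<Longrightarrow> y \<in> rat_frags \<Longrightarrow> x + y \<in> rat_frags"
  "x \<in> rat_frags \<Longrightarrow> y \<in> rat_frags \<Longrightarrow> x - y \<in> rat_frags"
  "x \<in> rat_frags \<Longrightarrow> - x \<in> rat_frags"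
  using keys_add[of x y] keys_diff[of x y] by auto

lemma rat_frags_induct [consumes 1, case_names zero diff frag]:
  assumes "x \<in> rat_frags" "P 0"
    "\<And>x y. x \<in> rat_frags \<Longrightarrow> y \<in> rat_frags \<Longrightarrow> P x \<Longrightarrow> P y \<Longrightarrow> P (x - y)"
    "\<And>p h. h \<in> carrier H \<Longrightarrow> P (frag_of (p, h))"
  shows "P x"
  by (rule free_Abelian_group_induct[of x "UNIV \<times> carrier H"]) (use assms in auto)

lemma rescale_rat_frags:
  assumes "x \<in> rat_frags"
  shows "rescale q x \<in> rat_frags"
  using assms by (induction rule: rat_frags_induct) (simp_all only: rescale_simps rat_frags_simps)

lemma relations_rat_frags: "rat_relations \<subseteq> rat_frags"
proof
  fix x assume "x \<in> rat_relations"
  then consider p p' h where "h \<in> carrier H" "x = frag_of (p + p', h) - (frag_of (p, h) + frag_of (p', h))"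
    | p h h' where "h \<in> carrier H" "h' \<in> carrier H" "x = frag_of (p, h \<otimes>\<^bsub>H\<^esub> h') - (frag_of (p, h) + frag_of (p, h'))"
    unfolding rat_relations_def tensor_relations_def by auto
  then show "x \<in> rat_frags"
  proof cases
    case 1
    show ?thesis unfolding 1(2) by (intro rat_frags_simps) (simp_all only: rat_frags_simps 1)
  next
    case 2
    show ?thesis unfolding 2(3) by (intro rat_frags_simps) (simp_all only: rat_frags_simps 2 H.m_closed)
  qed
qed

lemma rel_kernel_induct [consumes 1, case_names zero pos neg add]:
  assumes "y \<in> rel_kernel" "P 0"
    "\<And>x. x \<in> rat_relations \<Longrightarrow> P x"
    "\<And>x. x \<in> rat_relations \<Longrightarrow> P (- x)"
    "\<And>x y. x \<in> rel_kernel \<Longrightarrow> y \<in> rel_kernel \<Longrightarrow> P x \<Longrightarrow> P y \<Longrightarrow> P (x + y)"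
  shows "P y"
  using assms(1) unfolding rel_kernel_generate
proof (induction rule: generate.induct)
  case (inv x)
  then have "x \<in> rat_frags" using relations_rat_frags by blast
  then show ?case using assms(4)[OF inv] by simp
next
  case (eng x y)
  then show ?case using assms(5)[unfolded rel_kernel_generate, of x y] by simp
qed (use assms in auto)

lemma rel_kernel_simps:
  "0 \<in> rel_kernel"
  "x \<in> rel_kernel \<Longrightarrow> y \<in> rel_kernel \<Longrightarrow> x + y \<in> rel_kernel"
  "x \<in> rel_kernel \<Longrightarrow> - x \<in> rel_kernel"
  "x \<in> rat_relations \<Longrightarrow> x \<in> rel_kernel"
proof -
  show 0: "0 \<in> rel_kernel"
    unfolding rel_kernel_generate using generate.one[of "free_Abelian_group (UNIV \<times> carrier H)"] by simp
  show 1: "x \<in> rel_kernel \<Longrightarrow> y \<in> rel_kernel \<Longrightarrow> x + y \<in> rel_kernel" for x y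
    unfolding rel_kernel_generate using generate.eng[of x "free_Abelian_group (UNIV \<times> carrier H)" _ y] by simp
  show 2: "x \<in> rel_kernel" if "x \<in> rat_relations" for x
    unfolding rel_kernel_generate by (rule generate.incl[OF that])
  have 3: "- x \<in> rel_kernel" if x: "x \<in> rat_relations" for x
  proof -
    have "x \<in> rat_frags" using relations_rat_frags x by blast
    then show ?thesis unfolding rel_kernel_generate
      using generate.inv[OF x, of "free_Abelian_group (UNIV \<times> carrier H)"] by simp
  qed
  show "- x \<in> rel_kernel" if "x \<in> rel_kernel" for x
    using that
  proof (induction rule: rel_kernel_induct)
    case (add x y)
    then show ?case using 1[of "- x" "- y"] by simp
  qed (simp_all add: 0 2 3)
qed

lemma rel_kernel_rat_frags: "y \<in> rel_kernel \<Longrightarrow> y \<in> rat_frags"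
proof (induction rule: rel_kernel_induct)
  case (neg x)
  then show ?case using relations_rat_frags by auto
next
  case (add x y)
  then show ?case by (intro rat_frags_simps(3))
qed (use relations_rat_frags in auto)

lemma rel_kernel_diff: "x \<in> rel_kernel \<Longrightarrow> y \<in> rel_kernel \<Longrightarrow> x - y \<in> rel_kernel"
  using rel_kernel_simps(2)[OF _ rel_kernel_simps(3), of x y] by simp

lemma relation_left:
  "h \<in> carrier H \<Longrightarrow> frag_of (p + p', h) - (frag_of (p, h) + frag_of (p', h)) \<in> rat_relations"
  unfolding rat_relations_def tensor_relations_def by fastforce

lemma relation_right:
  "h \<in> carrier H \<Longrightarrow> h' \<in> carrier H \<Longrightarrow>
    frag_of (p, h \<otimes>\<^bsub>H\<^esub> h') - (frag_of (p, h) + frag_of (p, h')) \<in> rat_relations"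
  unfolding rat_relations_def tensor_relations_def by fastforce

lemma relation_cases:
  assumes "x \<in> rat_relations"
  obtains p p' h where "h \<in> carrier H" "x = frag_of (p + p', h) - (frag_of (p, h) + frag_of (p', h))"
    | p h h' where "h \<in> carrier H" "h' \<in> carrier H" "x = frag_of (p, h \<otimes>\<^bsub>H\<^esub> h') - (frag_of (p, h) + frag_of (p, h'))"
  using assms unfolding rat_relations_def tensor_relations_def by auto

text \<open>Multiplication by \<open>q\<close> is additive, so rescaling sends each defining
  relation to a relation.\<close>

lemma rescale_rel_kernel:
  assumes "y \<in> rel_kernel"
  shows "rescale q y \<in> rel_kernel"
proof -
  have rel: "rescale q x \<in> rel_kernel" if "x \<in> rat_relations" for x
    using that
  proof (cases rule: relation_cases)
    case (1 p p' h)
    then show ?thesis using rel_kernel_simps(4)[OF relation_left[of h "q * p" "q * p'"]] by (simp add: distrib_left)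
  next
    case (2 p h h')
    then show ?thesis using rel_kernel_simps(4)[OF relation_right[of h h' "q * p"]] by simp
  qed
  from assms show ?thesis
    by (induction rule: rel_kernel_induct) (simp_all add: rel_kernel_simps rel)
qed

lemma tcls_eq: "tcls x = tcls y \<longleftrightarrow> x - y \<in> rel_kernel"
proof
  assume "tcls x = tcls y"
  moreover have "x \<in> tcls x" unfolding tcls_def using rel_kernel_simps(1) by force
  ultimately obtain k where "k \<in> rel_kernel" "x = k + y" unfolding tcls_def by blast
  then show "x - y \<in> rel_kernel" by simp
next
  assume xy: "x - y \<in> rel_kernel"
  have "k + x \<in> tcls y" if "k \<in> rel_kernel" for k
    unfolding tcls_def using rel_kernel_simps(2)[OF that xy] by (intro image_eqI[of _ _ "k + (x - y)"]) auto
  moreover have "k + y \<in> tcls x" if "k \<in> rel_kernel" for k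
    unfolding tcls_def using rel_kernel_diff[OF that xy] by (intro image_eqI[of _ _ "k - (x - y)"]) auto
  ultimately show "tcls x = tcls y" unfolding tcls_def by blast
qed

lemma r_coset_tcls: "rel_kernel #>\<^bsub>free_Abelian_group S\<^esub> x = tcls x"
  unfolding r_coset_def tcls_def by auto

lemma rat_tensor_carrier: "carrier (rat_tensor H) = tcls ` rat_frags"
  unfolding rat_tensor_def Let_def tensor_group_def FactGroup_def RCOSETS_def rel_kernel_def[symmetric] r_coset_tcls
  by auto

lemma rat_tensor_zero: "\<zero>\<^bsub>rat_tensor H\<^esub> = tcls 0"
  unfolding rat_tensor_def Let_def tensor_group_def FactGroup_def rel_kernel_def[symmetric]
  by (simp add: tcls_def)

lemma rat_tensor_add: "tcls x \<oplus>\<^bsub>rat_tensor H\<^esub> tcls y = tcls (x + y)"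
proof -
  have "tcls x \<oplus>\<^bsub>rat_tensor H\<^esub> tcls y = (\<Union>a\<in>tcls x. \<Union>b\<in>tcls y. {a + b})"
    unfolding rat_tensor_def Let_def tensor_group_def FactGroup_def rel_kernel_def[symmetric]
    by (simp add: set_mult_def)
  also have "\<dots> = tcls (x + y)"
  proof (intro equalityI subsetI)
    fix z assume "z \<in> (\<Union>a\<in>tcls x. \<Union>b\<in>tcls y. {a + b})"
    then obtain k l where "k \<in> rel_kernel" "l \<in> rel_kernel" "z = (k + x) + (l + y)" unfolding tcls_def by blast
    then show "z \<in> tcls (x + y)"
      unfolding tcls_def using rel_kernel_simps(2)[of k l] by (intro image_eqI[of _ _ "k + l"]) auto
  next
    fix z assume "z \<in> tcls (x + y)"
    then obtain k where k: "k \<in> rel_kernel" "z = (k + x) + y" unfolding tcls_def by (auto simp: add.assoc)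
    moreover have "y \<in> tcls y" unfolding tcls_def using rel_kernel_simps(1) by force
    moreover have "k + x \<in> tcls x" unfolding tcls_def using k(1) by blast
    ultimately show "z \<in> (\<Union>a\<in>tcls x. \<Union>b\<in>tcls y. {a + b})" by blast
  qed
  finally show ?thesis .
qed

text \<open>Rescaling preserves the kernel, so all members of the union in the definition are one
  and the same coset; the union is over a nonempty set because \<open>0\<close> is in the
  kernel.\<close>

lemma rat_tensor_smult: "q \<odot>\<^bsub>rat_tensor H\<^esub> tcls x = tcls (rescale q x)"
proof -
  have "q \<odot>\<^bsub>rat_tensor H\<^esub> tcls x = (\<Union>y\<in>tcls x. tcls (rescale q y))"
    unfolding rat_tensor_def Let_def rel_kernel_def[symmetric] r_coset_tcls rescale_def by simp
  also have "tcls (rescale q y) = tcls (rescale q x)" if y: "y \<in> tcls x" for y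
  proof -
    obtain k where k: "k \<in> rel_kernel" "y = k + x" using y unfolding tcls_def by blast
    then show ?thesis unfolding tcls_eq using rescale_rel_kernel[of k q] by simp
  qed
  then have "(\<Union>y\<in>tcls x. tcls (rescale q y)) = (\<Union>y\<in>tcls x. tcls (rescale q x))" by simp
  also have "\<dots> = tcls (rescale q x)" unfolding tcls_def using rel_kernel_simps(1) by auto
  finally show ?thesis .
qed

lemma rescale_mult: "rescale (p * q) x = rescale p (rescale q x)"
proof -
  have "keys x \<subseteq> UNIV" by simp
  then show ?thesis
    by (induction x rule: frag_induction) (auto simp: mult.assoc)
qed

lemma rescale_one: "rescale 1 x = x"
proof -
  have "keys x \<subseteq> UNIV" by simp
  then show ?thesis
    by (induction x rule: frag_induction) auto
qed

text \<open>The one scalar law that fails for formal sums and relies on the relations in the left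
  argument; the others hold before passing to cosets.\<close>

lemma rescale_add: "x \<in> rat_frags \<Longrightarrow> rescale (p + q) x - (rescale p x + rescale q x) \<in> rel_kernel"
proof (induction rule: rat_frags_induct)
  case (diff x y)
  then show ?case using rel_kernel_diff[OF diff.IH] by (simp add: algebra_simps)
next
  case (frag r h)
  then show ?case using rel_kernel_simps(4)[OF relation_left[of h "p * r" "q * r"]] by (simp add: distrib_right)
qed (simp add: rel_kernel_simps)

lemma vectorspace_rat_tensor: "vectorspace rat_field (rat_tensor H)"
proof (rule vs_criteria)
  show "field rat_field" by (rule class_field)
  note simps = rat_tensor_carrier rat_tensor_zero rat_tensor_add rat_tensor_smult
  show "\<zero>\<^bsub>rat_tensor H\<^esub> \<in> carrier (rat_tensor H)"
    unfolding simps by (intro imageI rat_frags_simps)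
  show "\<forall>v w. v \<in> carrier (rat_tensor H) \<and> w \<in> carrier (rat_tensor H) \<longrightarrow> v \<oplus>\<^bsub>rat_tensor H\<^esub> w \<in> carrier (rat_tensor H)"
    unfolding rat_tensor_carrier
    by (clarsimp simp only: rat_tensor_add) (intro imageI CollectI rat_frags_simps[simplified mem_Collect_eq])
  show "\<forall>v\<in>carrier (rat_tensor H). \<exists>neg_v\<in>carrier (rat_tensor H). v \<oplus>\<^bsub>rat_tensor H\<^esub> neg_v = \<zero>\<^bsub>rat_tensor H\<^esub>"
  proof
    fix v assume "v \<in> carrier (rat_tensor H)"
    then obtain x where x: "x \<in> rat_frags" "v = tcls x" unfolding rat_tensor_carrier by blast
    have "tcls (- x) \<in> carrier (rat_tensor H)" unfolding rat_tensor_carrier by (intro imageI rat_frags_simps(5) x)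
    moreover have "v \<oplus>\<^bsub>rat_tensor H\<^esub> tcls (- x) = \<zero>\<^bsub>rat_tensor H\<^esub>" by (simp add: x(2) simps)
    ultimately show "\<exists>neg_v\<in>carrier (rat_tensor H). v \<oplus>\<^bsub>rat_tensor H\<^esub> neg_v = \<zero>\<^bsub>rat_tensor H\<^esub>" by blast
  qed
  show "\<forall>c v. c \<in> carrier rat_field \<and> v \<in> carrier (rat_tensor H) \<longrightarrow> c \<odot>\<^bsub>rat_tensor H\<^esub> v \<in> carrier (rat_tensor H)"
  proof (intro allI impI, elim conjE)
    fix c v assume "v \<in> carrier (rat_tensor H)"
    then obtain x where x: "x \<in> rat_frags" "v = tcls x" unfolding rat_tensor_carrier by blast
    show "c \<odot>\<^bsub>rat_tensor H\<^esub> v \<in> carrier (rat_tensor H)"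
      unfolding x(2) simps by (intro imageI rescale_rat_frags x)
  qed
  show "\<forall>a b v. a \<in> carrier rat_field \<and> b \<in> carrier rat_field \<and> v \<in> carrier (rat_tensor H) \<longrightarrow>
      (a \<oplus>\<^bsub>rat_field\<^esub> b) \<odot>\<^bsub>rat_tensor H\<^esub> v = a \<odot>\<^bsub>rat_tensor H\<^esub> v \<oplus>\<^bsub>rat_tensor H\<^esub> b \<odot>\<^bsub>rat_tensor H\<^esub> v"
  proof (intro allI impI, elim conjE)
    fix a b v assume "v \<in> carrier (rat_tensor H)"
    then obtain x where x: "x \<in> rat_frags" "v = tcls x" unfolding rat_tensor_carrier by blast
    show "(a \<oplus>\<^bsub>rat_field\<^esub> b) \<odot>\<^bsub>rat_tensor H\<^esub> v = a \<odot>\<^bsub>rat_tensor H\<^esub> v \<oplus>\<^bsub>rat_tensor H\<^esub> b \<odot>\<^bsub>rat_tensor H\<^esub> v"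
      unfolding x(2) simps tcls_eq using rescale_add[OF x(1)] by simp
  qed
qed (auto simp: rat_tensor_carrier rat_tensor_zero rat_tensor_add rat_tensor_smult add_ac rescale_mult rescale_one)

end

lemma group_rank_finite_iff:
  "group_rank H < \<infinity> \<longleftrightarrow> vectorspace.fin_dim rat_field (rat_tensor H)"
  by (simp add: group_rank_def)

section \<open>The canonical map into the rational vector space\<close>

definition emb :: "('h, 'm) monoid_scheme \<Rightarrow> 'h \<Rightarrow> (rat \<times> 'h \<Rightarrow>\<^sub>0 int) set" where
  "emb H h = tcls H (frag_of (1, h))"

context
  fixes H :: "('h, 'm) monoid_scheme"
  assumes H: "comm_group H"
begin

interpretation H: comm_group H by (rule H)
interpretation V: vectorspace rat_field "rat_tensor H" by (rule vectorspace_rat_tensor[OF H])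

lemma emb_closed: "h \<in> carrier H \<Longrightarrow> emb H h \<in> carrier (rat_tensor H)"
  unfolding emb_def rat_tensor_carrier[OF H] by (intro imageI rat_frags_simps(2)[OF H, THEN iffD2])

lemma emb_mult:
  assumes "h \<in> carrier H" "h' \<in> carrier H"
  shows "emb H (h \<otimes>\<^bsub>H\<^esub> h') = emb H h \<oplus>\<^bsub>rat_tensor H\<^esub> emb H h'"
  unfolding emb_def rat_tensor_add[OF H] tcls_eq[OF H]
  by (rule rel_kernel_simps(4)[OF H relation_right[OF H assms]])

lemma emb_one: "emb H \<one>\<^bsub>H\<^esub> = \<zero>\<^bsub>rat_tensor H\<^esub>"
  using emb_mult[of "\<one>\<^bsub>H\<^esub>" "\<one>\<^bsub>H\<^esub>"] emb_closed[of "\<one>\<^bsub>H\<^esub>"]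
  by (metis H.one_closed H.r_one V.M.add.r_cancel_one')

lemma emb_inv:
  assumes "h \<in> carrier H"
  shows "emb H (inv\<^bsub>H\<^esub> h) = \<ominus>\<^bsub>rat_tensor H\<^esub> emb H h"
proof -
  have "emb H (inv\<^bsub>H\<^esub> h) \<oplus>\<^bsub>rat_tensor H\<^esub> emb H h = \<zero>\<^bsub>rat_tensor H\<^esub>"
    using emb_mult[of "inv\<^bsub>H\<^esub> h" h] assms by (simp add: emb_one)
  then show ?thesis using assms by (intro V.M.minus_equality[symmetric] emb_closed) auto
qed

lemma emb_pow: "h \<in> carrier H \<Longrightarrow> emb H (h [^]\<^bsub>H\<^esub> (n::nat)) = of_nat n \<odot>\<^bsub>rat_tensor H\<^esub> emb H h"
proof (induction n)
  case 0
  then show ?case using V.smult_l_null[OF emb_closed] by (simp add: emb_one)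
next
  case (Suc n)
  have "of_nat (Suc n) \<odot>\<^bsub>rat_tensor H\<^esub> emb H h = of_nat n \<odot>\<^bsub>rat_tensor H\<^esub> emb H h \<oplus>\<^bsub>rat_tensor H\<^esub> 1 \<odot>\<^bsub>rat_tensor H\<^esub> emb H h"
    using V.smult_l_distr[of "of_nat n" 1 "emb H h"] emb_closed Suc.prems by (simp add: add.commute)
  then show ?case using Suc V.smult_one[OF emb_closed] by (simp add: emb_mult)
qed

lemma submodule_uminus:
  assumes W: "submodule rat_field W (rat_tensor H)" and v: "v \<in> W"
  shows "\<ominus>\<^bsub>rat_tensor H\<^esub> v \<in> W"
proof -
  interpret W: submodule rat_field W "rat_tensor H" by (rule W)
  have vV: "v \<in> carrier (rat_tensor H)" using v W.subset by blast
  have "(- 1) \<odot>\<^bsub>rat_tensor H\<^esub> v \<oplus>\<^bsub>rat_tensor H\<^esub> 1 \<odot>\<^bsub>rat_tensor H\<^esub> v = \<zero>\<^bsub>rat_tensor H\<^esub>"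
    using V.smult_l_distr[of "- 1" 1 v] V.smult_l_null[OF vV] vV by simp
  then have "\<ominus>\<^bsub>rat_tensor H\<^esub> v = (- 1) \<odot>\<^bsub>rat_tensor H\<^esub> v"
    using V.smult_one[OF vV] V.smult_closed[of "- 1" v] vV by (intro V.M.minus_equality) auto
  then show ?thesis using W.smult_closed[of "- 1" v] v by simp
qed

text \<open>Every \<open>p \<otimes> h\<close> is the scalar multiple by \<open>p\<close> of
  \<open>1 \<otimes> h\<close>, and pure tensors generate the group.\<close>

lemma submodule_all:
  assumes W: "submodule rat_field W (rat_tensor H)" and emb: "\<And>h. h \<in> carrier H \<Longrightarrow> emb H h \<in> W"
  shows "W = carrier (rat_tensor H)"
proof
  interpret W: submodule rat_field W "rat_tensor H" by (rule W)
  show "W \<subseteq> carrier (rat_tensor H)" by (rule W.subset)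
  have "tcls H x \<in> W" if "x \<in> {x. keys x \<subseteq> UNIV \<times> carrier H}" for x
    using that
  proof (induction rule: rat_frags_induct[OF H, consumes 1, case_names zero diff frag])
    case zero
    show ?case using emb[of "\<one>\<^bsub>H\<^esub>"] by (simp add: emb_one rat_tensor_zero[OF H])
  next
    case (diff x y)
    have y: "tcls H y \<in> carrier (rat_tensor H)" "tcls H (- y) \<in> carrier (rat_tensor H)"
      unfolding rat_tensor_carrier[OF H] using diff.hyps rat_frags_simps(5)[OF H] by blast+
    have "tcls H (- y) \<oplus>\<^bsub>rat_tensor H\<^esub> tcls H y = \<zero>\<^bsub>rat_tensor H\<^esub>"
      by (simp add: rat_tensor_add[OF H] rat_tensor_zero[OF H])
    then have "tcls H (- y) = \<ominus>\<^bsub>rat_tensor H\<^esub> tcls H y" using y by (intro V.M.minus_equality[symmetric])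
    then have "tcls H (- y) \<in> W" using submodule_uminus[OF W diff.IH(2)] by simp
    then have "tcls H x \<oplus>\<^bsub>rat_tensor H\<^esub> tcls H (- y) \<in> W" using diff.IH(1) by (intro W.m_closed)
    then show ?case by (simp add: rat_tensor_add[OF H])
  next
    case (frag p h)
    have "p \<odot>\<^bsub>rat_tensor H\<^esub> emb H h \<in> W" using emb[OF frag] W.smult_closed by simp
    then show ?case by (simp add: emb_def rat_tensor_smult[OF H])
  qed
  then show "carrier (rat_tensor H) \<subseteq> W" unfolding rat_tensor_carrier[OF H] by blast
qed

text \<open>If the \<open>n\<close>-th power of \<open>s\<close> lies in the group generated by
  \<open>F\<close>, then \<open>1 \<otimes> s\<close> is \<open>1 / n\<close> times a member of the
  span of the image of \<open>F\<close>. So finite generation up to multiples becomes finite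
  dimension.\<close>

lemma fin_dim_rat_tensor:
  assumes S: "S \<subseteq> carrier H" "carrier H = generate H S" and F: "finite F" "F \<subseteq> S"
    and pow: "\<And>s. s \<in> S \<Longrightarrow> \<exists>n::nat. 0 < n \<and> s [^]\<^bsub>H\<^esub> n \<in> generate H F"
  shows "V.fin_dim"
proof -
  have F': "emb H ` F \<subseteq> carrier (rat_tensor H)" using F S emb_closed by blast
  define W where "W = V.span (emb H ` F)"
  have W: "submodule rat_field W (rat_tensor H)" unfolding W_def by (rule V.span_is_submodule[OF F'])
  interpret W: submodule rat_field W "rat_tensor H" by (rule W)
  have zero: "\<zero>\<^bsub>rat_tensor H\<^esub> \<in> W"
    unfolding W_def V.span_def by (intro CollectI exI[of _ "\<lambda>_. 0"] exI[of _ "{}"]) (simp add: V.lincomb_def)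
  have closed: "emb H h \<in> W" if X: "X \<subseteq> carrier H" "emb H ` X \<subseteq> W" and h: "h \<in> generate H X" for X h
    using h
  proof (induction rule: generate.induct)
    case one
    show ?case unfolding emb_one by (rule zero)
  next
    case (inv h)
    then have "h \<in> carrier H" "emb H h \<in> W" using X by blast+
    then show ?case using emb_inv[of h] submodule_uminus[OF W, of "emb H h"] by simp
  next
    case (eng h1 h2)
    then show ?case using H.generate_in_carrier[OF X(1)] by (simp add: emb_mult W.m_closed)
  qed (use X in auto)
  have "emb H s \<in> W" if s: "s \<in> S" for s
  proof -
    obtain n :: nat where n: "0 < n" "s [^]\<^bsub>H\<^esub> n \<in> generate H F" using pow[OF s] by blast
    have sc: "s \<in> carrier H" using s S by blast
    have "emb H ` F \<subseteq> W" unfolding W_def by (rule V.in_own_span[OF F'])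
    then have "emb H (s [^]\<^bsub>H\<^esub> n) \<in> W" using n F S by (intro closed[of F]) auto
    then have "(1 / of_nat n) \<odot>\<^bsub>rat_tensor H\<^esub> (of_nat n \<odot>\<^bsub>rat_tensor H\<^esub> emb H s) \<in> W"
      unfolding emb_pow[OF sc] using W.smult_closed by simp
    then show ?thesis
      using V.smult_assoc1[of "1 / of_nat n" "of_nat n" "emb H s"] V.smult_one emb_closed[OF sc] n(1) by simp
  qed
  then have "emb H h \<in> W" if "h \<in> carrier H" for h using that S by (intro closed[of S]) auto
  then have "W = carrier (rat_tensor H)" by (rule submodule_all[OF W])
  then show ?thesis unfolding V.fin_dim_def W_def using F' F(1) by blast
qed

text \<open>On formal sums, send \<open>p \<otimes> k\<close> to \<open>k\<close> raised to the
  power \<open>\<lfloor>M p\<rfloor>\<close>. This map is not biadditive, but it kills a relation in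
  the left argument once \<open>M\<close> clears the two denominators, and a member of the kernel
  involves only finitely many relations. Applied to the difference of \<open>1 \<otimes> h\<close>
  and \<open>1 \<otimes> h'\<close>, it yields the torsion equation.\<close>

lemma rel_kernel_torsion:
  assumes "h \<in> carrier H" "h' \<in> carrier H" "emb H h = emb H h'"
  shows "\<exists>M::nat. 0 < M \<and> (h \<otimes>\<^bsub>H\<^esub> inv\<^bsub>H\<^esub> h') [^]\<^bsub>H\<^esub> M = \<one>\<^bsub>H\<^esub>"
proof -
  let ?F = "free_Abelian_group (UNIV \<times> carrier H) :: (rat \<times> 'h \<Rightarrow>\<^sub>0 int) monoid"
  have "\<exists>\<Phi>. \<Phi> \<in> hom ?F H \<and> (\<forall>p. \<forall>k\<in>carrier H. \<Phi> (frag_of (p, k)) = k [^]\<^bsub>H\<^esub> \<lfloor>of_nat M * p\<rfloor>)" for M :: nat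
  proof -
    obtain \<Phi> where "\<Phi> \<in> hom ?F H" "\<And>x. x \<in> UNIV \<times> carrier H \<Longrightarrow> \<Phi> (frag_of x) = (\<lambda>(p, k). k [^]\<^bsub>H\<^esub> \<lfloor>of_nat M * p\<rfloor>) x"
      by (rule H.free_Abelian_group_universal[of "\<lambda>(p, k). k [^]\<^bsub>H\<^esub> \<lfloor>of_nat M * (p::rat)\<rfloor>" "UNIV \<times> carrier H"]) auto
    then show ?thesis by auto
  qed
  then obtain \<Phi> where \<Phi>: "\<And>M::nat. \<Phi> M \<in> hom ?F H"
      "\<And>M p k. k \<in> carrier H \<Longrightarrow> \<Phi> M (frag_of (p, k)) = k [^]\<^bsub>H\<^esub> \<lfloor>of_nat M * p\<rfloor>" by metis
  have \<Phi>_hom: "group_hom ?F H (\<Phi> M)" for M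
    by (simp add: group_hom_def group_hom_axioms_def \<Phi>(1))
  have \<Phi>_add: "\<Phi> M (x + y) = \<Phi> M x \<otimes>\<^bsub>H\<^esub> \<Phi> M y" if "x \<in> carrier ?F" "y \<in> carrier ?F" for M x y
    using hom_mult[OF \<Phi>(1) that] by simp
  have \<Phi>_neg: "\<Phi> M (- x) = inv\<^bsub>H\<^esub> \<Phi> M x" if "x \<in> carrier ?F" for M x
    using group_hom.hom_inv[OF \<Phi>_hom that] that by simp
  have \<Phi>_carr: "\<Phi> M x \<in> carrier H" if "x \<in> carrier ?F" for M x
    using hom_in_carrier[OF \<Phi>(1) that] .
  have \<Phi>_rel: "\<Phi> M (x - (y + z)) = \<one>\<^bsub>H\<^esub>" if "x \<in> carrier ?F" "y \<in> carrier ?F" "z \<in> carrier ?F" "\<Phi> M x = \<Phi> M y \<otimes>\<^bsub>H\<^esub> \<Phi> M z" for M x y z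
  proof -
    have yz: "y + z \<in> carrier ?F" using monoid.m_closed[of ?F y z] that by (simp add: group.is_monoid)
    then have "- (y + z) \<in> carrier ?F" unfolding carrier_free_Abelian_group_iff keys_minus .
    then have "\<Phi> M (x + - (y + z)) = \<Phi> M x \<otimes>\<^bsub>H\<^esub> inv\<^bsub>H\<^esub> \<Phi> M (y + z)" using that(1) yz \<Phi>_add \<Phi>_neg by metis
    then have "\<Phi> M (x - (y + z)) = \<Phi> M x \<otimes>\<^bsub>H\<^esub> inv\<^bsub>H\<^esub> \<Phi> M (y + z)" by (simp only: diff_conv_add_uminus)
    then show ?thesis using that \<Phi>_add \<Phi>_carr by simp
  qed
  \<comment> \<open>The claim is made for all positive multiples \<open>N\<close> of
    \<open>M\<close>, so that the bounds for two summands combine to their product.\<close>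
  have kernel: "\<exists>M>0. \<forall>N>0. M dvd N \<longrightarrow> \<Phi> N y = \<one>\<^bsub>H\<^esub>" if "y \<in> rel_kernel H" for y
  proof -
    have rel: "\<exists>M>0. \<forall>N>0. M dvd N \<longrightarrow> \<Phi> N x = \<one>\<^bsub>H\<^esub>" if "x \<in> rat_relations H" for x
      using that
    proof (cases rule: relation_cases[OF H, consumes 1, case_names left right])
      case (left p p' k)
      obtain M :: nat where M: "M > 0" "\<forall>q\<in>{p, p'}. of_nat M * q \<in> \<int>" using common_denominator[of "{p, p'}"] by auto
      have "\<Phi> N x = \<one>\<^bsub>H\<^esub>" if N: "M dvd N" for N
        unfolding left(2)
      proof (rule \<Phi>_rel)
        obtain d where d: "N = d * M" using N by (metis dvd_div_mult_self)
        have "of_nat N * p \<in> \<int>" "of_nat N * p' \<in> \<int>"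
          using M(2) Ints_mult[OF Ints_of_nat[of d], of "of_nat M * p"] Ints_mult[OF Ints_of_nat[of d], of "of_nat M * p'"]
          by (simp_all add: d mult.assoc)
        then have "\<lfloor>of_nat N * p + of_nat N * p'\<rfloor> = \<lfloor>of_nat N * p\<rfloor> + \<lfloor>of_nat N * p'\<rfloor>"
          by (metis Ints_cases floor_add_int floor_of_int)
        then show "\<Phi> N (frag_of (p + p', k)) = \<Phi> N (frag_of (p, k)) \<otimes>\<^bsub>H\<^esub> \<Phi> N (frag_of (p', k))"
          using left(1) by (simp add: \<Phi>(2) distrib_left H.int_pow_mult)
      qed (use left in auto)
      then show ?thesis using M(1) by blast
    next
      case (right p k k')
      have "\<Phi> N x = \<one>\<^bsub>H\<^esub>" for N
        unfolding right(3)
        by (rule \<Phi>_rel) (use right in \<open>auto simp: \<Phi>(2) H.int_pow_distrib\<close>)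
      then show ?thesis by blast
    qed
    from that show ?thesis
    proof (induction rule: rel_kernel_induct[OF H, consumes 1, case_names zero pos neg add])
      case zero
      have "\<Phi> N 0 = \<one>\<^bsub>H\<^esub>" for N using group_hom.hom_one[OF \<Phi>_hom] by simp
      then show ?case by blast
    next
      case (neg x)
      have "x \<in> carrier ?F" using relations_rat_frags[OF H] neg by auto
      then have inv: "\<Phi> N (- x) = inv\<^bsub>H\<^esub> \<Phi> N x" for N by (rule \<Phi>_neg)
      obtain M where "M > 0" "\<forall>N>0. M dvd N \<longrightarrow> \<Phi> N x = \<one>\<^bsub>H\<^esub>" using rel[OF neg] by blast
      then show ?case unfolding inv by (intro exI[of _ M]) simp
    next
      case (add x y)
      then obtain M1 M2 where M: "M1 > 0" "\<forall>N>0. M1 dvd N \<longrightarrow> \<Phi> N x = \<one>\<^bsub>H\<^esub>" "M2 > 0" "\<forall>N>0. M2 dvd N \<longrightarrow> \<Phi> N y = \<one>\<^bsub>H\<^esub>"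
        by blast
      have "x \<in> carrier ?F" "y \<in> carrier ?F"
        using rel_kernel_rat_frags[OF H add(1)] rel_kernel_rat_frags[OF H add(2)] by auto
      then have "\<Phi> N (x + y) = \<one>\<^bsub>H\<^esub>" if "N > 0" "M1 * M2 dvd N" for N
        using M that \<Phi>_add dvd_mult_left dvd_mult_right by (metis H.one_closed H.r_one)
      then show ?case using M by (intro exI[of _ "M1 * M2"]) auto
    qed (rule rel)
  qed
  have "frag_of (1, h) - frag_of (1, h') \<in> rel_kernel H" using assms(3) by (simp add: emb_def tcls_eq[OF H])
  from kernel[OF this] obtain M where M0: "M > 0"
    "\<forall>N>0. M dvd N \<longrightarrow> \<Phi> N (frag_of (1, h) - frag_of (1, h')) = \<one>\<^bsub>H\<^esub>" by (elim exE conjE)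
  then have M: "M > 0" "\<Phi> M (frag_of (1, h) - frag_of (1, h')) = \<one>\<^bsub>H\<^esub>" by simp_all
  have "\<Phi> M (frag_of (1, h) + - frag_of (1, h')) = \<Phi> M (frag_of (1, h)) \<otimes>\<^bsub>H\<^esub> inv\<^bsub>H\<^esub> \<Phi> M (frag_of (1, h'))"
    using assms by (subst \<Phi>_add) (auto simp: \<Phi>_neg)
  then have "h [^]\<^bsub>H\<^esub> int M \<otimes>\<^bsub>H\<^esub> inv\<^bsub>H\<^esub> (h' [^]\<^bsub>H\<^esub> int M) = \<one>\<^bsub>H\<^esub>" using M(2) assms by (simp add: \<Phi>(2))
  then have "(h \<otimes>\<^bsub>H\<^esub> inv\<^bsub>H\<^esub> h') [^]\<^bsub>H\<^esub> int M = \<one>\<^bsub>H\<^esub>"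
    using assms by (simp only: H.int_pow_distrib H.inv_closed H.int_pow_inv)
  then show ?thesis using M(1) by (auto simp only: int_pow_int)
qed

text \<open>Coordinates with respect to a finite basis of \<open>\<rat> \<otimes> H\<close>. Equal
  coordinates mean equal images there, hence elements that differ by torsion, and torsion-freeness
  makes them equal.\<close>

lemma coordinates:
  assumes tf: "torsion_free H" and fd: "V.fin_dim"
  obtains r and \<phi> :: "'h \<Rightarrow> nat \<Rightarrow>\<^sub>0 rat" where "inj_on \<phi> (carrier H)"
    "\<And>x y. x \<in> carrier H \<Longrightarrow> y \<in> carrier H \<Longrightarrow> \<phi> (x \<otimes>\<^bsub>H\<^esub> y) = \<phi> x + \<phi> y"
    "\<And>x i. x \<in> carrier H \<Longrightarrow> r \<le> i \<Longrightarrow> lookup (\<phi> x) i = 0"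
proof -
  obtain \<beta> where \<beta>: "finite \<beta>" "V.basis \<beta>" using V.finite_basis_exists[OF fd] by blast
  have \<beta>V: "\<beta> \<subseteq> carrier (rat_tensor H)" using \<beta>(2) by (simp add: V.basis_def)
  have ex1: "\<exists>!a. a \<in> \<beta> \<rightarrow>\<^sub>E UNIV \<and> V.lincomb a \<beta> = v" if "v \<in> carrier (rat_tensor H)" for v
    using V.basis_criterion[OF \<beta>(1) \<beta>V] \<beta>(2) that by simp
  define co where "co v = (THE a. a \<in> \<beta> \<rightarrow>\<^sub>E UNIV \<and> V.lincomb a \<beta> = v)" for v
  have co: "co v \<in> \<beta> \<rightarrow>\<^sub>E UNIV" "V.lincomb (co v) \<beta> = v" if "v \<in> carrier (rat_tensor H)" for v
    using theI'[OF ex1[OF that]] by (auto simp: co_def)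
  have co_add: "co (u \<oplus>\<^bsub>rat_tensor H\<^esub> v) b = co u b + co v b"
    if uv: "u \<in> carrier (rat_tensor H)" "v \<in> carrier (rat_tensor H)" and b: "b \<in> \<beta>" for u v b
  proof -
    let ?c = "\<lambda>b\<in>\<beta>. co u b + co v b"
    have "V.lincomb ?c \<beta> = V.lincomb (\<lambda>b. co u b + co v b) \<beta>"
      using \<beta>V by (intro V.lincomb_cong) auto
    also have "\<dots> = u \<oplus>\<^bsub>rat_tensor H\<^esub> v"
      using V.lincomb_sum[OF \<beta>(1) \<beta>V, of "co u" "co v"] co uv by simp
    finally have "co (u \<oplus>\<^bsub>rat_tensor H\<^esub> v) = ?c"
      unfolding co_def using uv by (intro the1_equality ex1) auto
    then show ?thesis using b by simp
  qed
  obtain f where f: "bij_betw f {0..<card \<beta>} \<beta>" using ex_bij_betw_nat_finite[OF \<beta>(1)] by blast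
  define \<phi> where "\<phi> h = Abs_poly_mapping (\<lambda>i. if i < card \<beta> then co (emb H h) (f i) else 0)" for h
  have lookup: "lookup (\<phi> h) i = (if i < card \<beta> then co (emb H h) (f i) else 0)" for h i
  proof -
    have "finite {i. (if i < card \<beta> then co (emb H h) (f i) else 0) \<noteq> 0}"
      by (rule finite_subset[of _ "{..<card \<beta>}"]) auto
    then show ?thesis unfolding \<phi>_def by simp
  qed
  show ?thesis
  proof (rule that[of \<phi> "card \<beta>"])
    show "\<phi> (x \<otimes>\<^bsub>H\<^esub> y) = \<phi> x + \<phi> y" if xy: "x \<in> carrier H" "y \<in> carrier H" for x y
    proof (rule poly_mapping_eqI)
      fix i
      have "f i \<in> \<beta>" if "i < card \<beta>" using bij_betwE[OF f] that by auto
      then show "lookup (\<phi> (x \<otimes>\<^bsub>H\<^esub> y)) i = lookup (\<phi> x + \<phi> y) i"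
        using xy by (simp add: lookup_add lookup emb_mult co_add emb_closed)
    qed
    show "inj_on \<phi> (carrier H)"
    proof (rule inj_onI)
      fix x y assume xy: "x \<in> carrier H" "y \<in> carrier H" "\<phi> x = \<phi> y"
      have "co (emb H x) = co (emb H y)"
      proof (rule PiE_ext[OF co(1) co(1)])
        fix b assume "b \<in> \<beta>"
        then obtain i where "i < card \<beta>" "b = f i" using bij_betw_imp_surj_on[OF f] by (metis atLeastLessThan_iff imageE)
        then show "co (emb H x) b = co (emb H y) b"
          using arg_cong[OF xy(3), of "\<lambda>p. lookup p i"] by (simp add: lookup)
      qed (use xy emb_closed in auto)
      then have "emb H x = emb H y" using co(2)[OF emb_closed] xy by metis
      then obtain M :: nat where "0 < M" "(x \<otimes>\<^bsub>H\<^esub> inv\<^bsub>H\<^esub> y) [^]\<^bsub>H\<^esub> M = \<one>\<^bsub>H\<^esub>"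
        using rel_kernel_torsion[OF xy(1,2)] by blast
      then have "x \<otimes>\<^bsub>H\<^esub> inv\<^bsub>H\<^esub> y = \<one>\<^bsub>H\<^esub>" using tf xy unfolding torsion_free_def by simp
      then show "x = y" using xy by (metis H.inv_closed H.inv_equality H.inv_inv)
    qed
  qed (simp add: lookup)
qed

end

section \<open>The rank of the generated subgroup and the conclusion\<close>

lemma group_rank_subgroup_generated:
  assumes G: "comm_group G" and S: "S \<subseteq> carrier G" and fr: "finite_rank G S"
  shows "group_rank (subgroup_generated G S) < \<infinity>"
proof -
  interpret G: comm_group G by (rule G)
  let ?H = "subgroup_generated G S"
  have H: "comm_group ?H" by (rule G.abelian_subgroup_generated[OF G])
  have carr: "carrier ?H = generate G S" using S by (simp add: subgroup_generated_def Int_absorb1)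
  \<comment> \<open>Subgroups generated by subsets of \<open>S\<close>, and likewise powers, may be
    computed in \<open>G\<close>.\<close>
  have gen: "generate ?H X = generate G X" if "X \<subseteq> S" for X
  proof -
    have "generate (G\<lparr>carrier := generate G S\<rparr>) X = generate G X"
      using that by (intro G.generate_consistent G.generate_is_subgroup S) (auto intro: generate.incl)
    then show ?thesis using S by (simp add: subgroup_generated_def Int_absorb1)
  qed
  have pow: "x [^]\<^bsub>?H\<^esub> (n::nat) = x [^]\<^bsub>G\<^esub> n" for x n
    by (simp add: nat_pow_def subgroup_generated_def)
  obtain F where F: "F \<subseteq> S" "finite F" "\<forall>s\<in>S. \<exists>n::nat. 0 < n \<and> s [^]\<^bsub>G\<^esub> n \<in> generate G F"
    using fr unfolding finite_rank_def by (elim exE conjE)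
  have "vectorspace.fin_dim rat_field (rat_tensor ?H)"
  proof (rule fin_dim_rat_tensor[OF H _ _ F(2,1)])
    show "S \<subseteq> carrier ?H" unfolding carr by (auto intro: generate.incl)
    show "carrier ?H = generate ?H S" unfolding carr gen[OF order_refl] ..
    show "\<exists>n::nat. 0 < n \<and> s [^]\<^bsub>?H\<^esub> n \<in> generate ?H F" if "s \<in> S" for s
      unfolding pow gen[OF F(1)] using F(3) that by simp
  qed
  then show ?thesis by (rule group_rank_finite_iff[THEN iffD2])
qed

theorem theorem1p3:
  fixes G :: "('g, 'm) monoid_scheme"
  assumes "comm_group G" and "torsion_free G"
  shows "(\<forall>(R :: ('r, 'n) ring_scheme) A.
            graded_ring R G A \<and> noetherian_ring R \<longrightarrow>
              group_rank (subgroup_generated G (graded_supp R G A)) < \<infinity>) \<and>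
         (group_rank G < \<infinity> \<longrightarrow>
            (\<exists>(R :: ('g \<Rightarrow> rat) ring) A.
               graded_ring R G A \<and> noetherian_ring R \<and> graded_supp R G A = carrier G \<and>
               carrier (subgroup_generated G (graded_supp R G A)) = carrier G))"
proof (intro conjI allI impI; (elim conjE)?)
  fix R :: "('r, 'n) ring_scheme" and A
  assume "graded_ring R G A" "noetherian_ring R"
  then have "finite_rank G (graded_supp R G A)" by (rule graded_ring.finite_rank_supp)
  then show "group_rank (subgroup_generated G (graded_supp R G A)) < \<infinity>"
    by (intro group_rank_subgroup_generated assms(1)) (auto simp: graded_supp_def)
next
  interpret G: comm_group G by (rule assms(1))
  assume "group_rank G < \<infinity>"
  then have "vectorspace.fin_dim rat_field (rat_tensor G)" by (rule group_rank_finite_iff[THEN iffD1])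
  then obtain r and \<phi> :: "'g \<Rightarrow> nat \<Rightarrow>\<^sub>0 rat" where \<phi>: "inj_on \<phi> (carrier G)"
    "\<And>x y. x \<in> carrier G \<Longrightarrow> y \<in> carrier G \<Longrightarrow> \<phi> (x \<otimes>\<^bsub>G\<^esub> y) = \<phi> x + \<phi> y"
    "\<And>x i. x \<in> carrier G \<Longrightarrow> r \<le> i \<Longrightarrow> lookup (\<phi> x) i = 0"
    by (rule coordinates[OF assms]) (rule that; assumption)
  have "\<exists>(R :: ('g \<Rightarrow> rat) ring) A. graded_ring R G A \<and> noetherian_ring R \<and> graded_supp R G A = carrier G"
    by (rule graded_noetherian_ring_exists[OF assms(1) \<phi>(1)]) (rule \<phi>; assumption)+
  then obtain R :: "('g \<Rightarrow> rat) ring" and A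
    where R: "graded_ring R G A \<and> noetherian_ring R \<and> graded_supp R G A = carrier G"
    by (elim exE)
  moreover have "carrier (subgroup_generated G (carrier G)) = carrier G"
    by (simp add: G.subgroup_generated_group_carrier)
  ultimately show "\<exists>(R :: ('g \<Rightarrow> rat) ring) A.
      graded_ring R G A \<and> noetherian_ring R \<and> graded_supp R G A = carrier G \<and>
      carrier (subgroup_generated G (graded_supp R G A)) = carrier G"
    by (intro exI[of _ R] exI[of _ A]) simp
qed

end
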